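(* Let $m\geq 2$ be an integer, let $p$ be a prime with $p\leq 1024$, and let $n\neq p$ be a positive integer divisible by $p$. Let $c_0\in\mathbb{C}$ be a root of $G_{m,n}$. Suppose that $G_{m,p}$ and $G_{m,n}$ are irreducible over $\mathbb{Q}$. Then $G_{m,p}(c_0)$ is not an algebraic unit.
   Context: For $c\in\mathbb{C}$ let $f_c(z)=z^2+c$, and let $a_i=a_i(c)=f_c^i(0)\in\mathbb{Z}[c]$ denote the $i$-th iterate of $0$ (so $a_0=0$, $a_1=c$, $a_{i}=a_{i-1}^2+c$). For integers $m\geq 2$, $n\geq1$, the Misiurewicz polynomial $G_{m,n}\in\mathbb{Z}[c]$ is defined by $$G_{m,n}(c)=\prod_{k\mid n}\big(a_{m+k-1}+a_{m-1}\big)^{\mu(n/k)}\cdot\begin{cases}\prod_{k\mid n}(a_k)^{-\mu(n/k)} & \text{if } n\mid m-1,\\ 1 & \text{if } n\nmid m-1,\end{cases}$$ where $\mu$ is the Möbius function; it is a monic polynomial with integer coefficients whose roots are the parameters $c$ for which $0$ is strictly preperiodic of exact type $(m,n)$ under $f_c$. *)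

theory Defs
  imports Complex_Main "HOL-Computational_Algebra.Computational_Algebra"
begin

definition quad_map :: "'a::comm_ring_1 \<Rightarrow> 'a \<Rightarrow> 'a" where
  "quad_map c z = z ^ 2 + c"

(* The iterates of 0 as elements of Z[c]: the parameter is the indeterminate [:0, 1:]. *)
definition crit_iter :: "nat \<Rightarrow> int poly" where
  "crit_iter i = (quad_map [:0, 1:] ^^ i) 0"

definition moebius :: "nat \<Rightarrow> int" where
  "moebius n = (if squarefree n then (- 1) ^ card (prime_factors n) else 0)"

(* The product has negative exponents, so it is first formed in the fraction field of Z[c].
   Only m \<ge> 2 and n \<ge> 1 are meaningful; m - 1 is then not truncated. *)
definition misiurewicz_fract :: "nat \<Rightarrow> nat \<Rightarrow> int poly fract" where
  "misiurewicz_fract m n =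
     (\<Prod>k | k dvd n. to_fract (crit_iter (m + k - 1) + crit_iter (m - 1)) powi moebius (n div k))
     * (if n dvd m - 1 then (\<Prod>k | k dvd n. to_fract (crit_iter k) powi (- moebius (n div k)))
        else 1)"

(* The element of Z[c] that the above fraction represents; it is unique because to_fract
   is injective, and it exists for all m \<ge> 2 and n \<ge> 1. *)
definition misiurewicz_poly :: "nat \<Rightarrow> nat \<Rightarrow> int poly" where
  "misiurewicz_poly m n = (THE g. to_fract g = misiurewicz_fract m n)"

(* A unit of the ring of all algebraic integers. *)
definition algebraic_unit :: "complex \<Rightarrow> bool" where
  "algebraic_unit u \<longleftrightarrow> algebraic_int u \<and> (\<exists>v. algebraic_int v \<and> u * v = 1)"

end

theory Submission
  imports Defs "Jordan_Normal_Form.Char_Poly"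
begin

text \<open>Suppose that \<open>G\<^bsub>m,p\<^esub>(c\<^sub>0)\<close> is a unit and let \<open>k = n / p\<close>. Its inverse is a polynomial in \<open>c\<^sub>0\<close>
  with integer coefficients, so irreducibility of \<open>G\<^bsub>m,n\<^esub>\<close> turns the relation around: \<open>G\<^bsub>m,n\<^esub>(c)\<close> is a
  unit at every root \<open>c\<close> of \<open>G\<^bsub>m,p\<^esub>\<close>. At such a root, \<open>G\<^bsub>m,n\<^esub>(c)\<close> equals \<open>\<Phi>\<^sub>k(\<lambda>)\<close> up to a unit, where
  \<open>\<lambda> = 2\<^sup>p a\<^sub>m \<dots> a\<^bsub>m+p-1\<^esub>\<close> is the multiplier of the \<open>p\<close>-cycle. Hence the polynomial \<open>y(X) = \<Prod>\<^sub>c (1 - \<lambda>\<^sub>c X)\<close>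
  takes unit values at the primitive \<open>k\<close>-th roots of unity \<open>\<zeta>\<close>, with norm 1 in absolute value.

  On the other hand, residues at infinity give a recursion in \<open>m\<close> for the low power sums of the cycle
  products \<open>a\<^sub>m \<dots> a\<^bsub>m+p-1\<^esub>\<close>, and the cycle products lie in the radical of 2. Together with bounds on their trace this yields
  \<open>y \<equiv> 1 - 2\<^sup>b u X\<close> modulo \<open>2\<^bsup>b+1\<^esup>\<close> with \<open>u\<close> odd and \<open>b \<ge> 2\<close>. For \<open>k > 2\<close>, \<open>(y(\<zeta>) - y(1/\<zeta>)) / 4\<close> is an
  algebraic integer whose norm is less than 1, so it vanishes; this contradicts \<open>u\<close> being odd. For \<open>k = 2\<close>, already \<open>\<bar>y(-1)\<bar> = 1\<close> is impossible.\<close>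

section \<open>Algebraic integers\<close>

text \<open>The relation that is turned around is an identity \<open>F * H - 1 = G * K\<close> in
  Z[X]: at a root of \<open>G\<close> it says that \<open>F\<close> is a unit, at a root of
  \<open>F\<close> that \<open>G\<close> is one. The main obstacle is the power of 2 in the linear
  coefficient \<open>2 ^ p * tau\<close> of \<open>y\<close>. The higher coefficients are only known
  to be divisible by \<open>2 ^ (2 * p + 1)\<close>, so \<open>tau\<close>, the trace of the cycle
  products, must not be divisible by \<open>2 ^ (p + 1)\<close>, and the 2-adic recursion alone does
  not decide this. Once \<open>p + 2 \<le> 2 ^ (m - 1)\<close>, the trace doubles from level to
  level and \<open>y\<close> is squared modulo a growing power of 2, so valuation and precision rise
  together and only levels with \<open>2 ^ (m - 2) \<le> p + 1\<close> remain. There, for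
  \<open>m \<ge> 3\<close>, \<open>tau = 2 ^ (m - 2) * (2 ^ p - 1) - s\<close> with \<open>s\<close>
  the sum of the \<open>p\<close>-th powers of the fixed points, and the size of \<open>tau\<close>
  is played against its divisibility by the prime \<open>p\<close>. The recursion is restricted to
  power sums with \<open>p * q + 2 \<le> 2 ^ m\<close> because the residue at infinity is excluded
  by a degree drop of two.\<close>

lemma algebraic_int_of_stable:
  fixes z :: complex and b :: "nat \<Rightarrow> complex" and c :: "nat \<Rightarrow> nat \<Rightarrow> int"
  assumes "\<And>i. i < n \<Longrightarrow> z * b i = (\<Sum>j<n. of_int (c i j) * b j)"
    and "i0 < n" "b i0 \<noteq> 0"
  shows "algebraic_int z"
proof -
  define A :: "int mat" where "A = mat n n (\<lambda>(i, j). c i j)"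
  define A' :: "complex mat" where "A' = map_mat of_int A"
  have A: "A \<in> carrier_mat n n" and A': "A' \<in> carrier_mat n n"
    by (auto simp: A_def A'_def)
  have "A' *\<^sub>v vec n b = z \<cdot>\<^sub>v vec n b"
  proof (rule eq_vecI)
    fix i assume "i < dim_vec (z \<cdot>\<^sub>v vec n b)"
    then have i: "i < n" by simp
    show "(A' *\<^sub>v vec n b) $ i = (z \<cdot>\<^sub>v vec n b) $ i"
      using i assms(1)[OF i] by (simp add: A'_def A_def scalar_prod_def lessThan_atLeast0)
  qed (simp add: A'_def A_def)
  moreover have "vec n b \<noteq> 0\<^sub>v n"
    using assms(2,3) by (metis index_vec index_zero_vec(1))
  ultimately have "eigenvalue A' z"
    using A' unfolding eigenvalue_def eigenvector_def
    by (metis carrier_matD(1) vec_carrier)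
  then have "poly (char_poly A') z = 0"
    using eigenvalue_root_char_poly[OF A'] by simp
  moreover have "char_poly A' = map_poly of_int (char_poly A)"
    unfolding A'_def using of_int_hom.char_poly_hom[OF A] by metis
  moreover have "monic (char_poly A)"
    using degree_monic_char_poly[OF A] by simp
  ultimately show ?thesis
    unfolding algebraic_int_altdef_ipoly by metis
qed

text \<open>The integer span of the \<open>x ^ i * y ^ j\<close>, with \<open>i\<close> and
  \<open>j\<close> below the degrees of the two monic equations, is stable under multiplication by
  \<open>x\<close> and by \<open>y\<close>, hence by their sum and their product. Such a stable
  multiplier is an eigenvalue of an integer matrix.\<close>

lemma algebraic_int_of_stable_span:
  fixes x y :: complex
  assumes "algebraic_int x" "algebraic_int y"
  shows "algebraic_int (x + y)" "algebraic_int (x * y)"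
proof -
  obtain p where p: "poly (map_poly of_int p) x = 0" "lead_coeff p = 1"
    using assms(1) unfolding algebraic_int_altdef_ipoly by blast
  obtain q where q: "poly (map_poly of_int q) y = 0" "lead_coeff q = 1"
    using assms(2) unfolding algebraic_int_altdef_ipoly by blast
  define d e where "d = degree p" and "e = degree q"
  have d: "d > 0"
  proof (rule ccontr)
    assume "\<not> d > 0"
    then have "p = 1" using p(2) by (metis d_def gr0I monic_degree_0)
    with p(1) show False by simp
  qed
  have e: "e > 0"
  proof (rule ccontr)
    assume "\<not> e > 0"
    then have "q = 1" using q(2) by (metis e_def gr0I monic_degree_0)
    with q(1) show False by simp
  qed
  have top: "z ^ degree r = (\<Sum>i<degree r. of_int (- coeff r i) * z ^ i)"
    if "poly (map_poly of_int r) z = 0" "lead_coeff r = 1" for r :: "int poly" and z :: complex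
  proof -
    have "0 = (\<Sum>i\<le>degree r. of_int (coeff r i) * z ^ i)"
      using that(1) by (simp add: poly_altdef coeff_map_poly)
    also have "\<dots> = (\<Sum>i<degree r. of_int (coeff r i) * z ^ i) + z ^ degree r"
      using that(2) by (simp add: lessThan_Suc_atMost[symmetric])
    finally show ?thesis
      by (simp add: sum_negf eq_neg_iff_add_eq_0 add.commute)
  qed
  define I where "I = {..<d} \<times> {..<e}"
  define b where "b = (\<lambda>(i, j). x ^ i * y ^ j)"
  define S where "S = {u. \<exists>c :: nat \<times> nat \<Rightarrow> int. u = (\<Sum>k\<in>I. of_int (c k) * b k)}"
  have fin: "finite I" by (simp add: I_def)
  have SI: "(\<Sum>k\<in>I. of_int (c k) * b k) \<in> S" for c
    unfolding S_def by blast
  have Sadd: "u + v \<in> S" if uv: "u \<in> S" "v \<in> S" for u v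
  proof -
    obtain c1 where "u = (\<Sum>k\<in>I. of_int (c1 k) * b k)" using uv unfolding S_def by blast
    moreover obtain c2 where "v = (\<Sum>k\<in>I. of_int (c2 k) * b k)" using uv unfolding S_def by blast
    ultimately have "u + v = (\<Sum>k\<in>I. of_int (c1 k + c2 k) * b k)"
      by (simp add: sum.distrib distrib_right)
    then show ?thesis using SI by metis
  qed
  have Smul: "of_int n * u \<in> S" if uv: "u \<in> S" for u n
  proof -
    obtain c1 where "u = (\<Sum>k\<in>I. of_int (c1 k) * b k)"
      using uv unfolding S_def by blast
    then have "of_int n * u = (\<Sum>k\<in>I. of_int (n * c1 k) * b k)"
      by (simp add: sum_distrib_left mult.assoc)
    then show ?thesis using SI by metis
  qed
  have S0: "0 \<in> S"
    using SI[of "\<lambda>_. 0"] by simp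
  have Ssum: "(\<Sum>k\<in>K. f k) \<in> S" if "\<And>k. k \<in> K \<Longrightarrow> f k \<in> S" for K :: "'k set" and f
    using that by (induction K rule: infinite_finite_induct) (auto intro: Sadd S0)
  have Sb: "b k \<in> S" if "k \<in> I" for k
  proof -
    have "b k = (\<Sum>l\<in>I. of_int (if l = k then 1 else 0) * b l)"
      using that fin by (simp add: if_distrib[of "\<lambda>t. of_int t * _"] sum.delta' if_distribR cong: if_cong)
    then show ?thesis using SI[of "\<lambda>l. if l = k then 1 else 0"] by metis
  qed
  have xS: "x * u \<in> S" if uv: "u \<in> S" for u
  proof -
    obtain c where c: "u = (\<Sum>k\<in>I. of_int (c k) * b k)" using uv unfolding S_def by blast
    have "x * b k \<in> S" if k: "k \<in> I" for k
    proof -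
      obtain i j where ij: "k = (i, j)" "i < d" "j < e" using k by (auto simp: I_def)
      show ?thesis
      proof (cases "Suc i < d")
        case True
        then have "b (Suc i, j) \<in> S" using ij by (intro Sb) (auto simp: I_def)
        then show ?thesis by (simp add: ij b_def mult_ac)
      next
        case False
        then have "Suc i = d" using ij by simp
        then have "x * b k = x ^ d * y ^ j" by (auto simp: ij b_def mult_ac)
        also have "\<dots> = (\<Sum>l<d. of_int (- coeff p l) * b (l, j))"
          unfolding d_def top[OF p] sum_distrib_right b_def by (simp add: mult.assoc)
        also have "\<dots> \<in> S" using ij by (intro Ssum Smul Sb) (auto simp: I_def)
        finally show ?thesis .
      qed
    qed
    then have "(\<Sum>k\<in>I. of_int (c k) * (x * b k)) \<in> S" by (intro Ssum Smul)
    then show ?thesis by (simp add: c sum_distrib_left mult_ac)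
  qed
  have yS: "y * u \<in> S" if uv: "u \<in> S" for u
  proof -
    obtain c where c: "u = (\<Sum>k\<in>I. of_int (c k) * b k)" using uv unfolding S_def by blast
    have "y * b k \<in> S" if k: "k \<in> I" for k
    proof -
      obtain i j where ij: "k = (i, j)" "i < d" "j < e" using k by (auto simp: I_def)
      show ?thesis
      proof (cases "Suc j < e")
        case True
        then have "b (i, Suc j) \<in> S" using ij by (intro Sb) (auto simp: I_def)
        then show ?thesis by (simp add: ij b_def mult_ac)
      next
        case False
        then have "Suc j = e" using ij by simp
        then have "y * b k = x ^ i * y ^ e" by (auto simp: ij b_def mult_ac)
        also have "\<dots> = (\<Sum>l<e. of_int (- coeff q l) * b (i, l))"
          unfolding e_def top[OF q] sum_distrib_left b_def by (simp add: mult_ac)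
        also have "\<dots> \<in> S" using ij by (intro Ssum Smul Sb) (auto simp: I_def)
        finally show ?thesis .
      qed
    qed
    then have "(\<Sum>k\<in>I. of_int (c k) * (y * b k)) \<in> S" by (intro Ssum Smul)
    then show ?thesis by (simp add: c sum_distrib_left mult_ac)
  qed
  have alg: "algebraic_int z" if z: "\<And>u. u \<in> S \<Longrightarrow> z * u \<in> S" for z
  proof -
    define n where "n = card I"
    obtain g where g: "bij_betw g {..<n} I"
      using fin unfolding n_def by (metis ex_bij_betw_nat_finite lessThan_atLeast0)
    have gI: "g i \<in> I" if "i < n" for i using g that by (auto simp: bij_betw_def)
    have "\<exists>c. z * b (g i) = (\<Sum>j<n. of_int (c j) * b (g j))" if i: "i < n" for i
    proof -
      have "z * b (g i) \<in> S" using z Sb gI i by blast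
      then obtain c where "z * b (g i) = (\<Sum>k\<in>I. of_int (c k) * b k)" unfolding S_def by blast
      also have "\<dots> = (\<Sum>j<n. of_int (c (g j)) * b (g j))"
        by (rule sum.reindex_bij_betw[OF g, symmetric])
      finally show ?thesis by (intro exI[of _ "\<lambda>j. c (g j)"])
    qed
    then obtain c where c: "\<And>i. i < n \<Longrightarrow> z * b (g i) = (\<Sum>j<n. of_int (c i j) * b (g j))"
      by metis
    have "(0, 0) \<in> I" using d e by (simp add: I_def)
    then obtain i0 where "i0 < n" "g i0 = (0, 0)"
      using g by (metis bij_betw_iff_bijections lessThan_iff)
    then show ?thesis
      using algebraic_int_of_stable[of n z "\<lambda>i. b (g i)" c i0] c by (simp add: b_def)
  qed
  show "algebraic_int (x + y)"
    by (rule alg) (auto simp: distrib_right intro: Sadd xS yS)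
  show "algebraic_int (x * y)"
    by (rule alg) (auto simp: mult.assoc intro: xS yS)
qed

lemmas algebraic_int_add [intro] = algebraic_int_of_stable_span(1)
  and algebraic_int_mult [intro] = algebraic_int_of_stable_span(2)

lemma algebraic_int_diff [intro]:
  "algebraic_int x \<Longrightarrow> algebraic_int y \<Longrightarrow> algebraic_int (x - y :: complex)"
  using algebraic_int_add[of x "- y"] by simp

lemma algebraic_int_power [intro]: "algebraic_int x \<Longrightarrow> algebraic_int (x ^ n :: complex)"
  by (induction n) auto

lemma algebraic_int_sum [intro]:
  "(\<And>i. i \<in> A \<Longrightarrow> algebraic_int (f i)) \<Longrightarrow> algebraic_int (\<Sum>i\<in>A. f i :: complex)"
  by (induction A rule: infinite_finite_induct) auto

lemma algebraic_int_prod [intro]: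
  "(\<And>i. i \<in> A \<Longrightarrow> algebraic_int (f i)) \<Longrightarrow> algebraic_int (\<Prod>i\<in>A. f i :: complex)"
  by (induction A rule: infinite_finite_induct) auto

lemma algebraic_int_sum_mset [intro]:
  "(\<And>i. i \<in># M \<Longrightarrow> algebraic_int (f i)) \<Longrightarrow> algebraic_int (\<Sum>i\<in>#M. f i :: complex)"
  by (induction M) auto

lemma algebraic_int_poly_of_int [intro]:
  "algebraic_int x \<Longrightarrow> algebraic_int (poly (of_int_poly p) x :: complex)"
  by (induction p) auto

lemma algebraic_int_monic_root:
  "monic p \<Longrightarrow> poly (of_int_poly p) x = 0 \<Longrightarrow> algebraic_int (x :: complex)"
  unfolding algebraic_int_altdef_ipoly by blast

lemma algebraic_int_not_half: "\<not> algebraic_int (1 / 2 :: complex)"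
proof
  assume "algebraic_int (1 / 2 :: complex)"
  then have "(1 / 2 :: complex) \<in> \<int>"
    by (intro rational_algebraic_int_is_int) auto
  then obtain k where "1 / 2 = (of_int k :: complex)" by (auto elim: Ints_cases)
  then have "of_int (2 * k) = (1 :: complex)" by (simp add: mult.commute)
  then have "2 * k = 1" by (metis of_int_eq_1_iff)
  then show False by presburger
qed

text \<open>The way back from divisibility among algebraic integers to divisibility in Z: a rational
  algebraic integer is an integer.\<close>

lemma of_int_dvd_algebraic:
  assumes "algebraic_int (of_int a / of_int b :: complex)" "b \<noteq> 0"
  shows "b dvd a"
proof -
  have "(of_int a / of_int b :: complex) \<in> \<int>"
    using assms by (intro rational_algebraic_int_is_int) auto
  then obtain k where "of_int a / of_int b = (of_int k :: complex)" by (auto elim: Ints_cases)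
  then have "of_int a = (of_int (b * k) :: complex)" using assms(2) by (simp add: field_simps)
  then show ?thesis by (metis dvdI of_int_eq_iff)
qed

text \<open>The radical of the ideal generated by 2.\<close>

definition rad2 :: "complex \<Rightarrow> bool" where
  "rad2 x \<longleftrightarrow> algebraic_int x \<and> (\<exists>N. algebraic_int (x ^ N / 2))"

lemma rad2_0 [simp]: "rad2 0"
  unfolding rad2_def by (auto intro: exI[of _ 1])

text \<open>Every term of the binomial expansion of \<open>(x + y) ^ (N1 + N2)\<close> contains
  \<open>x ^ N1\<close> or \<open>y ^ N2\<close>.\<close>

lemma rad2_add:
  assumes "rad2 x" "rad2 y" shows "rad2 (x + y)"
proof -
  obtain N1 N2 where N: "algebraic_int (x ^ N1 / 2)" "algebraic_int (y ^ N2 / 2)"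
    using assms by (auto simp: rad2_def)
  have x: "algebraic_int x" and y: "algebraic_int y" using assms by (auto simp: rad2_def)
  have "(x + y) ^ (N1 + N2) / 2 = (\<Sum>k\<le>N1 + N2. of_nat ((N1 + N2) choose k) * (x ^ k * y ^ (N1 + N2 - k) / 2))"
    by (simp add: binomial_ring sum_divide_distrib mult.assoc)
  also have "algebraic_int \<dots>"
  proof (intro algebraic_int_sum algebraic_int_mult algebraic_int_of_nat)
    fix k assume k: "k \<in> {..N1 + N2}"
    show "algebraic_int (x ^ k * y ^ (N1 + N2 - k) / 2)"
    proof (cases "N1 \<le> k")
      case True
      then have "x ^ k * y ^ (N1 + N2 - k) / 2 = x ^ (k - N1) * (x ^ N1 / 2) * y ^ (N1 + N2 - k)"
        by (simp flip: power_add)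
      then show ?thesis using N x y by (simp only:) blast
    next
      case False
      then have "x ^ k * y ^ (N1 + N2 - k) / 2 = x ^ k * (y ^ (N1 - k) * (y ^ N2 / 2))"
        by (simp flip: power_add)
      then show ?thesis using N x y by (simp only:) blast
    qed
  qed
  finally show ?thesis using x y unfolding rad2_def by blast
qed

lemma rad2_mult:
  assumes "rad2 x" "algebraic_int y" shows "rad2 (x * y)"
proof -
  obtain N where "algebraic_int (x ^ N / 2)" using assms by (auto simp: rad2_def)
  then have "algebraic_int (x ^ N / 2 * y ^ N)" using assms by blast
  then have "algebraic_int ((x * y) ^ N / 2)" by (simp add: power_mult_distrib)
  then show ?thesis using assms unfolding rad2_def by blast
qed

lemma rad2_of_int_iff: "rad2 (of_int a) \<longleftrightarrow> even a"
proof
  assume "rad2 (of_int a)"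
  then obtain N where "algebraic_int ((of_int a) ^ N / (2 :: complex))" by (auto simp: rad2_def)
  then have "algebraic_int (of_int (a ^ N) / (of_int 2 :: complex))" by simp
  then have "2 dvd a ^ N" by (rule of_int_dvd_algebraic) simp
  then show "even a" by simp
next
  assume "even a"
  then obtain b where "a = 2 * b" by blast
  then have "algebraic_int ((of_int a) ^ 1 / (2 :: complex))" by simp
  then show "rad2 (of_int a)" unfolding rad2_def by blast
qed

section \<open>Power sums over the roots of a polynomial\<close>

definition psum :: "complex multiset \<Rightarrow> nat \<Rightarrow> complex" where
  "psum M k = (\<Sum>z\<in>#M. z ^ k)"

text \<open>The reversed form of the monic polynomial with roots \<open>M\<close>. In this
  normalisation the constant term is 1, and the logarithmic derivative generates the power
  sums.\<close>

definition eps :: "complex multiset \<Rightarrow> complex poly" where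
  "eps M = (\<Prod>z\<in>#M. [:1, - z:])"

lemma psum_empty [simp]: "psum {#} k = 0"
  and psum_add [simp]: "psum (add_mset z M) k = z ^ k + psum M k"
  and psum_union [simp]: "psum (M + M') k = psum M k + psum M' k"
  by (simp_all add: psum_def)

lemma eps_empty [simp]: "eps {#} = 1"
  and eps_add [simp]: "eps (add_mset z M) = [:1, - z:] * eps M"
  and eps_union: "eps (M + M') = eps M * eps M'"
  by (simp_all add: eps_def)

lemma coeff_0_eps [simp]: "coeff (eps M) 0 = 1"
  by (induction M) (auto simp: coeff_mult)

lemma poly_eps: "poly (eps M) x = (\<Prod>z\<in>#M. 1 - z * x)"
  by (induction M) (auto simp: algebra_simps)

text \<open>Logarithmic derivative: each factor contributes \<open>- z / (1 - z * X)\<close>, which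
  is a geometric series.\<close>

lemma fps_deriv_eps:
  "fps_deriv (fps_of_poly (eps M)) = - (fps_of_poly (eps M) * Abs_fps (\<lambda>n. psum M (Suc n)))"
proof (induction M)
  case (add z M)
  let ?E = "fps_of_poly (eps M)" and ?L = "fps_of_poly [:1, - z:]"
  have L: "fps_deriv ?L = - fps_const z"
    by (rule fps_ext) (auto simp: coeff_pCons split: nat.splits)
  have geo: "?L * Abs_fps (\<lambda>n. z ^ Suc n) = fps_const z"
  proof (rule fps_ext)
    fix n
    have L2: "?L = 1 - fps_const z * fps_X"
      by (rule fps_ext) (auto simp: coeff_pCons split: nat.splits)
    show "fps_nth (?L * Abs_fps (\<lambda>n. z ^ Suc n)) n = fps_nth (fps_const z) n"
      unfolding L2 left_diff_distrib mult_1 mult.assoc by (cases n) (auto simp: fps_X_mult_nth)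
  qed
  have split: "Abs_fps (\<lambda>n. psum (add_mset z M) (Suc n))
      = Abs_fps (\<lambda>n. z ^ Suc n) + Abs_fps (\<lambda>n. psum M (Suc n))"
    by (rule fps_ext) simp
  have "fps_deriv (?L * ?E) = - fps_const z * ?E - ?L * (?E * Abs_fps (\<lambda>n. psum M (Suc n)))"
    by (simp add: L add.IH)
  also have "\<dots> = - (?L * ?E * (Abs_fps (\<lambda>n. z ^ Suc n) + Abs_fps (\<lambda>n. psum M (Suc n))))"
    by (subst geo[symmetric]) (simp add: algebra_simps)
  finally show ?case
    unfolding eps_add fps_of_poly_mult split .
qed (simp add: fps_zero_def)

text \<open>Newton's identities, read off coefficient by coefficient from the logarithmic
  derivative.\<close>

lemma newton_eps:
  "of_nat (Suc n) * coeff (eps M) (Suc n) = - (\<Sum>i\<le>n. coeff (eps M) i * psum M (Suc (n - i)))"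
proof -
  have "fps_nth (fps_deriv (fps_of_poly (eps M))) n =
      fps_nth (- (fps_of_poly (eps M) * Abs_fps (\<lambda>n. psum M (Suc n)))) n"
    by (simp only: fps_deriv_eps)
  then show ?thesis by (simp add: fps_mult_nth atLeast0AtMost)
qed

text \<open>In characteristic 0 Newton's identities can be solved for the coefficients. This turns
  equality of low power sums, which residues provide, into equality of low coefficients.\<close>

lemma eps_coeff_cong:
  assumes "\<And>k. 1 \<le> k \<Longrightarrow> k \<le> J \<Longrightarrow> psum M k = psum M' k" and "j \<le> J"
  shows "coeff (eps M) j = coeff (eps M') j"
  using assms(2)
proof (induction j rule: less_induct)
  case (less j)
  show ?case
  proof (cases j)
    case (Suc n)
    have "of_nat (Suc n) * coeff (eps M) (Suc n) = of_nat (Suc n) * coeff (eps M') (Suc n)"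
      unfolding newton_eps using less Suc assms(1) by (auto intro!: sum.cong)
    then show ?thesis using Suc by (simp only: mult_cancel_left of_nat_eq_0_iff) simp
  qed simp
qed

lemma eps_coeff_1: "coeff (eps M) 1 = - psum M 1"
  using newton_eps[of 0 M] by simp

lemma eps_coeff_rat:
  assumes "\<And>k. k \<ge> 1 \<Longrightarrow> psum M k \<in> \<rat>"
  shows "coeff (eps M) j \<in> \<rat>"
proof (induction j rule: less_induct)
  case (less j)
  show ?case
  proof (cases j)
    case (Suc n)
    have "coeff (eps M) (Suc n) = - (\<Sum>i\<le>n. coeff (eps M) i * psum M (Suc (n - i))) / of_nat (Suc n)"
      using newton_eps[of n M] by (simp add: field_simps del: of_nat_Suc)
    also have "\<dots> \<in> \<rat>"
      using less Suc assms by (intro Rats_divide Rats_minus_iff[THEN iffD2] Rats_sum Rats_mult) auto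
    finally show ?thesis using Suc by simp
  qed simp
qed

lemma psum_rat:
  assumes "\<And>j. coeff (eps M) j \<in> \<rat>" and "k \<ge> 1"
  shows "psum M k \<in> \<rat>"
  using assms(2)
proof (induction k rule: less_induct)
  case (less k)
  obtain n where k: "k = Suc n" using less by (cases k) auto
  have "psum M (Suc n) = - (of_nat (Suc n) * coeff (eps M) (Suc n))
      - (\<Sum>i=1..n. coeff (eps M) i * psum M (Suc (n - i)))"
  proof -
    have "(\<Sum>i\<le>n. coeff (eps M) i * psum M (Suc (n - i)))
        = psum M (Suc n) + (\<Sum>i=1..n. coeff (eps M) i * psum M (Suc (n - i)))"
      by (subst atLeast0AtMost[symmetric], subst sum.atLeast_Suc_atMost) auto
    then show ?thesis by (simp only: newton_eps) simp
  qed
  also have "\<dots> \<in> \<rat>"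
    using less k assms(1) by (intro Rats_diff Rats_mult Rats_sum Rats_minus_iff[THEN iffD2]) auto
  finally show ?case using k by simp
qed

lemma eps_coeff_algebraic:
  assumes "\<And>z. z \<in># M \<Longrightarrow> algebraic_int z"
  shows "algebraic_int (coeff (eps M) j)"
  using assms
proof (induction M arbitrary: j)
  case (add z M)
  have "coeff (eps (add_mset z M)) j = coeff (eps M) j - z * (case j of 0 \<Rightarrow> 0 | Suc i \<Rightarrow> coeff (eps M) i)"
    by (auto simp: coeff_pCons split: nat.splits)
  then show ?case using add by (auto split: nat.splits)
qed (auto simp: coeff_1)

lemma eps_coeff_rad2:
  assumes "\<And>z. z \<in># M \<Longrightarrow> rad2 z" and "j \<ge> 1"
  shows "rad2 (coeff (eps M) j)"
  using assms
proof (induction M arbitrary: j)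
  case (add z M)
  obtain i where j: "j = Suc i" using add.prems by (cases j) auto
  have "algebraic_int (- coeff (eps M) i)"
    using add.prems by (auto intro!: eps_coeff_algebraic simp: rad2_def)
  then have "rad2 (z * - coeff (eps M) i)" using add.prems by (intro rad2_mult) auto
  moreover have "rad2 (coeff (eps M) j)" using add by auto
  ultimately have "rad2 (coeff (eps M) j + z * - coeff (eps M) i)" by (intro rad2_add)
  then show ?case by (simp add: j)
qed (auto simp: coeff_1)

lemma eps_int_poly:
  assumes "\<And>z. z \<in># M \<Longrightarrow> algebraic_int z" and "\<And>k. k \<ge> 1 \<Longrightarrow> psum M k \<in> \<rat>"
  obtains Y :: "int poly" where "of_int_poly Y = eps M"
proof -
  have "coeff (eps M) j \<in> \<int>" for j
    using assms by (intro rational_algebraic_int_is_int eps_coeff_algebraic eps_coeff_rat)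
  then obtain Y where "eps M = of_int_poly Y" by (rule intpolyE)
  then show ?thesis using that by metis
qed

lemma eps_proots_of_monic:
  assumes "monic P"
  shows "eps (proots P) = reflect_poly P"
proof -
  have *: "reflect_poly (\<Prod>x\<in>#M. [:- x, 1:]) = eps M" for M :: "complex multiset"
  proof (induction M)
    case (add x M)
    have "reflect_poly [:- x, 1:] = [:1, - x:]"
      by (cases "x = 0") (simp_all add: reflect_poly_def)
    then show ?case using add
      by (simp only: image_mset_add_mset prod_mset.add_mset reflect_poly_mult eps_add)
  qed simp
  have "P = (\<Prod>x\<in>#proots P. [:- x, 1:])"
    using complex_poly_decompose_multiset[of P] assms by simp
  then show ?thesis using *[of "proots P"] by simp
qed

section \<open>Sums over the roots of a polynomial, and residues\<close>

definition root_sum :: "complex poly \<Rightarrow> complex poly \<Rightarrow> complex" where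
  "root_sum P g = (\<Sum>r\<in>#proots P. poly g r)"

lemma root_sum_0 [simp]: "root_sum P 0 = 0"
  by (simp add: root_sum_def)

lemma root_sum_add: "root_sum P (g + h) = root_sum P g + root_sum P h"
  by (simp add: root_sum_def sum_mset.distrib)

lemma root_sum_smult: "root_sum P (Polynomial.smult c g) = c * root_sum P g"
proof -
  have "(\<Sum>r\<in>#M. poly (Polynomial.smult c g) r) = c * (\<Sum>r\<in>#M. poly g r)" for M
    by (induction M) (auto simp: algebra_simps)
  then show ?thesis by (simp add: root_sum_def)
qed

lemma root_sum_uminus: "root_sum P (- g) = - root_sum P g"
  using root_sum_smult[of P "-1" g] by simp

lemma root_sum_diff: "root_sum P (g - h) = root_sum P g - root_sum P h"
  using root_sum_add[of P g "- h"] by (simp add: root_sum_uminus)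

lemma root_sum_sum: "root_sum P (\<Sum>i\<in>A. f i) = (\<Sum>i\<in>A. root_sum P (f i))"
  by (induction A rule: infinite_finite_induct) (auto simp: root_sum_add)

lemma root_sum_mult: "P \<noteq> 0 \<Longrightarrow> Q \<noteq> 0 \<Longrightarrow> root_sum (P * Q) g = root_sum P g + root_sum Q g"
  by (simp add: root_sum_def proots_mult)

lemma root_sum_cong:
  assumes "\<And>r. poly P r = 0 \<Longrightarrow> poly g r = poly h r" and "P \<noteq> 0"
  shows "root_sum P g = root_sum P h"
  unfolding root_sum_def using assms by (intro arg_cong[of _ _ sum_mset] image_mset_cong) auto

lemma root_sum_eq_0:
  assumes "\<And>r. poly P r = 0 \<Longrightarrow> poly g r = 0" and "P \<noteq> 0"
  shows "root_sum P g = 0"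
  using root_sum_cong[of P g 0] assms by simp

lemma root_sum_power: "root_sum P (g ^ k) = psum (image_mset (poly g) (proots P)) k"
  by (simp add: root_sum_def psum_def image_mset.compositionality o_def)

lemma root_sum_1: "root_sum P 1 = of_nat (degree P)"
  by (simp add: root_sum_def size_proots_complex)

text \<open>By linearity it suffices to sum powers of the roots, and these power sums are rational
  by Newton's identities.\<close>

lemma root_sum_rat:
  assumes "monic P" and "\<And>i. coeff P i \<in> \<rat>" and "\<And>i. coeff g i \<in> \<rat>"
  shows "root_sum P g \<in> \<rat>"
proof -
  have ps: "root_sum P ([:0, 1:] ^ k) \<in> \<rat>" for k
  proof (cases "k = 0")
    case False
    have "coeff (eps (proots P)) j \<in> \<rat>" for j
      using assms by (simp add: eps_proots_of_monic coeff_reflect_poly)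
    then have "psum (proots P) k \<in> \<rat>" using False by (intro psum_rat) auto
    moreover have "poly [:0, 1:] = (\<lambda>x :: complex. x)" by (rule ext) simp
    ultimately show ?thesis by (simp only: root_sum_power) simp
  qed (simp add: root_sum_1)
  have "root_sum P g = root_sum P (\<Sum>i\<le>degree g. Polynomial.smult (coeff g i) ([:0, 1:] ^ i))"
    by (simp only: monom_altdef[symmetric] poly_as_sum_of_monoms)
  also have "\<dots> = (\<Sum>i\<le>degree g. coeff g i * root_sum P ([:0, 1:] ^ i))"
    by (simp only: root_sum_sum root_sum_smult)
  also have "\<dots> \<in> \<rat>" using ps assms(3) by (intro Rats_sum Rats_mult)
  finally show ?thesis .
qed

lemma coeff_mult_top:
  assumes "\<And>i. i > m \<Longrightarrow> coeff p i = 0" and "\<And>i. i > n \<Longrightarrow> coeff q i = 0"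
  shows "coeff (p * q) (m + n) = coeff p m * (coeff q n :: complex)"
proof -
  have "coeff (p * q) (m + n) = (\<Sum>i\<le>m + n. coeff p i * coeff q (m + n - i))"
    by (simp add: coeff_mult)
  also have "\<dots> = (\<Sum>i\<in>{m}. coeff p i * coeff q (m + n - i))"
  proof (intro sum.mono_neutral_right ballI)
    fix i assume "i \<in> {..m + n} - {m}"
    then consider "i > m" | "m + n - i > n" by fastforce
    then show "coeff p i * coeff q (m + n - i) = 0"
      by cases (auto simp: assms)
  qed auto
  finally show ?thesis by simp
qed

lemma degree_prod_mset_linear:
  "degree (\<Prod>x\<in>#M. [:- x, 1 :: complex:]) = size M" "monic (\<Prod>x\<in>#M. [:- x, 1 :: complex:])"
proof -
  have m: "monic (\<Prod>x\<in>#M. [:- x, 1 :: complex:])" for M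
  proof (induction M)
    case (add x M)
    have "lead_coeff ([:- x, 1:] * (\<Prod>x\<in>#M. [:- x, 1:])) = 1"
      unfolding lead_coeff_mult add by simp
    then show ?case by (simp only: image_mset_add_mset prod_mset.add_mset)
  qed simp
  then show "monic (\<Prod>x\<in>#M. [:- x, 1 :: complex:])" .
  have nz: "(\<Prod>x\<in>#M. [:- x, 1 :: complex:]) \<noteq> 0" for M
    using m[of M] by auto
  show "degree (\<Prod>x\<in>#M. [:- x, 1 :: complex:]) = size M"
  proof (induction M)
    case (add x M)
    have "degree ([:- x, 1:] * (\<Prod>x\<in>#M. [:- x, 1:])) = Suc (size M)"
      by (subst degree_mult_eq) (use add nz in auto)
    then show ?case by (simp only: image_mset_add_mset prod_mset.add_mset size_add_mset)
  qed simp
qed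

lemma poly_split_at:
  obtains h where "(g :: complex poly) = [:poly g r:] + [:- r, 1:] * h"
proof -
  have "poly (g - [:poly g r:]) r = 0" by simp
  then have "[:- r, 1:] dvd g - [:poly g r:]" by (simp only: poly_eq_0_iff_dvd)
  then obtain h where e: "g - [:poly g r:] = [:- r, 1:] * h" by (elim dvdE)
  show ?thesis
    by (rule that[of h]) (simp only: e[symmetric] add_diff_cancel_left' add_diff_eq)
qed

lemma pderiv_linear_mult: "pderiv ([:- r, 1:] * P) = P + [:- r, 1:] * pderiv (P :: complex poly)"
proof -
  have "pderiv [:- r, 1:] = 1" by (simp add: pderiv_pCons)
  then show ?thesis by (simp only: pderiv_mult mult_1_right add.commute)
qed

text \<open>The ring identity behind the inductive step of the next lemma: \<open>l\<close> is the
  new linear factor, \<open>p'\<close> the derivative of \<open>P\<close>, and \<open>c\<close> the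
  value of \<open>g\<close> at the new root.\<close>

lemma (in comm_ring_1) euclid_step:
  assumes "g * p' = S + K * P" "g = c + l * h"
  shows "g * (P + l * p') = (l * S + c * P) + (K + h) * (l * P)"
proof -
  have "g * (P + l * p') = (c + l * h) * P + l * (g * p')" using assms(2) by (simp add: algebra_simps)
  then show ?thesis using assms(1) by (simp add: algebra_simps)
qed
text \<open>Partial fractions: \<open>g * pderiv P / P\<close> is a polynomial plus the sum of the
  \<open>poly g r / (X - r)\<close> over the roots. The top coefficient of the numerator
  \<open>S\<close> of the fractional part is therefore the sum of the residues.\<close>

lemma root_sum_pderiv:
  assumes "monic P"
  shows "\<exists>S K. g * pderiv P = S + K * P \<and> (\<forall>i\<ge>degree P. coeff S i = 0) \<and>
    (degree P > 0 \<longrightarrow> coeff S (degree P - 1) = root_sum P g)"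
proof -
  have *: "\<exists>S K. g * pderiv P = S + K * P \<and> (\<forall>i\<ge>size M. coeff S i = 0) \<and>
      (size M > 0 \<longrightarrow> coeff S (size M - 1) = (\<Sum>r\<in>#M. poly g r))"
    if "P = (\<Prod>x\<in>#M. [:- x, 1:])" for M P
    using that
  proof (induction M arbitrary: P)
    case (add r M)
    define P0 where "P0 = (\<Prod>x\<in>#M. [:- x, 1:])"
    obtain S K where SK: "g * pderiv P0 = S + K * P0" "\<forall>i\<ge>size M. coeff S i = 0"
      "size M > 0 \<longrightarrow> coeff S (size M - 1) = (\<Sum>r\<in>#M. poly g r)"
      using add.IH[OF P0_def] by (elim exE conjE)
    have P: "P = [:- r, 1:] * P0" using add.prems by (simp only: P0_def image_mset_add_mset prod_mset.add_mset)
    have P0: "degree P0 = size M \<and> monic P0"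
      unfolding P0_def using degree_prod_mset_linear by blast
    obtain g2 where g2: "g = [:poly g r:] + [:- r, 1:] * g2" by (rule poly_split_at)
    define S' where "S' = [:- r, 1:] * S + [:poly g r:] * P0"
    have 1: "g * pderiv P = S' + (K + g2) * P"
      unfolding P pderiv_linear_mult S'_def by (rule euclid_step[OF SK(1) g2])
    have c: "coeff S' i = (case i of 0 \<Rightarrow> 0 | Suc j \<Rightarrow> coeff S j) - r * coeff S i + poly g r * coeff P0 i" for i
      by (auto simp: S'_def coeff_pCons split: nat.splits)
    have 2: "\<forall>i\<ge>size (add_mset r M). coeff S' i = 0"
      using SK(2) P0 by (auto simp: c coeff_eq_0 split: nat.splits)
    have 3: "coeff S' (size M) = poly g r + (\<Sum>r\<in>#M. poly g r)"
      using SK(2,3) P0 by (cases "size M") (auto simp: c coeff_eq_0)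
    show ?case using 1 2 3 by (intro exI[of _ S'] exI[of _ "K + g2"]) auto
  qed (auto intro: exI[of _ 0])
  have "P = (\<Prod>x\<in>#proots P. [:- x, 1:])"
    using complex_poly_decompose_multiset[of P] assms by simp
  from *[OF this] show ?thesis
    unfolding size_proots_complex root_sum_def .
qed

text \<open>Residues at infinity: the difference of the root sums is the sum of the residues of
  \<open>N / (P Q)\<close>.\<close>

lemma root_sum_compare:
  assumes "monic P" "monic Q" and N: "N = g1 * pderiv P * Q - g2 * pderiv Q * P - K * P * Q"
    and deg: "degree N < degree P + degree Q"
  shows "root_sum P g1 - root_sum Q g2 = coeff N (degree P + degree Q - 1)"
proof -
  obtain S1 K1 where 1: "g1 * pderiv P = S1 + K1 * P" "\<forall>i\<ge>degree P. coeff S1 i = 0"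
    "degree P > 0 \<longrightarrow> coeff S1 (degree P - 1) = root_sum P g1"
    using root_sum_pderiv[OF assms(1), of g1] by (elim exE conjE)
  obtain S2 K2 where 2: "g2 * pderiv Q = S2 + K2 * Q" "\<forall>i\<ge>degree Q. coeff S2 i = 0"
    "degree Q > 0 \<longrightarrow> coeff S2 (degree Q - 1) = root_sum Q g2"
    using root_sum_pderiv[OF assms(2), of g2] by (elim exE conjE)
  have top: "degree (S * Q) < degree P + degree Q \<and>
      coeff (S * Q) (degree P + degree Q - 1) = (if degree P = 0 then 0 else coeff S (degree P - 1))"
    if S: "\<And>i. i \<ge> degree P \<Longrightarrow> coeff S i = 0" and "monic Q" "degree P + degree Q > 0"
    for S P Q :: "complex poly"
  proof (cases "degree P = 0")
    case True
    then have "S = 0" using S by (intro poly_eqI) auto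
    then show ?thesis using True that by simp
  next
    case False
    have "degree S < degree P"
    proof (cases "S = 0")
      case False
      then show ?thesis using S[of "degree S"] by (metis leading_coeff_0_iff linorder_not_less)
    qed (use False in simp)
    moreover have "coeff (S * Q) ((degree P - 1) + degree Q) = coeff S (degree P - 1) * coeff Q (degree Q)"
      using S by (intro coeff_mult_top) (auto simp: coeff_eq_0)
    ultimately show ?thesis using False that(2) degree_mult_le[of S Q] by simp
  qed
  have "P \<noteq> 0" "Q \<noteq> 0" using assms(1,2) by auto
  define R where "R = S1 * Q - S2 * P"
  define L where "L = K1 - K2 - K"
  have NR: "N = R + L * (P * Q)"
    unfolding N R_def L_def 1(1) 2(1) by (simp add: algebra_simps)
  have pos: "degree P + degree Q > 0" using deg by linarith
  have z: "root_sum P' g = 0" if "degree P' = 0" for P' g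
    using that size_proots_complex[of P'] by (simp add: root_sum_def)
  have t1: "degree (S1 * Q) < degree P + degree Q"
    "coeff (S1 * Q) (degree P + degree Q - 1) = root_sum P g1"
    using top[of P S1 Q] 1(2,3) assms(2) pos z[of P] by (auto split: if_splits)
  have t2: "degree (S2 * P) < degree P + degree Q"
    "coeff (S2 * P) (degree P + degree Q - 1) = root_sum Q g2"
    using top[of Q S2 P] 2(2,3) assms(1) pos z[of Q] by (auto simp: add.commute split: if_splits)
  \<comment> \<open>\<open>N / (P * Q)\<close> vanishes at infinity by the degree bound, so its
    polynomial part \<open>L\<close> must be zero.\<close>
  have "L = 0"
  proof (rule ccontr)
    assume "L \<noteq> 0"
    have PQ: "degree (P * Q) = degree P + degree Q" "P * Q \<noteq> 0"
      using \<open>P \<noteq> 0\<close> \<open>Q \<noteq> 0\<close> by (auto simp: degree_mult_eq)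
    have "degree (L * (P * Q)) \<ge> degree P + degree Q"
      using \<open>L \<noteq> 0\<close> PQ by (simp add: degree_mult_eq)
    moreover have "L * (P * Q) = N - R" using NR by simp
    moreover have "degree (N - R) < degree P + degree Q"
      unfolding R_def using deg t1 t2 by (intro degree_diff_less) auto
    ultimately show False by simp
  qed
  then show ?thesis using NR t1 t2 by (simp add: R_def)
qed

text \<open>A degree drop of two leaves no residue at infinity. The polynomial \<open>K\<close>
  removes the polynomial part of the difference of the two logarithmic derivatives.\<close>

lemma root_sum_compare_eq:
  assumes "monic P" "monic Q" and "N = g1 * pderiv P * Q - g2 * pderiv Q * P - K * P * Q"
    and "degree N + 2 \<le> degree P + degree Q"
  shows "root_sum P g1 = root_sum Q g2"
  using root_sum_compare[OF assms(1-3)] assms(4) by (simp add: coeff_eq_0)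

section \<open>Sums of cycle products\<close>

definition cit :: "nat \<Rightarrow> complex poly" where
  "cit i = of_int_poly (crit_iter i)"

lemma crit_iter_0 [simp]: "crit_iter 0 = 0"
  and crit_iter_Suc: "crit_iter (Suc i) = crit_iter i ^ 2 + [:0, 1:]"
  by (simp_all add: crit_iter_def quad_map_def)

lemma cit_0 [simp]: "cit 0 = 0"
  by (simp add: cit_def)

lemma cit_Suc: "cit (Suc i) = cit i ^ 2 + [:0, 1:]"
  by (simp add: cit_def crit_iter_Suc hom_distribs)

lemma monic_add_lower:
  assumes "monic p" "degree q < degree (p :: 'a :: comm_ring_1 poly)"
  shows "monic (p + q)" "degree (p + q) = degree p"
  using assms by (auto simp: degree_add_eq_left coeff_eq_0)

lemma crit_iter_monic:
  assumes "i \<ge> 1" shows "degree (crit_iter i) = 2 ^ (i - 1)" "monic (crit_iter i)"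
proof -
  have "degree (crit_iter (Suc i)) = 2 ^ i \<and> monic (crit_iter (Suc i))" for i
  proof (induction i)
    case (Suc i)
    let ?p = "crit_iter (Suc i)"
    have "?p \<noteq> 0" using Suc by auto
    then have d: "degree (?p ^ 2) = 2 ^ Suc i"
      using Suc by (simp add: degree_power_eq)
    have l: "lead_coeff (?p ^ 2) = 1"
      by (simp only: lead_coeff_power conjunct2[OF Suc] power_one)
    have "degree [:0, 1 :: int:] < degree (?p ^ 2)"
      unfolding d using one_less_power[of "2 :: nat" "Suc i"] by simp
    from monic_add_lower[OF l this] show ?case
      by (simp only: crit_iter_Suc[of "Suc i"] d simp_thms)
  qed (simp add: crit_iter_Suc)
  from this[of "i - 1"] assms show "degree (crit_iter i) = 2 ^ (i - 1)" "monic (crit_iter i)" by auto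
qed

lemma degree_cit: "i \<ge> 1 \<Longrightarrow> degree (cit i) = 2 ^ (i - 1)"
  and monic_cit: "i \<ge> 1 \<Longrightarrow> monic (cit i)"
  using crit_iter_monic by (simp_all add: cit_def)

lemma cit_nonzero: "i \<ge> 1 \<Longrightarrow> cit i \<noteq> 0"
  using monic_cit[of i] by auto

text \<open>\<open>critF n m\<close> cuts out the parameters with \<open>f\<^sup>n(x) = x\<close> at \<open>x = a\<^sub>m\<close> and
  \<open>a\<^bsub>m-1\<^esub> = -f\<^bsup>n-1\<^esup>(x)\<close>; \<open>cyc n m\<close> is the product of the cycle.\<close>

definition critF :: "nat \<Rightarrow> nat \<Rightarrow> complex poly" where
  "critF n m = cit (m + n - 1) + cit (m - 1)"

definition critE :: "nat \<Rightarrow> nat \<Rightarrow> complex poly" where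
  "critE n m = cit (m + n) - cit m"

definition cyc :: "nat \<Rightarrow> nat \<Rightarrow> complex poly" where
  "cyc n m = (\<Prod>i<n. cit (m + i))"

definition cyc_sum :: "nat \<Rightarrow> nat \<Rightarrow> nat \<Rightarrow> complex" where
  "cyc_sum n m q = root_sum (critF n m) (cyc n m ^ q)"

text \<open>A difference of two squares. Iterated down to \<open>critE n 0 = cit n\<close>, it sorts
  the parameters with \<open>a (m + n) = a m\<close> by their preperiod.\<close>

lemma critE_Suc: "critE n (Suc m) = critF n (Suc m) * critE n m"
  by (simp add: critE_def critF_def cit_Suc algebra_simps power2_eq_square)

lemma pow2_less: "n \<ge> 1 \<Longrightarrow> m \<ge> 1 \<Longrightarrow> (2 :: nat) ^ (m - 1) < 2 ^ (m + n - 1)"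
  by (intro power_strict_increasing) auto

lemma crit_lower:
  assumes "n \<ge> 1" "m \<ge> 1" shows "degree (cit m) < degree (cit (m + n))"
  using assms pow2_less[of n m] by (simp add: degree_cit)

lemma monic_critE:
  assumes "n \<ge> 1" "m \<ge> 1"
  shows "monic (critE n m)" "degree (critE n m) = 2 ^ (m + n - 1)"
proof -
  have e: "critE n m = cit (m + n) + - cit m" by (simp add: critE_def)
  have l: "degree (- cit m) < degree (cit (m + n))" using crit_lower[OF assms] by simp
  have d: "degree (cit (m + n)) = 2 ^ (m + n - 1)" using assms by (intro degree_cit) auto
  have "monic (cit (m + n))" using assms by (intro monic_cit) auto
  from monic_add_lower[OF this l] show "monic (critE n m)" "degree (critE n m) = 2 ^ (m + n - 1)"
    unfolding e by (auto simp only: d)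
qed

lemma monic_critF_Suc:
  assumes "n \<ge> 1" "m \<ge> 1"
  shows "monic (critF n (Suc m))" "degree (critF n (Suc m)) = 2 ^ (m + n - 1)"
proof -
  have e: "critF n (Suc m) = cit (m + n) + cit m" by (simp add: critF_def)
  have d: "degree (cit (m + n)) = 2 ^ (m + n - 1)" using assms by (intro degree_cit) auto
  have "monic (cit (m + n))" using assms by (intro monic_cit) auto
  from monic_add_lower[OF this crit_lower[OF assms]]
  show "monic (critF n (Suc m))" "degree (critF n (Suc m)) = 2 ^ (m + n - 1)"
    unfolding e by (auto simp only: d)
qed

lemma critF_1: "critF n 1 = cit n"
  by (simp add: critF_def)

lemma monic_critF:
  assumes "n \<ge> 1" "m \<ge> 1"
  shows "monic (critF n m)" "degree (critF n m) = 2 ^ (m + n - 2)"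
proof -
  have "monic (critF n m) \<and> degree (critF n m) = 2 ^ (m + n - 2)"
  proof (cases "m = 1")
    case True
    have "2 ^ (m + n - 2) = (2 :: nat) ^ (n - 1)" using True by simp
    then show ?thesis using monic_cit[of n] degree_cit[of n] assms True by (simp only: critF_1 simp_thms)
  next
    case False
    then show ?thesis using monic_critF_Suc[of n "m - 1"] assms by (auto simp: numeral_2_eq_2)
  qed
  then show "monic (critF n m)" "degree (critF n m) = 2 ^ (m + n - 2)" by auto
qed

lemma poly_cyc_rotate:
  assumes "poly (critE n m) c = 0"
  shows "poly (cyc n (Suc m)) c = poly (cyc n m) c"
proof (cases n)
  case (Suc k)
  have "poly (cyc n (Suc m)) c = (\<Prod>i<k. poly (cit (Suc m + i)) c) * poly (cit (m + n)) c"
    by (simp add: cyc_def poly_prod Suc)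
  also have "poly (cit (m + n)) c = poly (cit m) c" using assms by (simp add: critE_def)
  also have "(\<Prod>i<k. poly (cit (Suc m + i)) c) * poly (cit m) c = poly (cyc n m) c"
    by (simp add: cyc_def poly_prod Suc prod.lessThan_Suc_shift mult.commute del: prod.lessThan_Suc)
  finally show ?thesis .
qed (simp add: cyc_def)

text \<open>By \<open>critE_Suc\<close> the roots of \<open>critE n m\<close> are those of
  \<open>critF n i\<close> with \<open>1 \<le> i \<le> m\<close> together with those of
  \<open>cit n\<close>. At the latter the cycle product vanishes; at the former it does not change
  when the starting point moves along the cycle from \<open>i\<close> to \<open>m\<close>.\<close>

lemma root_sum_critE:
  assumes "n \<ge> 1" "q \<ge> 1" "m \<ge> 1"
  shows "root_sum (critE n m) (cyc n m ^ q) = (\<Sum>i=1..m. cyc_sum n i q)"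
  using assms(3)
proof (induction m rule: dec_induct)
  case base
  have eq: "critE n 1 = critF n 1 * cit n"
    using critE_Suc[of n 0] by (simp add: critE_def)
  have "root_sum (cit n) (cyc n 1 ^ q) = 0"
  proof (rule root_sum_eq_0)
    fix r assume "poly (cit n) r = 0"
    then have "\<exists>i<n. poly (cit (1 + i)) r = 0" using assms by (intro exI[of _ "n - 1"]) auto
    then show "poly (cyc n 1 ^ q) r = 0" using assms by (auto simp: cyc_def poly_prod)
  qed (use assms cit_nonzero in auto)
  moreover have "root_sum (critF n 1 * cit n) (cyc n 1 ^ q)
      = root_sum (critF n 1) (cyc n 1 ^ q) + root_sum (cit n) (cyc n 1 ^ q)"
    by (rule root_sum_mult) (use assms cit_nonzero critF_1 in auto)
  ultimately show ?case unfolding eq cyc_sum_def by simp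
next
  case (step m)
  have nz: "critF n (Suc m) \<noteq> 0" "critE n m \<noteq> 0"
    using monic_critF[of n "Suc m"] monic_critE[of n m] assms step by auto
  have "root_sum (critE n m) (cyc n (Suc m) ^ q) = root_sum (critE n m) (cyc n m ^ q)"
    using nz by (intro root_sum_cong) (auto simp: poly_cyc_rotate)
  then show ?case
    using step nz by (simp add: critE_Suc root_sum_mult cyc_sum_def)
qed

lemma cyc_sum_1: "n \<ge> 1 \<Longrightarrow> q \<ge> 1 \<Longrightarrow> cyc_sum n 1 q = 0"
  unfolding cyc_sum_def critF_1
proof (rule root_sum_eq_0)
  fix r assume "poly (cit n) r = 0" "n \<ge> 1" "q \<ge> 1"
  moreover have "\<exists>i<n. poly (cit (1 + i)) r = 0"
    using calculation by (intro exI[of _ "n - 1"]) auto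
  ultimately show "poly (cyc n 1 ^ q) r = 0" by (auto simp: cyc_def poly_prod)
qed (use cit_nonzero in auto)

text \<open>At a root of \<open>critF n (Suc m)\<close> the orbit arrives at \<open>- a m\<close>
  instead of \<open>a m\<close>, which changes the sign of one factor of the product.\<close>

lemma cyc_sum_Suc:
  assumes "n \<ge> 1"
  shows "cyc_sum n (Suc m) q = (- 1) ^ q * root_sum (critF n (Suc m)) (cyc n m ^ q)"
proof -
  have "poly (cyc n (Suc m)) c = - poly (cyc n m) c" if "poly (critF n (Suc m)) c = 0" for c
  proof -
    obtain k where Suc: "n = Suc k" using assms by (cases n) auto
    have "poly (cyc n (Suc m)) c = (\<Prod>i<k. poly (cit (Suc m + i)) c) * poly (cit (m + n)) c"
      by (simp add: cyc_def poly_prod Suc)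
    also have "poly (cit (m + n)) c = - poly (cit m) c"
      using that by (simp add: critF_def eq_neg_iff_add_eq_0)
    also have "(\<Prod>i<k. poly (cit (Suc m + i)) c) * - poly (cit m) c = - poly (cyc n m) c"
      by (simp add: cyc_def poly_prod Suc prod.lessThan_Suc_shift mult.commute del: prod.lessThan_Suc)
    finally show ?thesis .
  qed
  moreover have "critF n (Suc m) \<noteq> 0" using monic_critF[of n "Suc m"] assms by auto
  ultimately have "cyc_sum n (Suc m) q = root_sum (critF n (Suc m)) ((- cyc n m) ^ q)"
    unfolding cyc_sum_def by (intro root_sum_cong) auto
  also have "(- cyc n m) ^ q = Polynomial.smult ((- 1) ^ q) (cyc n m ^ q)"
    by (metis smult_power smult_minus_left smult_1_left)
  finally show ?thesis by (simp add: root_sum_smult)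
qed

lemma degree_pderiv_less: "degree p \<ge> 1 \<Longrightarrow> degree (pderiv p) + 1 = degree (p :: complex poly)"
  by (simp add: degree_pderiv)

lemma degree_wronskian:
  assumes "degree a \<ge> 1" "degree b \<ge> 1"
  shows "degree (a * pderiv b - pderiv a * b) + 1 \<le> degree a + degree (b :: complex poly)"
proof -
  have "degree (a * pderiv b) \<le> degree a + degree b - 1" "degree (pderiv a * b) \<le> degree a + degree b - 1"
    using degree_mult_le[of a "pderiv b"] degree_mult_le[of "pderiv a" b] assms by (auto simp: degree_pderiv)
  then have "degree (a * pderiv b - pderiv a * b) \<le> degree a + degree b - 1"
    by (rule degree_diff_le)
  then show ?thesis using assms by linarith
qed

lemma degree_cyc: "m \<ge> 1 \<Longrightarrow> degree (cyc n m) + 2 ^ (m - 1) = 2 ^ (m + n - 1)"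
  and monic_cyc: "m \<ge> 1 \<Longrightarrow> monic (cyc n m)"
proof -
  assume m: "m \<ge> 1"
  show mon: "monic (cyc n m)" for n unfolding cyc_def using m monic_cit
    by (induction n) (auto simp: lead_coeff_mult)
  show "degree (cyc n m) + 2 ^ (m - 1) = 2 ^ (m + n - 1)"
  proof (induction n)
    case (Suc n)
    have "degree (cyc (Suc n) m) = degree (cyc n m) + degree (cit (m + n))"
    proof -
      have "cyc n m \<noteq> 0" using mon[of n] by auto
      then have "degree (cyc n m * cit (m + n)) = degree (cyc n m) + degree (cit (m + n))"
        using cit_nonzero[of "m + n"] m by (intro degree_mult_eq) auto
      then show ?thesis by (simp add: cyc_def)
    qed
    also have "\<dots> + 2 ^ (m - 1) = 2 ^ (m + n - 1) + 2 ^ (m + n - 1)"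
      using Suc m by (simp add: degree_cit)
    also have "\<dots> = 2 ^ (m + Suc n - 1)" using m by (cases m) auto
    finally show ?case .
  qed (simp add: cyc_def)
qed

text \<open>Here the degree of \<open>N\<close> misses that of the product by exactly one, because
  \<open>cyc n m\<close> has degree \<open>degree b - degree a\<close>. So there is a residue at
  infinity, namely twice the leading coefficient of a Wronskian, and the recursion holds at every
  level.\<close>

lemma cyc_sum_recursion:
  assumes "n \<ge> 1" "m \<ge> 1"
  shows "cyc_sum n (Suc m) 1 = 2 ^ m * (2 ^ n - 1) - (\<Sum>i=1..m. cyc_sum n i 1)"
proof -
  define a b g where "a = cit m" and "b = cit (m + n)" and "g = cyc n m"
  have "monic a" unfolding a_def by (rule monic_cit[OF assms(2)])
  moreover have "monic b" unfolding b_def by (rule monic_cit) (use assms in auto)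
  moreover have "degree a = 2 ^ (m - 1)" "degree b = 2 ^ (m + n - 1)"
    using assms by (simp_all add: a_def b_def degree_cit)
  ultimately have da: "degree a = 2 ^ (m - 1)" "monic a" and db: "degree b = 2 ^ (m + n - 1)" "monic b"
    by blast+
  have dg: "degree g + degree a = degree b" "monic g"
    using assms degree_cyc[of m n] monic_cyc[of m n] da db by (auto simp: g_def)
  have pos: "degree a \<ge> 1" "degree b \<ge> 1" using da db by auto
  define W where "W = g * (pderiv a * b - a * pderiv b)"
  define N where "N = W + W"
  have Neq: "N = g * pderiv (critF n (Suc m)) * critE n m - g * pderiv (critE n m) * critF n (Suc m)
      - 0 * critF n (Suc m) * critE n m"
    by (simp add: N_def W_def critF_def critE_def a_def b_def pderiv_add pderiv_diff algebra_simps)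
  have w1: "degree (pderiv a * b - a * pderiv b) + 1 \<le> degree a + degree b"
    using degree_wronskian[OF pos] by (metis degree_minus minus_diff_eq)
  have "degree N < degree (critF n (Suc m)) + degree (critE n m)"
  proof -
    have "degree W < 2 * degree b"
      using degree_mult_le[of g "pderiv a * b - a * pderiv b"] w1 dg by (simp add: W_def)
    then have "degree N < 2 * degree b" unfolding N_def by (intro degree_add_less)
    then show ?thesis using db monic_critF_Suc[OF assms] monic_critE[OF assms] by simp
  qed
  then have "root_sum (critF n (Suc m)) g - root_sum (critE n m) g
      = coeff N (degree (critF n (Suc m)) + degree (critE n m) - 1)"
    using Neq monic_critF_Suc[OF assms] monic_critE[OF assms] by (intro root_sum_compare[where K = 0]) auto
  also have "degree (critF n (Suc m)) + degree (critE n m) - 1 = degree g + (degree a + degree b - 1)"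
    using monic_critF_Suc[OF assms] monic_critE[OF assms] dg db pos by simp
  also have "coeff N \<dots> = 2 * (coeff g (degree g) * coeff (pderiv a * b - a * pderiv b) (degree a + degree b - 1))"
  proof -
    have "coeff W (degree g + (degree a + degree b - 1))
        = coeff g (degree g) * coeff (pderiv a * b - a * pderiv b) (degree a + degree b - 1)"
      unfolding W_def
    proof (rule coeff_mult_top)
      show "coeff (pderiv a * b - a * pderiv b) i = 0" if "i > degree a + degree b - 1" for i
        by (rule coeff_eq_0) (use w1 that in linarith)
    qed (rule coeff_eq_0)
    then show ?thesis unfolding N_def coeff_add by (metis mult_2)
  qed
  also have "coeff (pderiv a * b - a * pderiv b) (degree a + degree b - 1)
      = of_nat (degree a) - of_nat (degree b)"
  proof -
    have "coeff (pderiv a * b) ((degree a - 1) + degree b) = of_nat (degree a)"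
      using da db pos by (subst coeff_mult_top) (auto simp: coeff_pderiv coeff_eq_0)
    moreover have "coeff (a * pderiv b) (degree a + (degree b - 1)) = of_nat (degree b)"
      using da db pos by (subst coeff_mult_top) (auto simp: coeff_pderiv coeff_eq_0)
    moreover have "degree a - 1 + degree b = degree a + degree b - 1"
      "degree a + (degree b - 1) = degree a + degree b - 1" using pos by linarith+
    ultimately show ?thesis by (simp only: coeff_diff)
  qed
  finally have "root_sum (critF n (Suc m)) g = root_sum (critE n m) g + 2 * (2 ^ (m - 1) - 2 ^ (m + n - 1))"
    using dg da db by (simp add: algebra_simps)
  moreover have "cyc_sum n (Suc m) 1 = - root_sum (critF n (Suc m)) g"
    using cyc_sum_Suc[of n m 1] assms by (simp add: g_def)
  moreover have "root_sum (critE n m) g = (\<Sum>i=1..m. cyc_sum n i 1)"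
    using root_sum_critE[of n 1 m] assms by (simp add: g_def)
  moreover have "2 * (2 ^ (m - 1) - 2 ^ (m + n - 1)) = (2 ^ m - 2 ^ (m + n) :: complex)"
    using assms by (cases m) (auto simp: algebra_simps)
  ultimately have "cyc_sum n (Suc m) 1 = - ((\<Sum>i=1..m. cyc_sum n i 1) + (2 ^ m - 2 ^ (m + n)))"
    by (simp only:)
  then show ?thesis by (simp add: algebra_simps power_add)
qed

lemma cyc_sum_value:
  assumes "n \<ge> 1"
  shows "cyc_sum n 2 1 = 2 * (2 ^ n - 1)" and "m \<ge> 3 \<Longrightarrow> cyc_sum n m 1 = 2 ^ (m - 2) * (2 ^ n - 1)"
proof -
  show 2: "cyc_sum n 2 1 = 2 * (2 ^ n - 1)"
    using cyc_sum_recursion[of n 1] cyc_sum_1[of n 1] assms by (simp add: numeral_2_eq_2)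
  have "cyc_sum n (m + 3) 1 = 2 ^ (m + 1) * (2 ^ n - 1) \<and>
      (\<Sum>i=1..m+2. cyc_sum n i 1) = 2 ^ (m + 1) * (2 ^ n - 1)" for m
  proof (induction m)
    case 0
    have s: "(\<Sum>i=1..2. cyc_sum n i 1) = 2 * (2 ^ n - 1)"
      using 2 cyc_sum_1[of n 1] assms by (simp add: numeral_2_eq_2)
    have "cyc_sum n 3 1 = 2 ^ 2 * (2 ^ n - 1) - (\<Sum>i=1..2. cyc_sum n i 1)"
      using cyc_sum_recursion[of n 2] assms by (simp add: numeral_3_eq_3 numeral_2_eq_2)
    then show ?case unfolding s add_0 using s by simp
  next
    case (Suc m)
    have s: "(\<Sum>i=1..Suc m+2. cyc_sum n i 1) = 2 ^ (Suc m + 1) * (2 ^ n - 1)"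
    proof -
      have "(\<Sum>i=1..Suc m+2. cyc_sum n i 1) = (\<Sum>i=1..m+2. cyc_sum n i 1) + cyc_sum n (m + 3) 1"
        by (simp add: numeral_3_eq_3)
      also have "\<dots> = 2 ^ (m + 1) * (2 ^ n - 1) + 2 ^ (m + 1) * (2 ^ n - 1)"
        by (simp only: Suc)
      finally show ?thesis by (simp add: algebra_simps)
    qed
    have "cyc_sum n (Suc (m + 3)) 1 = 2 ^ (m + 3) * (2 ^ n - 1) - (\<Sum>i=1..Suc m + 2. cyc_sum n i 1)"
      using cyc_sum_recursion[of n "m + 3"] assms by (simp add: numeral_3_eq_3)
    also have "\<dots> = 2 ^ (Suc m + 1) * (2 ^ n - 1)"
      unfolding s by (simp add: power_add algebra_simps)
    finally show ?case using s by simp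
  qed
  note * = this
  show "cyc_sum n m 1 = 2 ^ (m - 2) * (2 ^ n - 1)" if m: "m \<ge> 3"
  proof -
    have e: "m - 3 + 3 = m" "m - 3 + 1 = m - 2" using m by auto
    show ?thesis using *[of "m - 3", unfolded e] by (rule conjunct1)
  qed
qed

section \<open>Root sums of monomials in the orbit, and the doubling rule\<close>

definition orbit_monom :: "nat \<Rightarrow> nat \<Rightarrow> nat \<Rightarrow> (nat \<Rightarrow> nat) \<Rightarrow> complex poly" where
  "orbit_monom n m s e = [:0, 1:] ^ s * (\<Prod>i<n. cit (m + i) ^ e i)"

lemma degree_orbit_monom:
  assumes "m \<ge> 1" "\<And>i. i < n \<Longrightarrow> e i \<le> 1"
  shows "degree (orbit_monom n m s e) + 2 ^ (m - 1) \<le> s + 2 ^ (m + n - 1)"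
    and "n \<ge> 1 \<Longrightarrow> e 0 = 0 \<Longrightarrow> degree (orbit_monom n m s e) + 2 ^ m \<le> s + 2 ^ (m + n - 1)"
proof -
  have X: "degree ([:0, 1 :: complex:] ^ s) = s" by (simp add: degree_power_eq)
  have dstep: "degree (cit (m + i) ^ e i) \<le> 2 ^ (m + i - 1)" if "i < n" for i
  proof -
    have "degree (cit (m + i) ^ e i) = e i * 2 ^ (m + i - 1)"
      using assms(1) by (simp add: degree_power_eq cit_nonzero degree_cit)
    then show ?thesis using assms(2)[OF that] by (cases "e i") auto
  qed
  have "degree (\<Prod>i<k. cit (m + i) ^ e i) + 2 ^ (m - 1) \<le> 2 ^ (m + k - 1)" if "k \<le> n" for k
    using that
  proof (induction k)
    case (Suc k)
    have "degree (\<Prod>i<Suc k. cit (m + i) ^ e i) \<le> degree (\<Prod>i<k. cit (m + i) ^ e i) + degree (cit (m + k) ^ e k)"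
      using degree_mult_le by simp
    moreover have "(2 :: nat) ^ (m + Suc k - 1) = 2 ^ (m + k - 1) + 2 ^ (m + k - 1)"
      using assms(1) by (cases m) auto
    ultimately show ?case using Suc dstep[of k] by linarith
  qed simp
  from this[of n] show "degree (orbit_monom n m s e) + 2 ^ (m - 1) \<le> s + 2 ^ (m + n - 1)"
    using degree_mult_le[of "[:0, 1:] ^ s" "\<Prod>i<n. cit (m + i) ^ e i"] X
    unfolding orbit_monom_def by linarith
  have *: "degree (\<Prod>i<k. cit (m + i) ^ e i) + 2 ^ m \<le> 2 ^ (m + k - 1)" if "k \<le> n" "k \<ge> 1" "e 0 = 0" for k
    using that(2,1,3)
  proof (induction k rule: dec_induct)
    case (step k)
    have "degree (\<Prod>i<Suc k. cit (m + i) ^ e i) \<le> degree (\<Prod>i<k. cit (m + i) ^ e i) + degree (cit (m + k) ^ e k)"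
      using degree_mult_le by simp
    moreover have "(2 :: nat) ^ (m + Suc k - 1) = 2 ^ (m + k - 1) + 2 ^ (m + k - 1)"
      using assms(1) by (cases m) auto
    moreover have "degree (cit (m + k) ^ e k) \<le> 2 ^ (m + k - 1)" using dstep[of k] step.prems by simp
    ultimately show ?case using step by linarith
  qed simp
  from *[of n] show "n \<ge> 1 \<Longrightarrow> e 0 = 0 \<Longrightarrow> degree (orbit_monom n m s e) + 2 ^ m \<le> s + 2 ^ (m + n - 1)"
    using degree_mult_le[of "[:0, 1:] ^ s" "\<Prod>i<n. cit (m + i) ^ e i"] X
    unfolding orbit_monom_def by linarith
qed

lemma root_sum_square: "P \<noteq> 0 \<Longrightarrow> root_sum (P ^ 2) g = 2 * root_sum P g"
  by (simp add: power2_eq_square root_sum_mult)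

lemma monic_square: "monic p \<Longrightarrow> monic (p ^ 2 :: complex poly)"
  by (simp only: lead_coeff_power power_one)

text \<open>\<open>cit (Suc k)\<close> differs from \<open>cit k ^ 2\<close> by the single term
  \<open>c\<close>, so for \<open>g\<close> of small degree the roots of \<open>cit k\<close>,
  counted twice, give the same sum.\<close>

lemma root_sum_cit_Suc:
  assumes "k \<ge> 1" "degree g + 2 \<le> 2 * degree (cit k)"
  shows "root_sum (cit (Suc k)) g = 2 * root_sum (cit k) g"
proof -
  define y where "y = cit k"
  have my: "monic y" and y0: "y \<noteq> 0" using assms monic_cit cit_nonzero by (auto simp: y_def)
  have dy: "degree y \<ge> 1" using assms by (simp add: y_def degree_cit)
  define M where "M = y - 2 * ([:0, 1:] * pderiv y)"
  define N where "N = g * (y * M)"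
  have dM: "degree M \<le> degree y"
  proof -
    have "degree ([:0, 1:] * pderiv y) \<le> degree y"
      using degree_mult_le[of "[:0, 1:]" "pderiv y"] dy by (simp add: degree_pderiv)
    then show ?thesis unfolding M_def mult_2 by (intro degree_diff_le degree_add_le) auto
  qed
  have "root_sum (cit (Suc k)) g = root_sum (y ^ 2) g"
  proof (rule root_sum_compare_eq)
    show "monic (cit (Suc k))" by (rule monic_cit) simp
    show "monic (y ^ 2)" by (rule monic_square[OF my])
    show "N = g * pderiv (cit (Suc k)) * y ^ 2 - g * pderiv (y ^ 2) * cit (Suc k) - 0 * cit (Suc k) * y ^ 2"
      unfolding N_def M_def cit_Suc y_def[symmetric]
      by (simp add: power2_eq_square pderiv_mult pderiv_add pderiv_pCons algebra_simps
          del: mult_pCons_left mult_pCons_right)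
    have "degree N \<le> degree g + (degree y + degree M)"
      unfolding N_def using degree_mult_le[of g "y * M"] degree_mult_le[of y M] by linarith
    moreover have "degree (cit (Suc k)) = 2 * degree y" "degree (y ^ 2) = 2 * degree y"
      using assms y0 by (simp_all add: y_def degree_cit degree_power_eq) (cases k; simp)
    ultimately show "degree N + 2 \<le> degree (cit (Suc k)) + degree (y ^ 2)"
      using dM assms(2) by (simp add: y_def)
  qed
  then show ?thesis using root_sum_square[OF y0] by (simp add: y_def)
qed

text \<open>Descent from \<open>cit (m + n)\<close> to lower levels: each step halves the sum, until
  a level is reached whose iterate is a factor of the monomial, where it vanishes. Level
  \<open>m\<close> is such a level since \<open>e 0 = 1\<close>.\<close>

lemma root_sum_cit_orbit_monom:
  assumes "m \<ge> 1" "\<And>i. i < n \<Longrightarrow> e i \<le> 1" "e 0 = 1" "n \<ge> 1" "s + 2 \<le> 2 ^ (m - 1)"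
  shows "root_sum (cit (m + n)) (orbit_monom n m s e) = 0"
  using assms(4,2)
proof (induction n rule: dec_induct)
  case base
  let ?g = "orbit_monom 1 m s e"
  have g: "?g = [:0, 1:] ^ s * cit m" using assms(3) by (simp add: orbit_monom_def)
  have "degree ?g + 2 ^ (m - 1) \<le> s + 2 ^ (m + 1 - 1)"
    by (rule degree_orbit_monom) (use assms(1) base in auto)
  moreover have "(2 :: nat) ^ m = 2 * 2 ^ (m - 1)" using assms(1) by (cases m) auto
  ultimately have "root_sum (cit (Suc m)) ?g = 2 * root_sum (cit m) ?g"
    using assms by (intro root_sum_cit_Suc) (auto simp: degree_cit)
  moreover have "root_sum (cit m) ?g = 0"
    unfolding g by (rule root_sum_eq_0) (use assms(1) cit_nonzero in auto)
  ultimately show ?case by simp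
next
  case (step n)
  let ?g = "orbit_monom (Suc n) m s e"
  have g: "?g = orbit_monom n m s e * cit (m + n) ^ e n" by (simp add: orbit_monom_def)
  have "degree ?g + 2 ^ (m - 1) \<le> s + 2 ^ (m + Suc n - 1)"
    by (rule degree_orbit_monom) (use assms(1) step.prems in auto)
  moreover have "(2 :: nat) ^ (m + n) = 2 * 2 ^ (m + n - 1)" using assms(1) by (cases m) auto
  ultimately have 1: "root_sum (cit (Suc (m + n))) ?g = 2 * root_sum (cit (m + n)) ?g"
    using assms(1,5) by (intro root_sum_cit_Suc) (auto simp: degree_cit)
  have "root_sum (cit (m + n)) ?g = 0"
  proof (cases "e n = 0")
    case True
    then show ?thesis using step.IH step.prems by (simp add: g)
  next
    case False
    then show ?thesis
      unfolding g using assms(1) cit_nonzero[of "m + n"] by (intro root_sum_eq_0) auto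
  qed
  then show ?case using 1 by simp
qed

text \<open>For \<open>e 0 = 0\<close> the polynomials \<open>b - a\<close> and \<open>b + a\<close>
  are close enough to have equal sums. For \<open>e 0 = 1\<close> the two sums cancel: the product
  \<open>b ^ 2 - a ^ 2\<close> is close to \<open>b ^ 2\<close>, and the sum over the roots of
  \<open>b\<close> vanishes by the previous lemma.\<close>

lemma root_sum_flip_base:
  assumes "m \<ge> 1" "n \<ge> 1" "\<And>i. i < n \<Longrightarrow> e i \<le> 1" "2 * s + (\<Sum>i<n. e i) + 2 \<le> 2 ^ m"
  shows "root_sum (critE n m) (orbit_monom n m s e)
    = (- 1) ^ e 0 * root_sum (critF n (Suc m)) (orbit_monom n m s e)"
proof -
  define a b g where "a = cit m" and "b = cit (m + n)" and "g = orbit_monom n m s e"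
  have ma: "monic a" unfolding a_def by (rule monic_cit[OF assms(1)])
  have mb: "monic b" unfolding b_def by (rule monic_cit) (use assms in auto)
  have da: "degree a = 2 ^ (m - 1)" and db: "degree b = 2 ^ (m + n - 1)"
    using assms by (simp_all add: a_def b_def degree_cit)
  have pos: "degree a \<ge> 1" "degree b \<ge> 1" using da db by auto
  have E: "critE n m = b - a" and F: "critF n (Suc m) = b + a"
    by (simp_all add: critE_def critF_def a_def b_def)
  note mE = monic_critE[OF assms(2,1)] and mF = monic_critF_Suc[OF assms(2,1)]
  have m2: "(2 :: nat) ^ m = 2 * 2 ^ (m - 1)" using assms(1) by (cases m) auto
  have bm: "(2 :: nat) ^ m \<le> 2 ^ (m + n - 1)" using assms by (intro power_increasing) auto
  have w: "degree (a * pderiv b - pderiv a * b) + 1 \<le> degree a + degree b"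
    by (rule degree_wronskian[OF pos])
  have e0: "e 0 \<le> 1" using assms(2,3) by auto
  consider "e 0 = 0" | "e 0 = 1" using e0 by linarith
  then show ?thesis
  proof cases
    case 1
    have s: "s + 1 \<le> 2 ^ (m - 1)" using assms(4) m2 by linarith
    have dg: "degree g + 2 ^ m \<le> s + 2 ^ (m + n - 1)"
      unfolding g_def using assms 1 by (intro degree_orbit_monom) auto
    define W where "W = g * (a * pderiv b - pderiv a * b)"
    have "root_sum (critE n m) g = root_sum (critF n (Suc m)) g"
    proof (rule root_sum_compare_eq[where K = 0])
      show "W + W = g * pderiv (critE n m) * critF n (Suc m) - g * pderiv (critF n (Suc m)) * critE n m
          - 0 * critE n m * critF n (Suc m)"
        unfolding E F W_def by (simp add: pderiv_add pderiv_diff algebra_simps)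
      have "degree (W + W) \<le> degree g + degree (a * pderiv b - pderiv a * b)"
        unfolding W_def using degree_mult_le by (intro degree_add_le) auto
      then show "degree (W + W) + 2 \<le> degree (critE n m) + degree (critF n (Suc m))"
        using w dg s mE(2) mF(2) da db m2 by linarith
    qed (rule mE(1) mF(1))+
    then show ?thesis using 1 by (simp add: g_def)
  next
    case 2
    have "(\<Sum>i<n. e i) \<ge> 1"
      using 2 assms(2) by (metis One_nat_def finite_lessThan le_numeral_extra(4) lessThan_iff
          linorder_not_less less_one member_le_sum zero_le not_gr_zero sum_eq_0_iff zero_neq_one)
    then have s: "s + 2 \<le> 2 ^ (m - 1)" using assms(4) m2 by linarith
    have dg: "degree g + 2 ^ (m - 1) \<le> s + 2 ^ (m + n - 1)"
      unfolding g_def using assms by (intro degree_orbit_monom) auto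
    have EF0: "critE n m \<noteq> 0" "critF n (Suc m) \<noteq> 0" using mE(1) mF(1) by auto
    have EF: "critE n m * critF n (Suc m) = b ^ 2 - a ^ 2"
      unfolding E F by (simp add: power2_eq_square algebra_simps)
    define W where "W = g * (a * (b * (a * pderiv b - pderiv a * b)))"
    have b0: "b \<noteq> 0" using mb by auto
    have dEF: "degree (critE n m * critF n (Suc m)) = 2 * degree b"
      using EF0 mE(2) mF(2) db by (simp add: degree_mult_eq)
    have "root_sum (critE n m * critF n (Suc m)) g = root_sum (b ^ 2) g"
    proof (rule root_sum_compare_eq[where K = 0])
      show "monic (critE n m * critF n (Suc m))"
        using mE(1) mF(1) by (simp only: lead_coeff_mult mult_1)
      show "monic (b ^ 2)" by (rule monic_square[OF mb])
      show "W + W = g * pderiv (critE n m * critF n (Suc m)) * b ^ 2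
          - g * pderiv (b ^ 2) * (critE n m * critF n (Suc m)) - 0 * (critE n m * critF n (Suc m)) * b ^ 2"
        unfolding EF W_def by (simp add: power2_eq_square pderiv_mult pderiv_diff algebra_simps)
      have "degree (a * (b * (a * pderiv b - pderiv a * b)))
          \<le> degree a + (degree b + degree (a * pderiv b - pderiv a * b))"
        using degree_mult_le[of a "b * (a * pderiv b - pderiv a * b)"]
          degree_mult_le[of b "a * pderiv b - pderiv a * b"] by linarith
      then have "degree W \<le> degree g + (degree a + (degree b + degree (a * pderiv b - pderiv a * b)))"
        unfolding W_def using degree_mult_le[of g "a * (b * (a * pderiv b - pderiv a * b))"] by linarith
      then have "degree (W + W) \<le> degree g + (degree a + (degree b + degree (a * pderiv b - pderiv a * b)))"
        by (intro degree_add_le)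
      moreover have "degree (b ^ 2) = 2 * degree b" using b0 by (simp add: degree_power_eq)
      ultimately show "degree (W + W) + 2 \<le> degree (critE n m * critF n (Suc m)) + degree (b ^ 2)"
        using w dg s da db m2 bm dEF by linarith
    qed
    also have "root_sum (b ^ 2) g = 2 * root_sum b g" by (rule root_sum_square[OF b0])
    also have "root_sum b g = 0"
      unfolding b_def g_def using assms 2 s by (intro root_sum_cit_orbit_monom) auto
    finally have "root_sum (critE n m) g + root_sum (critF n (Suc m)) g = 0"
      using EF0 by (simp add: root_sum_mult)
    then show ?thesis using 2 by (simp add: g_def eq_neg_iff_add_eq_0)
  qed
qed

lemma prod_fun_upd_split:
  fixes f :: "nat \<Rightarrow> 'a :: comm_monoid_mult"
  assumes "i < n"
  shows "(\<Prod>j<n. f j ^ (e(i := k)) j) = f i ^ k * (\<Prod>j\<in>{..<n} - {i}. f j ^ e j)"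
proof -
  have "(\<Prod>j<n. f j ^ (e(i := k)) j) = f i ^ (e(i := k)) i * (\<Prod>j\<in>{..<n} - {i}. f j ^ (e(i := k)) j)"
    using assms by (intro prod.remove) auto
  then show ?thesis by simp
qed

lemma orbit_monom_upd:
  assumes "i < n"
  shows "orbit_monom n m s (e(i := e i + k)) = orbit_monom n m s e * cit (m + i) ^ k"
proof -
  let ?f = "\<lambda>j. cit (m + j)"
  have 1: "(\<Prod>j<n. ?f j ^ (e(i := e i + k)) j) = ?f i ^ (e i + k) * (\<Prod>j\<in>{..<n} - {i}. ?f j ^ e j)"
    by (rule prod_fun_upd_split[OF assms])
  have 2: "(\<Prod>j<n. ?f j ^ e j) = ?f i ^ e i * (\<Prod>j\<in>{..<n} - {i}. ?f j ^ e j)"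
    using prod_fun_upd_split[OF assms, of ?f e "e i"] by simp
  show ?thesis unfolding orbit_monom_def 1 2 by (simp add: power_add mult_ac)
qed

lemma sum_fun_upd:
  fixes e :: "nat \<Rightarrow> nat"
  assumes "i < n"
  shows "(\<Sum>j<n. (e(i := k)) j) + e i = (\<Sum>j<n. e j) + k"
proof -
  have "(\<Sum>j<n. (e(i := k)) j) = k + (\<Sum>j\<in>{..<n} - {i}. e j)"
    using assms by (subst sum.remove[of _ i]) auto
  moreover have "(\<Sum>j<n. e j) = e i + (\<Sum>j\<in>{..<n} - {i}. e j)"
    using assms by (subst sum.remove[of _ i]) auto
  ultimately show ?thesis by simp
qed

text \<open>A monomial in the cycle of weight at most \<open>2\<^sup>m - 2\<close> (with \<open>c\<close> of weight 2) is reduced to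
  a squarefree one by the relation \<open>z\<^sub>i\<^sup>2 = z\<^bsub>i+1\<^esub> - c\<close>, which does not increase the weight.\<close>

lemma root_sum_flip:
  assumes "m \<ge> 1" "n \<ge> 1" "2 * s + (\<Sum>i<n. e i) + 2 \<le> 2 ^ m"
  shows "root_sum (critE n m) (orbit_monom n m s e)
    = (- 1) ^ e 0 * root_sum (critF n (Suc m)) (orbit_monom n m s e)"
  using assms(3)
proof (induction "\<Sum>i<n. e i" arbitrary: s e rule: less_induct)
  case less
  show ?case
  proof (cases "\<forall>i<n. e i \<le> 1")
    case True
    then show ?thesis using assms less.prems by (intro root_sum_flip_base) auto
  next
    case False
    then obtain i where i: "i < n" "e i \<ge> 2" by (metis Suc_1 not_less_eq_eq One_nat_def)
    define e1 where "e1 = e(i := e i - 2)"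
    have e1: "e = e1(i := e1 i + 2)" using i by (auto simp: e1_def fun_eq_iff)
    have se1: "(\<Sum>i<n. e1 i) + 2 = (\<Sum>i<n. e i)"
      using sum_fun_upd[OF i(1), of e "e i - 2"] i by (simp add: e1_def)
    \<comment> \<open>The exponent taken from \<open>i\<close> moves on to the next index. Past the
      end it wraps around to 0, which costs a sign at the roots of \<open>critF\<close>; this is why
      the sign in the claim depends on \<open>e 0\<close> alone.\<close>
    define i' where "i' = (if Suc i < n then Suc i else 0)"
    have i': "i' < n" using assms by (auto simp: i'_def)
    define e2 where "e2 = e1(i' := e1 i' + 1)"
    have se2: "(\<Sum>i<n. e2 i) = (\<Sum>i<n. e1 i) + 1"
      using sum_fun_upd[OF i', of e1 "e1 i' + 1"] by (simp add: e2_def)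
    have split: "orbit_monom n m s e = orbit_monom n m s e1 * cit (m + Suc i) - orbit_monom n m (Suc s) e1"
      by (subst e1, subst orbit_monom_upd[OF i(1)]) (simp add: orbit_monom_def cit_Suc algebra_simps)
    have om2: "orbit_monom n m s e2 = orbit_monom n m s e1 * cit (m + i')"
      unfolding e2_def orbit_monom_upd[OF i'] by simp
    have nz: "critE n m \<noteq> 0" "critF n (Suc m) \<noteq> 0"
      using monic_critE(1)[OF assms(2,1)] monic_critF_Suc(1)[OF assms(2,1)] by auto
    have IH1: "root_sum (critE n m) (orbit_monom n m (Suc s) e1)
        = (- 1) ^ e1 0 * root_sum (critF n (Suc m)) (orbit_monom n m (Suc s) e1)"
      using less.prems se1 by (intro less.hyps) auto
    have IH2: "root_sum (critE n m) (orbit_monom n m s e2)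
        = (- 1) ^ e2 0 * root_sum (critF n (Suc m)) (orbit_monom n m s e2)"
      using less.prems se1 se2 by (intro less.hyps) auto
    have par: "(- 1) ^ e1 0 = ((- 1) ^ e 0 :: complex)"
    proof (cases "i = 0")
      case True
      then have "e 0 = e1 0 + 2" using i by (simp add: e1_def)
      then show ?thesis by simp
    qed (simp add: e1_def)
    have E2: "root_sum (critE n m) (orbit_monom n m s e1 * cit (m + Suc i)) = root_sum (critE n m) (orbit_monom n m s e2)"
    proof (rule root_sum_cong[OF _ nz(1)])
      fix r assume r: "poly (critE n m) r = 0"
      show "poly (orbit_monom n m s e1 * cit (m + Suc i)) r = poly (orbit_monom n m s e2) r"
      proof (cases "Suc i < n")
        case False
        then have "Suc i = n" using i by simp
        then show ?thesis using r False unfolding om2 by (simp add: i'_def critE_def)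
      qed (simp only: om2 i'_def if_True)
    qed
    have F2: "(- 1) ^ e 0 * root_sum (critF n (Suc m)) (orbit_monom n m s e1 * cit (m + Suc i))
        = (- 1) ^ e2 0 * root_sum (critF n (Suc m)) (orbit_monom n m s e2)"
    proof (cases "Suc i < n")
      case True
      then have "e2 0 = e1 0" by (simp add: e2_def i'_def)
      then show ?thesis unfolding om2 using True par by (simp add: i'_def)
    next
      case False
      then have n: "Suc i = n" and i0: "i' = 0" using i by (auto simp: i'_def)
      have "root_sum (critF n (Suc m)) (orbit_monom n m s e1 * cit (m + Suc i))
          = root_sum (critF n (Suc m)) (- orbit_monom n m s e2)"
      proof (rule root_sum_cong[OF _ nz(2)])
        fix r assume "poly (critF n (Suc m)) r = 0"
        then have "poly (cit (m + n)) r = - poly (cit m) r"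
          by (simp add: critF_def eq_neg_iff_add_eq_0)
        then show "poly (orbit_monom n m s e1 * cit (m + Suc i)) r = poly (- orbit_monom n m s e2) r"
          unfolding om2 n i0 by simp
      qed
      moreover have "e2 0 = e1 0 + 1" by (simp add: e2_def i0)
      ultimately show ?thesis using par by (simp add: root_sum_uminus)
    qed
    show ?thesis
      unfolding split root_sum_diff E2 IH1 IH2 right_diff_distrib F2 par ..
  qed
qed

text \<open>The sign of the flip cancels the one in \<open>cyc_sum_Suc\<close>. Two consecutive
  instances show that the sum doubles from one level to the next.\<close>

theorem cyc_sum_doubling:
  assumes "n \<ge> 1" "m \<ge> 1" "q \<ge> 1" "n * q + 2 \<le> 2 ^ m"
  shows "cyc_sum n (Suc m) q = (\<Sum>i=1..m. cyc_sum n i q)"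
proof -
  have om: "orbit_monom n m 0 (\<lambda>_. q) = cyc n m ^ q"
    by (simp add: orbit_monom_def cyc_def prod_power_distrib)
  have "root_sum (critE n m) (cyc n m ^ q) = (- 1) ^ q * root_sum (critF n (Suc m)) (cyc n m ^ q)"
    using root_sum_flip[of m n 0 "\<lambda>_. q"] assms by (simp add: om)
  then show ?thesis
    using cyc_sum_Suc[of n m q] root_sum_critE[of n q m] assms by simp
qed

section \<open>Sums over fixed points\<close>

text \<open>The two coefficients, as polynomials in the parameter, of \<open>x ^ q\<close> reduced
  modulo the fixed point equation \<open>x\<^sup>2 = x - c\<close>.\<close>

fun fix_pow0 :: "nat \<Rightarrow> complex poly" and fix_pow1 :: "nat \<Rightarrow> complex poly" where
  "fix_pow0 0 = 1"
| "fix_pow0 (Suc q) = - [:0, 1:] * fix_pow1 q"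
| "fix_pow1 0 = 0"
| "fix_pow1 (Suc q) = fix_pow0 q + fix_pow1 q"

lemma fix_pow:
  assumes "x\<^sup>2 + c = (x :: complex)"
  shows "x ^ q = poly (fix_pow0 q) c + poly (fix_pow1 q) c * x"
proof (induction q)
  case (Suc q)
  have "x ^ Suc q = (poly (fix_pow0 q) c + poly (fix_pow1 q) c * x) * x" using Suc by simp
  also have "\<dots> = poly (fix_pow0 q) c * x + poly (fix_pow1 q) c * x\<^sup>2"
    by (simp add: power2_eq_square algebra_simps)
  also have "x\<^sup>2 = x - c" using assms by (simp add: eq_diff_eq)
  finally show ?case by (simp add: algebra_simps)
qed simp

lemma degree_fix_pow: "2 * degree (fix_pow0 q) \<le> q \<and> 2 * degree (fix_pow1 q) \<le> q - 1"
proof (induction q)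
  case (Suc q)
  have "2 * degree (fix_pow0 (Suc q)) \<le> Suc q"
  proof (cases "q = 0")
    case False
    have d1: "degree (- [:0, 1 :: complex:]) = 1" by simp
    have "degree (fix_pow0 (Suc q)) \<le> 1 + degree (fix_pow1 q)"
      using degree_mult_le[of "- [:0, 1 :: complex:]" "fix_pow1 q"] unfolding d1 fix_pow0.simps .
    then show ?thesis using Suc False by linarith
  qed simp
  moreover have "degree (fix_pow1 (Suc q)) \<le> max (degree (fix_pow0 q)) (degree (fix_pow1 q))"
    by (simp add: degree_add_le_max)
  ultimately show ?case using Suc by auto
qed simp

text \<open>The summand on the right is \<open>x ^ q + x' ^ q\<close> for the two fixed points
  \<open>x\<close> and \<open>x'\<close> of the map, which add up to 1. The sum is thereby moved to
  the roots of \<open>cit m\<close>, where its sign can be determined.\<close>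

lemma cyc_sum_fixed_points:
  assumes "m \<ge> 1" "q \<ge> 1" "q + 2 \<le> 2 ^ m"
  shows "cyc_sum 1 (Suc m) q = root_sum (cit m) (fix_pow0 q + fix_pow0 q + fix_pow1 q)"
proof -
  define a E where "a = cit m" and "E = critE 1 m"
  define r0 r1 where "r0 = fix_pow0 q" and "r1 = fix_pow1 q"
  define X where "X = [:0, 1 :: complex:]"
  have X': "pderiv X = 1" by (simp add: X_def pderiv_pCons)
  have dX: "degree X = 1" by (simp add: X_def)
  have ma: "monic a" and a0: "a \<noteq> 0" unfolding a_def using assms monic_cit cit_nonzero by auto
  have E: "E = a ^ 2 + X - a" by (simp add: E_def critE_def a_def cit_Suc X_def)
  have mE: "monic E" "degree E = 2 * degree a"
    using monic_critE[of 1 m] assms by (simp_all add: E_def a_def degree_cit) (cases m; simp)+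
  have m2: "(2 :: nat) ^ m = 2 * 2 ^ (m - 1)" using assms(1) by (cases m) auto
  have da: "degree a = 2 ^ (m - 1)" using assms by (simp add: a_def degree_cit)
  have dr: "degree r0 + 1 \<le> degree a" "degree r1 + 2 \<le> degree a"
    using degree_fix_pow[of q] assms m2 da by (auto simp: r0_def r1_def)
  have pa: "degree (pderiv a) + 1 = degree a" by (rule degree_pderiv_less) (use da in simp)
  have dE2: "degree (a ^ 2) = 2 * degree a" using a0 by (simp add: degree_power_eq)
  have Xa: "degree (X * pderiv a) \<le> degree a"
    using degree_mult_le[of X "pderiv a"] dX pa by linarith
  have aa: "degree (a * pderiv a) + 1 \<le> 2 * degree a"
    using degree_mult_le[of a "pderiv a"] pa by linarith
  have Xaa: "degree (a * (X * pderiv a)) \<le> 2 * degree a"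
    using degree_mult_le[of a "X * pderiv a"] Xa by linarith
  have "root_sum E r0 = root_sum (a ^ 2) r0"
  proof (rule root_sum_compare_eq[where K = 0])
    let ?V = "a + a * pderiv a - (X * pderiv a + X * pderiv a)"
    show "r0 * (a * ?V) = r0 * pderiv E * a ^ 2 - r0 * pderiv (a ^ 2) * E - 0 * E * a ^ 2"
      unfolding E by (simp add: power2_eq_square pderiv_mult pderiv_add pderiv_diff X' algebra_simps)
    have "degree ?V + 1 \<le> 2 * degree a"
    proof -
      have "degree ?V \<le> 2 * degree a - 1"
        using Xa aa dr by (intro degree_diff_le degree_add_le) auto
      then show ?thesis using dr by linarith
    qed
    moreover have "degree (r0 * (a * ?V)) \<le> degree r0 + (degree a + degree ?V)"
      using degree_mult_le[of r0 "a * ?V"] degree_mult_le[of a ?V] by linarith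
    ultimately show "degree (r0 * (a * ?V)) + 2 \<le> degree E + degree (a ^ 2)"
      using mE dE2 dr by linarith
  qed (rule mE(1), rule monic_square[OF ma])
  then have 1: "root_sum E r0 = 2 * root_sum a r0" by (simp add: root_sum_square[OF a0])
  \<comment> \<open>The \<open>K\<close> used here is the polynomial part of
    \<open>r1 * a * pderiv E / E - r1 * pderiv a / a\<close>.\<close>
  have 2: "root_sum E (r1 * a) = root_sum a r1"
  proof (rule root_sum_compare_eq[where K = "r1 * pderiv a + r1 * pderiv a"])
    let ?V = "a ^ 2 - X * pderiv a + a * pderiv a - (a * (X * pderiv a) + a * (X * pderiv a))"
    show "r1 * ?V = r1 * a * pderiv E * a - r1 * pderiv a * E - (r1 * pderiv a + r1 * pderiv a) * E * a"
      unfolding E by (simp add: power2_eq_square pderiv_mult pderiv_add pderiv_diff X' algebra_simps)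
    have "degree ?V \<le> 2 * degree a"
      using Xa aa Xaa dE2 by (intro degree_diff_le degree_add_le) auto
    then show "degree (r1 * ?V) + 2 \<le> degree E + degree a"
      using degree_mult_le[of r1 ?V] mE dr by linarith
  qed (rule mE(1), rule ma)
  have "cyc_sum 1 (Suc m) q = root_sum E (a ^ q)"
    using cyc_sum_doubling[of 1 m q] root_sum_critE[of 1 q m] assms
    by (simp add: E_def a_def cyc_def)
  also have "\<dots> = root_sum E (r0 + r1 * a)"
  proof (rule root_sum_cong)
    fix r assume "poly E r = 0"
    then have "(poly a r)\<^sup>2 + r = poly a r" by (simp add: E X_def)
    then show "poly (a ^ q) r = poly (r0 + r1 * a) r"
      using fix_pow[of "poly a r" r q] by (simp add: r0_def r1_def)
  qed (use mE in auto)
  also have "\<dots> = root_sum a (r0 + r0 + r1)"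
    by (simp only: root_sum_add 1 2 mult_2)
  finally show ?thesis by (simp add: a_def r0_def r1_def)
qed

section \<open>Positivity of the sums over fixed points\<close>

definition nonneg_real :: "complex \<Rightarrow> bool" where
  "nonneg_real z \<longleftrightarrow> Im z = 0 \<and> Re z \<ge> 0"

lemma nonneg_real_add: "nonneg_real a \<Longrightarrow> nonneg_real b \<Longrightarrow> nonneg_real (a + b)"
  and nonneg_real_mult: "nonneg_real a \<Longrightarrow> nonneg_real b \<Longrightarrow> nonneg_real (a * b)"
  and nonneg_real_of_nat [simp]: "nonneg_real (of_nat n)"
  and nonneg_real_0 [simp]: "nonneg_real 0"
  and nonneg_real_1 [simp]: "nonneg_real 1"
  by (auto simp: nonneg_real_def)

lemma nonneg_real_sum: "(\<And>i. i \<in> A \<Longrightarrow> nonneg_real (f i)) \<Longrightarrow> nonneg_real (\<Sum>i\<in>A. f i)"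
  by (induction A rule: infinite_finite_induct) (auto intro: nonneg_real_add)

definition nonneg_fps :: "complex fps \<Rightarrow> bool" where
  "nonneg_fps F \<longleftrightarrow> (\<forall>n. nonneg_real (fps_nth F n))"

lemma nonneg_fps_add: "nonneg_fps F \<Longrightarrow> nonneg_fps G \<Longrightarrow> nonneg_fps (F + G)"
  by (auto simp: nonneg_fps_def intro: nonneg_real_add)

lemma nonneg_fps_mult: "nonneg_fps F \<Longrightarrow> nonneg_fps G \<Longrightarrow> nonneg_fps (F * G)"
  by (auto simp: nonneg_fps_def fps_mult_nth intro!: nonneg_real_sum nonneg_real_mult)

lemma nonneg_fps_deriv: "nonneg_fps F \<Longrightarrow> nonneg_fps (fps_deriv F)"
  unfolding nonneg_fps_def fps_deriv_nth by (blast intro: nonneg_real_mult nonneg_real_of_nat)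

lemma nonneg_fps_X_power: "nonneg_fps (fps_X ^ k)"
  by (auto simp: nonneg_fps_def fps_X_power_nth)

lemma nonneg_fps_geometric:
  assumes "nonneg_fps W" "fps_nth W 0 = 0" "G = 1 + W * G"
  shows "nonneg_fps G"
  unfolding nonneg_fps_def
proof
  fix n show "nonneg_real (fps_nth G n)"
  proof (induction n rule: less_induct)
    case (less n)
    have "fps_nth G n = fps_nth (1 + W * G) n" using assms(3) by (rule arg_cong)
    also have "\<dots> = (if n = 0 then 1 else 0) + (\<Sum>i=0..n. fps_nth W i * fps_nth G (n - i))"
      by (simp add: fps_mult_nth)
    also have "nonneg_real \<dots>"
    proof (intro nonneg_real_add nonneg_real_sum)
      fix i assume "i \<in> {0..n}"
      show "nonneg_real (fps_nth W i * fps_nth G (n - i))"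
      proof (cases "i = 0")
        case False
        then show ?thesis using assms(1) less \<open>i \<in> {0..n}\<close>
          by (intro nonneg_real_mult) (auto simp: nonneg_fps_def)
      qed (simp add: assms(2))
    qed auto
    finally show ?case .
  qed
qed

definition neg_eps :: "nat \<Rightarrow> complex poly" where
  "neg_eps i = eps (image_mset uminus (proots (cit i)))"

text \<open>\<open>neg_eps i\<close> is the reversed \<open>cit i\<close> evaluated at
  \<open>- X\<close>. Under reversal the summand \<open>c\<close> of \<open>cit (Suc i)\<close>
  becomes \<open>X ^ (2 ^ i - 1)\<close>, and the exponent is odd.\<close>

lemma neg_eps_Suc:
  assumes "i \<ge> 1"
  shows "neg_eps (Suc i) = neg_eps i ^ 2 - monom 1 (2 ^ i - 1)"
proof -
  have ev: "poly (neg_eps j) x = poly (reflect_poly (cit j)) (- x)" if "j \<ge> 1" for j x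
  proof -
    have "poly (eps (image_mset uminus M)) x = poly (eps M) (- x)" for M
      by (simp add: poly_eps image_mset.compositionality o_def)
    then show ?thesis by (simp add: neg_eps_def eps_proots_of_monic[OF monic_cit[OF that]])
  qed
  have d: "degree (cit i ^ 2) = 2 ^ i" "degree (cit (Suc i)) = 2 ^ i"
    using assms cit_nonzero[of i] by (simp_all add: degree_power_eq degree_cit) (cases i; simp)
  have "reflect_poly (cit (Suc i)) = reflect_poly (cit i ^ 2) + monom 1 (2 ^ i - 1)"
  proof (rule poly_eqI)
    fix n
    show "coeff (reflect_poly (cit (Suc i))) n = coeff (reflect_poly (cit i ^ 2) + monom 1 (2 ^ i - 1)) n"
    proof (cases "n \<le> 2 ^ i")
      case True
      have "(2 ^ i - n = 1) = (n = 2 ^ i - 1)" using True one_le_power[of "2 :: nat" i] by auto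
      then have "coeff [:0, 1 :: complex:] (2 ^ i - n) = coeff (monom 1 (2 ^ i - 1)) n"
        by (auto simp: coeff_pCons split: nat.splits)
      moreover have "coeff (cit (Suc i)) (2 ^ i - n) = coeff (cit i ^ 2) (2 ^ i - n) + coeff [:0, 1:] (2 ^ i - n)"
        by (simp only: cit_Suc[of i] coeff_add)
      ultimately show ?thesis using True by (simp only: coeff_reflect_poly d coeff_add) simp
    qed (auto simp: coeff_reflect_poly d)
  qed
  then have r: "reflect_poly (cit (Suc i)) = reflect_poly (cit i) ^ 2 + monom 1 (2 ^ i - 1)"
    by (simp only: reflect_poly_power)
  have "odd ((2 :: nat) ^ i - 1)" using assms by auto
  then have "poly (neg_eps (Suc i)) x = poly (neg_eps i ^ 2 - monom 1 (2 ^ i - 1)) x" for x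
    using assms by (simp add: ev r poly_monom)
  then show ?thesis by (metis poly_eq_poly_eq_iff ext)
qed

text \<open>With \<open>\<alpha>\<close> for \<open>neg_eps\<close> and
  \<open>W = X ^ k / \<alpha> i ^ 2\<close>, the recursion is
  \<open>\<alpha> (Suc i) = \<alpha> i ^ 2 * (1 - W)\<close>. So \<open>1 / \<alpha>\<close> and
  minus the logarithmic derivative of \<open>\<alpha>\<close> keep nonnegative coefficients
  together; the latter generates the power sums.\<close>

lemma nonneg_psum_neg_roots:
  assumes "i \<ge> 1"
  shows "nonneg_real (psum (image_mset uminus (proots (cit i))) (Suc n))"
proof -
  define P where "P = (\<lambda>i. Abs_fps (\<lambda>n. psum (image_mset uminus (proots (cit i))) (Suc n)))"
  define \<alpha> where "\<alpha> = (\<lambda>i. fps_of_poly (neg_eps i))"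
  have \<alpha>0: "fps_nth (\<alpha> i) 0 = 1" for i by (simp add: \<alpha>_def neg_eps_def)
  have inv: "\<alpha> i * inverse (\<alpha> i) = 1" for i using \<alpha>0[of i] by (simp add: inverse_mult_eq_1')
  have D: "fps_deriv (\<alpha> i) = - (\<alpha> i * P i)" for i
    unfolding \<alpha>_def P_def neg_eps_def by (rule fps_deriv_eps)
  have "nonneg_fps (inverse (\<alpha> i)) \<and> nonneg_fps (P i)"
    using assms
  proof (induction i rule: dec_induct)
    case base
    have "cit 1 = [:0, 1:]" by (simp add: cit_Suc)
    then have "proots (cit 1) = {#0#}" using proots_linear_factor[of "0 :: complex"] by simp
    then show ?case by (auto simp: \<alpha>_def P_def neg_eps_def nonneg_fps_def)
  next
    case (step i)
    define k :: nat where "k = 2 ^ i - 1"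
    define \<beta> where "\<beta> = inverse (\<alpha> i)"
    have ab: "\<alpha> i * \<beta> = 1" using inv by (simp add: \<beta>_def)
    define W where "W = fps_X ^ k * \<beta> ^ 2"
    define G where "G = inverse (1 - W)"
    have k: "k \<ge> 1" using step one_less_power[of "2 :: nat" i] by (simp add: k_def)
    have W0: "fps_nth W 0 = 0" using k by (simp add: W_def)
    have GW: "(1 - W) * G = 1" unfolding G_def by (rule inverse_mult_eq_1') (simp add: W0)
    have G1: "G = 1 + W * G" using GW by (simp add: algebra_simps)
    have nb: "nonneg_fps \<beta>" using step by (simp add: \<beta>_def)
    have nW: "nonneg_fps W" unfolding W_def power2_eq_square
      by (intro nonneg_fps_mult nonneg_fps_X_power nb)
    have nG: "nonneg_fps G" by (rule nonneg_fps_geometric[OF nW W0 G1])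
    have b2: "\<alpha> i ^ 2 * \<beta> ^ 2 = 1" using ab by (metis power_mult_distrib power_one)
    have \<alpha>S: "\<alpha> (Suc i) = \<alpha> i ^ 2 * (1 - W)"
    proof -
      have "\<alpha> (Suc i) = \<alpha> i ^ 2 - fps_X ^ k"
        using step unfolding \<alpha>_def neg_eps_Suc[OF step(1)]
        by (simp add: fps_of_poly_diff fps_of_poly_power fps_of_poly_monom k_def)
      also have "\<dots> = \<alpha> i ^ 2 - fps_X ^ k * (\<alpha> i ^ 2 * \<beta> ^ 2)" unfolding b2 by simp
      finally show ?thesis by (simp add: W_def algebra_simps)
    qed
    have "\<alpha> (Suc i) * (\<beta> ^ 2 * G) = (\<alpha> i ^ 2 * \<beta> ^ 2) * ((1 - W) * G)"
      unfolding \<alpha>S by (simp only: mult_ac)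
    then have one: "\<alpha> (Suc i) * (\<beta> ^ 2 * G) = 1" by (simp only: b2 GW mult_1)
    have invS: "inverse (\<alpha> (Suc i)) = \<beta> ^ 2 * G"
    proof -
      have "inverse (\<alpha> (Suc i)) = inverse (\<alpha> (Suc i)) * (\<alpha> (Suc i) * (\<beta> ^ 2 * G))" by (simp only: one mult_1_right)
      also have "\<dots> = (\<alpha> (Suc i) * inverse (\<alpha> (Suc i))) * (\<beta> ^ 2 * G)" by (simp only: mult_ac)
      finally show ?thesis by (simp only: inv mult_1)
    qed
    have "fps_deriv (\<alpha> (Suc i)) = - (\<alpha> i ^ 2 * (P i + P i) * (1 - W) + \<alpha> i ^ 2 * fps_deriv W)"
      unfolding \<alpha>S by (simp add: power2_eq_square D algebra_simps)
    then have e1: "\<alpha> (Suc i) * P (Suc i) = \<alpha> i ^ 2 * (P i + P i) * (1 - W) + \<alpha> i ^ 2 * fps_deriv W"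
      by (simp only: D neg_equal_iff_equal)
    have "(\<beta> ^ 2 * G) * (\<alpha> i ^ 2 * (P i + P i) * (1 - W) + \<alpha> i ^ 2 * fps_deriv W)
        = (\<alpha> i ^ 2 * \<beta> ^ 2) * (P i + P i) * ((1 - W) * G) + (\<alpha> i ^ 2 * \<beta> ^ 2) * (fps_deriv W * G)"
      by (simp add: algebra_simps)
    moreover have "(\<beta> ^ 2 * G) * (\<alpha> (Suc i) * P (Suc i)) = (\<alpha> (Suc i) * (\<beta> ^ 2 * G)) * P (Suc i)"
      by (simp only: mult_ac)
    ultimately have "1 * P (Suc i) = 1 * (P i + P i) * 1 + 1 * (fps_deriv W * G)"
      by (simp only: e1[symmetric] one b2 GW)
    then have PS: "P (Suc i) = P i + P i + fps_deriv W * G"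
      by (simp only: one b2 GW mult_1 mult_1_right)
    have "nonneg_fps (P i)" using step by blast
    then have "nonneg_fps (P (Suc i))"
      unfolding PS by (intro nonneg_fps_add nonneg_fps_mult nonneg_fps_deriv nW nG)
    moreover have "nonneg_fps (inverse (\<alpha> (Suc i)))"
      unfolding invS power2_eq_square by (intro nonneg_fps_mult nb nG)
    ultimately show ?case by blast
  qed
  then show ?thesis by (auto simp: nonneg_fps_def P_def)
qed

text \<open>Nonnegative coefficients with respect to \<open>- X\<close>, to match the power sums of
  the negated roots.\<close>

definition alternating :: "complex poly \<Rightarrow> bool" where
  "alternating g \<longleftrightarrow> (\<forall>k. nonneg_real ((- 1) ^ k * coeff g k))"

lemma alternating_add: "alternating g \<Longrightarrow> alternating h \<Longrightarrow> alternating (g + h)"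
  by (auto simp: alternating_def distrib_left intro: nonneg_real_add)

lemma alternating_fix_pow: "alternating (fix_pow0 q) \<and> alternating (fix_pow1 q)"
proof (induction q)
  case (Suc q)
  have "alternating (fix_pow0 (Suc q))"
    unfolding alternating_def
  proof
    fix k
    show "nonneg_real ((- 1) ^ k * coeff (fix_pow0 (Suc q)) k)"
      using Suc by (cases k) (auto simp: alternating_def)
  qed
  then show ?case using Suc by (auto intro: alternating_add)
qed (auto simp: alternating_def)

lemma nonneg_root_sum_cit:
  assumes "m \<ge> 1" "alternating g"
  shows "nonneg_real (root_sum (cit m) g)"
proof -
  have p: "nonneg_real (root_sum (cit m) ((- [:0, 1:]) ^ k))" for k
  proof (cases k)
    case (Suc n)
    have "root_sum (cit m) ((- [:0, 1:]) ^ k) = psum (image_mset uminus (proots (cit m))) k"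
    proof -
      have "poly (- [:0, 1:]) = (uminus :: complex \<Rightarrow> complex)" by (rule ext) simp
      then show ?thesis by (simp only: root_sum_power)
    qed
    then show ?thesis using nonneg_psum_neg_roots[OF assms(1), of n] Suc by simp
  qed (simp add: root_sum_1)
  have "root_sum (cit m) g = root_sum (cit m) (\<Sum>k\<le>degree g. Polynomial.smult (coeff g k) ([:0, 1:] ^ k))"
    by (simp only: monom_altdef[symmetric] poly_as_sum_of_monoms)
  also have "\<dots> = (\<Sum>k\<le>degree g. ((- 1) ^ k * coeff g k) * root_sum (cit m) ((- [:0, 1:]) ^ k))"
  proof (unfold root_sum_sum, rule sum.cong[OF refl])
    fix k
    have "(- [:0, 1 :: complex:]) ^ k = Polynomial.smult ((- 1) ^ k) ([:0, 1:] ^ k)"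
      by (metis smult_power smult_minus_left smult_1_left)
    then have "((- 1) ^ k * coeff g k) * root_sum (cit m) ((- [:0, 1:]) ^ k)
        = ((- 1) ^ k * (- 1) ^ k) * (coeff g k * root_sum (cit m) ([:0, 1:] ^ k))"
      by (simp only: root_sum_smult mult_ac)
    also have "(- 1) ^ k * (- 1) ^ k = (1 :: complex)" by (metis left_minus_one_mult_self mult_1_right)
    finally show "root_sum (cit m) (Polynomial.smult (coeff g k) ([:0, 1:] ^ k))
        = ((- 1) ^ k * coeff g k) * root_sum (cit m) ((- [:0, 1:]) ^ k)"
      by (simp only: root_sum_smult mult_1)
  qed
  also have "nonneg_real \<dots>"
  proof (rule nonneg_real_sum)
    fix k
    show "nonneg_real (((- 1) ^ k * coeff g k) * root_sum (cit m) ((- [:0, 1:]) ^ k))"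
      by (rule nonneg_real_mult[OF _ p]) (use assms(2) in \<open>auto simp: alternating_def\<close>)
  qed
  finally show ?thesis .
qed

theorem cyc_sum_fixed_nonneg:
  assumes "m \<ge> 1" "q \<ge> 1" "q + 2 \<le> 2 ^ m"
  shows "nonneg_real (cyc_sum 1 (Suc m) q)"
  unfolding cyc_sum_fixed_points[OF assms]
  using assms alternating_fix_pow by (intro nonneg_root_sum_cit alternating_add) auto

section \<open>Integrality and congruences modulo p\<close>

lemma root_sum_int:
  fixes P g :: "int poly"
  assumes "monic P"
  shows "root_sum (of_int_poly P) (of_int_poly g) \<in> \<int>"
proof (rule rational_algebraic_int_is_int)
  have P: "monic (of_int_poly P :: complex poly)" using assms by simp
  then have nz: "(of_int_poly P :: complex poly) \<noteq> 0" by (metis coeff_0 zero_neq_one)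
  show "root_sum (of_int_poly P) (of_int_poly g) \<in> \<rat>"
    by (rule root_sum_rat[OF P]) auto
  show "algebraic_int (root_sum (of_int_poly P) (of_int_poly g))"
    unfolding root_sum_def using assms nz
    by (intro algebraic_int_sum_mset algebraic_int_poly_of_int) (auto intro: algebraic_int_monic_root)
qed

definition mis_W :: "nat \<Rightarrow> nat \<Rightarrow> int poly" where
  "mis_W m n = crit_iter (m + n - 1) + crit_iter (m - 1)"

lemma critF_mis_W: "critF n m = of_int_poly (mis_W m n)"
  by (simp add: critF_def mis_W_def cit_def hom_distribs)

lemma monic_mis_W: "n \<ge> 1 \<Longrightarrow> m \<ge> 1 \<Longrightarrow> monic (mis_W m n)"
  using monic_critF(1)[of n m] unfolding critF_mis_W by simp

lemma of_int_poly_prod: "of_int_poly (\<Prod>i\<in>A. f i) = (\<Prod>i\<in>A. of_int_poly (f i) :: complex poly)"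
  by (induction A rule: infinite_finite_induct) (auto simp: hom_distribs)

lemma cyc_int: "cyc n m = of_int_poly (\<Prod>i<n. crit_iter (m + i))"
  by (simp add: cyc_def cit_def of_int_poly_prod)

lemma cyc_sum_int:
  assumes "n \<ge> 1" "m \<ge> 1" shows "cyc_sum n m q \<in> \<int>"
proof -
  have "cyc_sum n m q = root_sum (of_int_poly (mis_W m n)) (of_int_poly ((\<Prod>i<n. crit_iter (m + i)) ^ q))"
    by (simp add: cyc_sum_def critF_mis_W cyc_int hom_distribs)
  then show ?thesis using root_sum_int[OF monic_mis_W[OF assms]] by simp
qed

text \<open>The Frobenius congruence in the ring of algebraic integers: the inner binomial
  coefficients are divisible by \<open>p\<close>.\<close>

lemma psum_prime_cong:
  assumes "prime p" "\<And>z. z \<in># M \<Longrightarrow> algebraic_int z"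
  shows "\<exists>t. algebraic_int t \<and> psum M 1 ^ p - psum M p = of_nat p * t"
  using assms(2)
proof (induction M)
  case (add z M)
  let ?s = "psum M 1"
  obtain t where t: "algebraic_int t" "?s ^ p - psum M p = of_nat p * t" using add by auto
  have p: "p > 1" using assms(1) by (rule prime_gt_1_nat)
  define u where "u = (\<Sum>k\<in>{0<..<p}. of_nat ((p choose k) div p) * (z ^ k * ?s ^ (p - k)))"
  have s: "algebraic_int ?s"
    unfolding psum_def by (rule algebraic_int_sum_mset) (use add.prems in auto)
  have z: "algebraic_int z" using add.prems by auto
  have u: "algebraic_int u" unfolding u_def using s z by (intro algebraic_int_sum) blast
  have "(z + ?s) ^ p = (\<Sum>k\<in>{0..p}. of_nat (p choose k) * (z ^ k * ?s ^ (p - k)))"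
    by (simp add: binomial_ring mult.assoc atLeast0AtMost)
  also have "{0..p} = insert 0 (insert p {0<..<p})" using p by auto
  also have "(\<Sum>k\<in>\<dots>. of_nat (p choose k) * (z ^ k * ?s ^ (p - k)))
      = ?s ^ p + (z ^ p + (\<Sum>k\<in>{0<..<p}. of_nat (p choose k) * (z ^ k * ?s ^ (p - k))))"
    using p by simp
  also have "(\<Sum>k\<in>{0<..<p}. of_nat (p choose k) * (z ^ k * ?s ^ (p - k))) = of_nat p * u"
    unfolding u_def sum_distrib_left
  proof (rule sum.cong[OF refl])
    fix k assume "k \<in> {0<..<p}"
    then have "p dvd p choose k" using assms(1) by (intro dvd_choose_prime) auto
    then have "p choose k = p * ((p choose k) div p)" by simp
    then have "(of_nat (p choose k) :: complex) = of_nat p * of_nat ((p choose k) div p)"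
      by (metis of_nat_mult)
    then show "of_nat (p choose k) * (z ^ k * ?s ^ (p - k))
        = of_nat p * (of_nat ((p choose k) div p) * (z ^ k * ?s ^ (p - k)))"
      by (simp only: mult.assoc)
  qed
  finally have "psum (add_mset z M) 1 ^ p - psum (add_mset z M) p = of_nat p * (t + u)"
    using t(2) by (simp add: algebra_simps)
  then show ?case using t(1) u by blast
qed (use assms(1) prime_gt_0_nat in \<open>auto intro!: exI[of _ 0]\<close>)

text \<open>Fermat's congruence, obtained from the previous lemma for \<open>a\<close> copies of
  1.\<close>

lemma prime_power_cong:
  assumes "prime p" shows "int p dvd int a ^ p - int a"
proof -
  have "\<exists>t. algebraic_int t \<and> psum (replicate_mset a 1) 1 ^ p - psum (replicate_mset a 1) p = of_nat p * t"
    by (rule psum_prime_cong[OF assms]) (auto split: if_splits)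
  then obtain t where t: "algebraic_int t"
    "psum (replicate_mset a 1) 1 ^ p - psum (replicate_mset a 1) p = of_nat p * t" by blast
  have "psum (replicate_mset a 1) k = of_nat a" for k
    by (simp add: psum_def)
  then have "of_int (int a ^ p - int a) = (of_nat p * t :: complex)" using t(2) by simp
  then have "of_int (int a ^ p - int a) / of_int (int p) = t"
    using prime_gt_0_nat[OF assms] by (simp add: field_simps)
  then have "algebraic_int (of_int (int a ^ p - int a) / of_int (int p) :: complex)" using t(1) by metis
  then show ?thesis by (rule of_int_dvd_algebraic) (use prime_gt_0_nat[OF assms] in simp)
qed

text \<open>The first power sum of the fixed points is \<open>2 ^ (m - 2)\<close>. Its
  \<open>p\<close>-th power is congruent to \<open>s\<close> by Frobenius and to itself by
  Fermat.\<close>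

lemma cyc_sum_fixed_cong:
  assumes "prime p" "m \<ge> 3" "cyc_sum 1 m p = of_int s"
  shows "int p dvd s - 2 ^ (m - 2)"
proof -
  define N where "N = image_mset (poly (cyc 1 m)) (proots (critF 1 m))"
  have N: "psum N q = cyc_sum 1 m q" for q
    by (simp add: N_def cyc_sum_def root_sum_power)
  have nz: "critF 1 m \<noteq> 0" using monic_critF(1)[of 1 m] assms by auto
  have "algebraic_int z" if "z \<in># N" for z
    using that nz monic_mis_W[of 1 m] assms(2) unfolding N_def
    by (auto simp: critF_mis_W cyc_int intro!: algebraic_int_poly_of_int intro: algebraic_int_monic_root)
  from psum_prime_cong[OF assms(1) this] obtain t where t: "algebraic_int t"
    "psum N 1 ^ p - psum N p = of_nat p * t" by blast
  have "psum N 1 = of_int (2 ^ (m - 2))" using cyc_sum_value(2)[of 1 m] assms by (simp add: N)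
  then have "of_int ((2 ^ (m - 2)) ^ p - s) / of_int (int p) = t"
    using t(2) assms(3) prime_gt_0_nat[OF assms(1)] by (simp add: N field_simps)
  then have "algebraic_int (of_int ((2 ^ (m - 2)) ^ p - s) / of_int (int p) :: complex)" using t(1) by metis
  then have "int p dvd (2 ^ (m - 2)) ^ p - s"
    by (rule of_int_dvd_algebraic) (use prime_gt_0_nat[OF assms(1)] in simp)
  moreover have "int p dvd (2 ^ (m - 2)) ^ p - 2 ^ (m - 2)"
    using prime_power_cong[OF assms(1), of "2 ^ (m - 2)"] by simp
  ultimately have "int p dvd ((2 ^ (m - 2)) ^ p - 2 ^ (m - 2)) - ((2 ^ (m - 2)) ^ p - s)"
    by (rule dvd_diff[rotated])
  then show ?thesis by simp
qed

section \<open>Explicit values and an archimedean bound for sums over fixed points\<close>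

lemma root_sum_cubic:
  "root_sum P [:a, b, c, d:] = a * of_nat (degree P) + b * psum (proots P) 1
    + c * psum (proots P) 2 + d * psum (proots P) 3"
proof -
  have "(\<Sum>r\<in>#M. poly [:a, b, c, d:] r) = a * of_nat (size M) + b * psum M 1 + c * psum M 2 + d * psum M 3" for M
    by (induction M) (auto simp: algebra_simps power2_eq_square power3_eq_cube)
  from this[of "proots P"] show ?thesis by (simp only: root_sum_def size_proots_complex)
qed

lemma psum_newton_3:
  assumes "monic P" "e1 = coeff (reflect_poly P) 1" "e2 = coeff (reflect_poly P) 2" "e3 = coeff (reflect_poly P) 3"
  shows "psum (proots P) 1 = - e1" "psum (proots P) 2 = - 2 * e2 + e1 * e1"
    "psum (proots P) 3 = - 3 * e3 + e1 * e2 - e1 * (- 2 * e2 + e1 * e1)"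
proof -
  let ?M = "proots P"
  have e: "eps ?M = reflect_poly P" by (rule eps_proots_of_monic[OF assms(1)])
  have n1: "e1 = - psum ?M 1" using newton_eps[of 0 ?M] coeff_0_eps[of ?M] assms by (simp add: e)
  have n2: "2 * e2 = - (psum ?M 2 + e1 * psum ?M 1)"
    using newton_eps[of 1 ?M] coeff_0_eps[of ?M] assms unfolding e by (simp add: numeral_2_eq_2 add.commute)
  have n3: "3 * e3 = - (psum ?M 3 + e1 * psum ?M 2 + e2 * psum ?M 1)"
    using newton_eps[of 2 ?M] coeff_0_eps[of ?M] assms unfolding e
    by (simp add: numeral_2_eq_2 numeral_3_eq_3 algebra_simps)
  show 1: "psum ?M 1 = - e1" using n1 by simp
  have "psum ?M 2 = - (2 * e2) - e1 * psum ?M 1" by (simp only: n2) simp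
  then show 2: "psum ?M 2 = - 2 * e2 + e1 * e1" by (simp only: 1) simp
  have "psum ?M 3 = - (3 * e3) - e1 * psum ?M 2 - e2 * psum ?M 1" by (simp only: n3) simp
  then show "psum ?M 3 = - 3 * e3 + e1 * e2 - e1 * (- 2 * e2 + e1 * e1)"
    by (simp only: 1 2) (simp add: algebra_simps)
qed

lemma cit_small: "cit 1 = [:0, 1:]" "cit 2 = [:0, 1, 1:]" "cit 3 = [:0, 1, 1, 2, 1:]"
  by (simp_all add: cit_Suc numeral_2_eq_2 numeral_3_eq_3 power2_eq_square)

text \<open>Among the levels with \<open>m \<ge> 3\<close> and
  \<open>2 ^ (m - 2) \<le> p + 1\<close>, these four are the ones that the bound
  \<open>cyc_sum_fixed_bound\<close> does not reach.\<close>

lemma cyc_sum_fixed_small: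
  "cyc_sum 1 3 2 = 4" "cyc_sum 1 3 3 = 2" "cyc_sum 1 4 3 = 10" "cyc_sum 1 4 5 = 24"
proof -
  have r2: "psum (proots (cit 2)) 1 = -1"
    using psum_newton_3(1)[of "cit 2"] by (simp add: cit_small coeff_reflect_poly)
  have f2: "fix_pow0 2 + fix_pow0 2 + fix_pow1 2 = [:1, -2, 0, 0:]"
    by (simp add: eval_nat_numeral one_pCons)
  have "cyc_sum 1 3 2 = root_sum (cit 2) [:1, -2, 0, 0:]"
    using cyc_sum_fixed_points[of 2 2] unfolding f2 by simp
  also have "\<dots> = 4" unfolding root_sum_cubic r2 by (simp add: cit_small)
  finally show "cyc_sum 1 3 2 = 4" .
  have r3: "psum (proots (cit 3)) 1 = -2" "psum (proots (cit 3)) 2 = 2"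
    using psum_newton_3(1,2)[of "cit 3"] by (simp_all add: cit_small coeff_reflect_poly numeral_2_eq_2)
  have f3: "fix_pow0 3 + fix_pow0 3 + fix_pow1 3 = [:1, -3, 0, 0:]"
    by (simp add: eval_nat_numeral one_pCons)
  have "cyc_sum 1 4 3 = root_sum (cit 3) [:1, -3, 0, 0:]"
    using cyc_sum_fixed_points[of 3 3] unfolding f3 by simp
  also have "\<dots> = 10" unfolding root_sum_cubic r3 by (simp add: cit_small)
  finally show "cyc_sum 1 4 3 = 10" .
  have f5: "fix_pow0 5 + fix_pow0 5 + fix_pow1 5 = [:1, -5, 5, 0:]"
    by (simp add: eval_nat_numeral one_pCons)
  have "cyc_sum 1 4 5 = root_sum (cit 3) [:1, -5, 5, 0:]"
    using cyc_sum_fixed_points[of 3 5] unfolding f5 by simp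
  also have "\<dots> = 24" unfolding root_sum_cubic r3 by (simp add: cit_small)
  finally show "cyc_sum 1 4 5 = 24" .
  \<comment> \<open>For \<open>q = 3\<close> at level 3 the condition
    \<open>q + 2 \<le> 2 ^ 2\<close> of \<open>cyc_sum_fixed_points\<close> fails, so the sum is
    computed directly over the roots of \<open>critF 1 3\<close>.\<close>
  define F where "F = critF 1 3"
  have F: "F = [:0, 2, 2, 2, 1:]" by (simp add: F_def critF_def cit_small)
  have rF: "psum (proots F) 1 = -2" "psum (proots F) 3 = -2"
    using psum_newton_3(1,3)[of F] by (simp_all add: F coeff_reflect_poly numeral_2_eq_2 numeral_3_eq_3)
  have "cyc_sum 1 3 3 = - root_sum F (cit 2 ^ 3)"
    using cyc_sum_Suc[of 1 2 3] by (simp add: F_def cyc_def numeral_3_eq_3)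
  also have "root_sum F (cit 2 ^ 3) = root_sum F [:0, 2, 0, -1:]"
  proof (rule root_sum_cong)
    fix r assume "poly F r = 0"
    then have h0: "r * (r ^ 3 + 2 * r\<^sup>2 + 2 * r + 2) = 0" by (simp add: F power2_eq_square power3_eq_cube algebra_simps)
    have "(r + r\<^sup>2) ^ 3 - (2 * r - r ^ 3) = (r * (r ^ 3 + 2 * r\<^sup>2 + 2 * r + 2)) * (r\<^sup>2 + r - 1)"
      by (simp add: power2_eq_square power3_eq_cube algebra_simps)
    then have "(r + r\<^sup>2) ^ 3 - (2 * r - r ^ 3) = 0" by (simp only: h0 mult_zero_left)
    then have "(r + r\<^sup>2) ^ 3 = 2 * r - r ^ 3" by simp
    then show "poly (cit 2 ^ 3) r = poly [:0, 2, 0, -1:] r"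
      by (simp add: cit_small power2_eq_square power3_eq_cube algebra_simps)
  qed (simp add: F)
  also have "\<dots> = -2" unfolding root_sum_cubic rF by simp
  finally show "cyc_sum 1 3 3 = 2" by simp
qed

text \<open>The orbit of 0 ends in a fixed point. Outside the disc of radius 2 and of radius
  \<open>norm c\<close>, the map strictly increases the norm, which rules out a large parameter as
  well as a large fixed point.\<close>

lemma fixed_point_bound:
  assumes "m \<ge> 1" "poly (critF 1 m) c = 0"
  defines "x \<equiv> poly (cit m) c"
  shows "x = x\<^sup>2 + c" "norm c \<le> 2" "norm x \<le> 2"
proof -
  define a where "a = (\<lambda>k. poly (cit k) c)"
  have aS: "a (Suc k) = (a k)\<^sup>2 + c" for k by (simp add: a_def cit_Suc)
  obtain m' where m': "m = Suc m'" using assms(1) by (cases m) auto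
  have "a m = - a m'" using assms(2) by (simp add: critF_def a_def m' eq_neg_iff_add_eq_0)
  then have "(a m)\<^sup>2 = (a m')\<^sup>2" by simp
  then have fixed: "a (Suc m) = a m" using aS[of m'] aS[of m] by (simp add: m')
  then show x: "x = x\<^sup>2 + c" using aS[of m] by (simp add: x_def a_def)
  have esc: "norm (z\<^sup>2 + c) > norm z" if "norm z > 2" "norm z \<ge> norm c" for z
  proof -
    have "norm (z\<^sup>2 + c) \<ge> norm z ^ 2 - norm c"
      using norm_diff_ineq[of "z\<^sup>2" c] by (simp add: norm_power)
    moreover have "norm z ^ 2 > 2 * norm z" 
    proof -
      have "0 < norm z" using that(1) by linarith
      then show ?thesis
        using mult_strict_right_mono[of 2 "norm z" "norm z"] that(1) by (simp add: power2_eq_square)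
    qed
    ultimately show ?thesis using that(2) by linarith
  qed
  show c: "norm c \<le> 2"
  proof (rule ccontr)
    assume c: "\<not> norm c \<le> 2"
    have "norm (a k) \<ge> norm c" if "k \<ge> 1" for k
      using that
    proof (induction k rule: dec_induct)
      case base
      then show ?case by (simp add: a_def cit_small[unfolded One_nat_def])
    next
      case (step k)
      then show ?case using esc[of "a k"] c aS[of k] by simp
    qed
    then have "norm (a m) \<ge> norm c" using assms(1) by blast
    then show False using esc[of "a m"] c fixed aS[of m] by simp
  qed
  show "norm x \<le> 2"
    using esc[of x] c x by (metis linorder_not_less order_less_imp_le order_trans less_irrefl)
qed

text \<open>As a function of \<open>t\<^sup>2\<close> the power \<open>t ^ p\<close> is convex for
  \<open>p \<ge> 2\<close>, and a third of the right-hand side is its chord over the interval from 1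
  to 4.\<close>

lemma power_chord:
  fixes t :: real assumes "1 \<le> t" "t \<le> 2" "p \<ge> 2"
  shows "3 * t ^ p \<le> (4 - t\<^sup>2) + (t\<^sup>2 - 1) * 2 ^ p"
  using assms(3)
proof (induction p rule: dec_induct)
  case (step p)
  have p: "(2 :: real) ^ p \<ge> 4" using power_increasing[of 2 p "2 :: real"] step by simp
  have "3 * t ^ Suc p = t * (3 * t ^ p)" by simp
  also have "\<dots> \<le> t * ((4 - t\<^sup>2) + (t\<^sup>2 - 1) * 2 ^ p)"
    using step assms by (intro mult_left_mono) auto
  also have "\<dots> = (4 - t\<^sup>2) + (t\<^sup>2 - 1) * 2 ^ Suc p - (2 - t) * (t - 1) * ((t + 1) * 2 ^ p - (2 + t))"
    by (simp add: power2_eq_square algebra_simps)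
  also have "\<dots> \<le> (4 - t\<^sup>2) + (t\<^sup>2 - 1) * 2 ^ Suc p"
  proof -
    have "(t + 1) * 2 ^ p \<ge> (t + 1) * 4" using p assms by (intro mult_left_mono) auto
    moreover have "2 + t \<le> (t + 1) * 4" using assms by simp
    ultimately have "(t + 1) * 2 ^ p - (2 + t) \<ge> 0" by (simp only: diff_ge_0_iff_ge)
    then have "(2 - t) * (t - 1) * ((t + 1) * 2 ^ p - (2 + t)) \<ge> 0" using assms by simp
    then show ?thesis by linarith
  qed
  finally show ?case .
qed (simp add: power2_eq_square)

text \<open>From \<open>c = x * (1 - x)\<close> and \<open>norm c \<le> 2\<close> it follows that
  \<open>Re x \<ge> norm x ^ 2 - 2\<close> when \<open>norm x \<ge> 1\<close>. The chord then gives
  a bound linear in \<open>Re x\<close>, which can be summed because the sum of the fixed points is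
  known.\<close>

lemma fixed_point_power_bound:
  fixes x c :: complex
  assumes "x = x\<^sup>2 + c" "norm c \<le> 2" "norm x \<le> 2" "p \<ge> 2"
  shows "3 * norm (x ^ p) \<le> 2 ^ p * (1 + Re x) + 3"
proof (cases "norm x \<le> 1")
  case True
  then have "norm x ^ p \<le> 1" by (simp add: power_le_one)
  moreover have "Re x \<ge> -1" using True abs_Re_le_cmod[of x] by linarith
  then have "2 ^ p * (1 + Re x) \<ge> 0" by simp
  ultimately show ?thesis unfolding norm_power by linarith
next
  case False
  define t u where "t = norm x" and "u = Re x"
  have t: "1 \<le> t" "t \<le> 2" using False assms by (auto simp: t_def)
  have "c = x * (1 - x)" using assms(1) by (simp add: algebra_simps power2_eq_square)
  then have "norm c = t * norm (1 - x)" by (simp add: norm_mult t_def)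
  then have "(t * norm (1 - x))\<^sup>2 \<le> 2\<^sup>2" using assms(2) by (intro power_mono) (auto simp: t_def)
  moreover have "(norm (1 - x))\<^sup>2 = 1 - 2 * u + t\<^sup>2"
    unfolding t_def u_def cmod_power2 by (simp add: power2_eq_square algebra_simps)
  ultimately have "t\<^sup>2 * (1 - 2 * u + t\<^sup>2) \<le> 4" by (simp add: power_mult_distrib)
  then have h: "2 * t\<^sup>2 * u \<ge> t\<^sup>2 + t\<^sup>2 * t\<^sup>2 - 4" by (simp add: algebra_simps)
  have t2: "1 \<le> t\<^sup>2" "t\<^sup>2 \<le> 4" using t power_mono[of t 2 2] by (auto simp: one_le_power)
  have "(t\<^sup>2 - 1) * (4 - t\<^sup>2) \<ge> 0" using t2 by (intro mult_nonneg_nonneg) auto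
  then have "2 * t\<^sup>2 * (t\<^sup>2 - 2) \<le> 2 * t\<^sup>2 * u" using h by (simp add: algebra_simps)
  then have "t\<^sup>2 - 2 \<le> u" using t2 t by (simp add: mult_le_cancel_left)
  then have "(t\<^sup>2 - 1) * 2 ^ p \<le> (1 + u) * 2 ^ p" by (intro mult_right_mono) auto
  moreover have "3 * t ^ p \<le> (4 - t\<^sup>2) + (t\<^sup>2 - 1) * 2 ^ p" by (rule power_chord[OF t assms(4)])
  ultimately have "3 * t ^ p \<le> (4 - t\<^sup>2) + (1 + u) * 2 ^ p" by linarith
  then have "3 * t ^ p \<le> 3 + 2 ^ p * (1 + u)" using t2 by (simp add: mult.commute)
  then show ?thesis by (simp add: norm_power t_def u_def)
qed

theorem cyc_sum_fixed_bound:
  assumes "m \<ge> 3" "p \<ge> 2" "9 * 2 ^ (m - 2) < 2 ^ p + (3 :: int)"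
  shows "norm (cyc_sum 1 m p) < 2 ^ (m - 2) * (2 ^ p - 1)"
proof -
  define R where "R = proots (critF 1 m)"
  define x where "x = poly (cyc 1 m)"
  have xc: "x c = poly (cit m) c" for c by (simp add: x_def cyc_def)
  have nz: "critF 1 m \<noteq> 0" using monic_critF(1)[of 1 m] assms by auto
  have dR: "size R = 2 ^ (m - 1)"
    using monic_critF(2)[of 1 m] assms unfolding R_def size_proots_complex by simp
  have c0: "poly (cit k) 0 = 0" for k by (induction k) (auto simp: cit_Suc)
  then have "0 \<in># R" using nz by (simp add: R_def critF_def)
  \<comment> \<open>The parameter 0 contributes nothing and is left out. Counting it would add
    \<open>2 ^ p + 3\<close> to the estimate for three times the norm; without it, the hypothesis on
    \<open>9 * 2 ^ (m - 2)\<close> is what makes the final inequality strict.\<close>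
  then obtain N where N: "R = add_mset 0 N" by (metis insert_DiffM)
  have x0: "x 0 = 0" by (simp add: xc c0)
  have sumq: "cyc_sum 1 m q = (\<Sum>c\<in>#N. x c ^ q)" if "q \<ge> 1" for q
    unfolding cyc_sum_def root_sum_def R_def[symmetric] poly_power x_def[symmetric] N
    using that x0 by simp
  have bd: "3 * norm (x c ^ p) \<le> 2 ^ p * (1 + Re (x c)) + 3" if "c \<in># N" for c
  proof -
    have "c \<in># R" using that by (simp add: N)
    then have "poly (critF 1 m) c = 0" using nz by (simp add: R_def)
    from fixed_point_bound[OF _ this] show ?thesis
      using assms by (intro fixed_point_power_bound[where c = c]) (auto simp: xc)
  qed
  have "3 * norm (\<Sum>c\<in>#K. x c ^ p) \<le> 2 ^ p * (of_nat (size K) + Re (\<Sum>c\<in>#K. x c)) + 3 * of_nat (size K)"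
    if "\<And>c. c \<in># K \<Longrightarrow> 3 * norm (x c ^ p) \<le> 2 ^ p * (1 + Re (x c)) + 3" for K
    using that
  proof (induction K)
    case (add c K)
    have "3 * norm (\<Sum>c\<in>#add_mset c K. x c ^ p) \<le> 3 * norm (x c ^ p) + 3 * norm (\<Sum>c\<in>#K. x c ^ p)"
      using norm_triangle_ineq[of "x c ^ p" "\<Sum>c\<in>#K. x c ^ p"] by simp
    moreover have "3 * norm (\<Sum>c\<in>#K. x c ^ p) \<le> 2 ^ p * (of_nat (size K) + Re (\<Sum>c\<in>#K. x c)) + 3 * of_nat (size K)"
      using add by auto
    moreover have "3 * norm (x c ^ p) \<le> 2 ^ p * (1 + Re (x c)) + 3" using add.prems by auto
    ultimately show ?case by (simp add: algebra_simps)
  qed simp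
  from this[OF bd] have "3 * norm (cyc_sum 1 m p)
      \<le> 2 ^ p * (of_nat (size N) + Re (cyc_sum 1 m 1)) + 3 * of_nat (size N)"
    using sumq[of p] sumq[of 1] assms by simp
  moreover have "real (size N) = 2 * 2 ^ (m - 2) - 1"
  proof -
    have "m - 1 = Suc (m - 2)" using assms(1) by simp
    then have "2 ^ (m - 1) = (2 * 2 ^ (m - 2) :: nat)" by (simp only: power_Suc)
    then have "size N + 1 = 2 * 2 ^ (m - 2)" using dR N by simp
    then have "real (size N + 1) = real (2 * 2 ^ (m - 2))" by (rule arg_cong)
    then show ?thesis by simp
  qed
  moreover have "Re (cyc_sum 1 m 1) = 2 ^ (m - 2)"
    using cyc_sum_value(2)[of 1 m] assms by simp
  moreover have "real_of_int (9 * 2 ^ (m - 2)) < real_of_int (2 ^ p + 3)"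
    using assms(3) by (simp only: of_int_less_iff)
  ultimately show ?thesis by (simp add: algebra_simps)
qed

section \<open>The recursion modulo powers of 2\<close>

text \<open>The error \<open>2 ^ B * D\<close> enters the square doubled or squared, so one binary
  digit of precision is gained; the hypothesis on \<open>s * s\<close> disposes of the quadratic
  term.\<close>

lemma const_dvd_square:
  fixes y :: "int poly"
  assumes "[:2 ^ B:] dvd y - [:1, - s:]" "B \<ge> 1" "2 ^ Suc B dvd s * s"
  shows "[:2 ^ Suc B:] dvd y * y - [:1, - (2 * s):]"
proof -
  obtain D where D: "y - [:1, - s:] = [:2 ^ B:] * D" using assms(1) by (elim dvdE)
  obtain t where t: "s * s = 2 ^ Suc B * t" using assms(3) by (elim dvdE)
  obtain C where C: "B = Suc C" using assms(2) by (cases B) auto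
  have y: "y = [:1, - s:] + [:2 ^ B:] * D" using D by (simp add: algebra_simps)
  have k: "[:2 ^ Suc B:] = [:2 ^ B:] + [:2 ^ B :: int:]" "[:2 ^ B:] * [:2 ^ B:] = [:2 ^ Suc B:] * [:2 ^ C :: int:]"
    by (simp_all add: C)
  have sq: "[:1, - s:] * [:1, - s:] = [:1, - (2 * s):] + [:2 ^ Suc B:] * [:0, 0, t:]"
    using t by simp
  have "y * y - [:1, - (2 * s):] = [:1, - s:] * [:1, - s:] - [:1, - (2 * s):]
      + ([:2 ^ B:] + [:2 ^ B:]) * ([:1, - s:] * D) + ([:2 ^ B:] * [:2 ^ B:]) * (D * D)"
    unfolding y by (simp only: ring_distribs mult_ac add_ac diff_conv_add_uminus)
  also have "\<dots> = [:2 ^ Suc B:] * ([:0, 0, t:] + [:1, - s:] * D + [:2 ^ C:] * (D * D))"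
    unfolding sq k(2) k(1)[symmetric] by (simp only: ring_distribs mult_ac add_ac add_diff_cancel_left')
  finally show ?thesis by (rule dvdI)
qed

lemma const_dvd_trans_le:
  "[:2 ^ A:] dvd (f :: int poly) \<Longrightarrow> B \<le> A \<Longrightarrow> [:2 ^ B:] dvd f"
  by (meson const_poly_dvd_const_poly_iff dvd_trans le_imp_power_dvd)

lemma dvd_diff_trans: "(d :: 'a :: comm_ring_1) dvd x - y \<Longrightarrow> d dvd y - z \<Longrightarrow> d dvd x - z"
  using dvd_add[of d "x - y" "y - z"] by simp

lemma dvd_diff_mult_right: "(d :: 'a :: comm_ring_1) dvd x - y \<Longrightarrow> d dvd z * x - z * y"
  by (metis dvd_mult right_diff_distrib)

text \<open>Here \<open>Y m\<close> is the polynomial \<open>\<Prod>(1 - h X)\<close> over the cycle products \<open>h\<close>, and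
  \<open>y m\<close> is the same for the multipliers \<open>2\<^sup>p h\<close>.\<close>

locale two_adic =
  fixes p :: nat and Y :: "nat \<Rightarrow> int poly"
  assumes p2: "p \<ge> 2"
    and Y0: "\<And>m. m \<ge> 2 \<Longrightarrow> coeff (Y m) 0 = 1"
    and Yeven: "\<And>m j. m \<ge> 2 \<Longrightarrow> j \<ge> 1 \<Longrightarrow> even (coeff (Y m) j)"
    and Yrec: "\<And>m j. m \<ge> 2 \<Longrightarrow> p * j + 2 \<le> 2 ^ m \<Longrightarrow>
      coeff (Y (Suc m)) j = coeff (\<Prod>i=2..m. Y i) j"
begin

definition y :: "nat \<Rightarrow> int poly" where "y m = pcompose (Y m) [:0, 2 ^ p:]"

definition tau :: "nat \<Rightarrow> int" where "tau m = - coeff (Y m) 1"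

lemma coeff_y: "coeff (y m) j = 2 ^ (p * j) * coeff (Y m) j"
  by (simp add: y_def coeff_pcompose_linear power_mult)

lemma prod_Y:
  "coeff (\<Prod>i=2..m. Y i) 0 = 1" "j \<ge> 1 \<Longrightarrow> even (coeff (\<Prod>i=2..m. Y i) j)"
  "coeff (\<Prod>i=2..m. Y i) 1 = - (\<Sum>i=2..m. tau i)"
proof -
  have *: "coeff (\<Prod>i\<in>A. Y i) 0 = 1 \<and> (\<forall>j\<ge>1. even (coeff (\<Prod>i\<in>A. Y i) j)) \<and>
      coeff (\<Prod>i\<in>A. Y i) 1 = - (\<Sum>i\<in>A. tau i)" if "finite A" "\<And>i. i \<in> A \<Longrightarrow> i \<ge> 2" for A
    using that
  proof (induction A rule: finite_induct)
    case (insert x A)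
    let ?R = "\<Prod>i\<in>A. Y i"
    have R: "coeff ?R 0 = 1" "\<And>j. j \<ge> 1 \<Longrightarrow> even (coeff ?R j)" "coeff ?R 1 = - (\<Sum>i\<in>A. tau i)"
      using insert by auto
    have x: "coeff (Y x) 0 = 1" "\<And>j. j \<ge> 1 \<Longrightarrow> even (coeff (Y x) j)" using insert Y0 Yeven by auto
    have ev: "even (coeff (Y x * ?R) j)" if j: "j \<ge> 1" for j
      unfolding coeff_mult
    proof (rule dvd_sum)
      fix i assume "i \<in> {..j}"
      show "even (coeff (Y x) i * coeff ?R (j - i))"
        using x(2)[of i] R(2)[of "j - i"] j by (cases "i = 0") auto
    qed
    have c1: "coeff (Y x * ?R) 1 = coeff (Y x) 0 * coeff ?R 1 + coeff (Y x) 1 * coeff ?R 0"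
      by (simp add: coeff_mult)
    have cc: "coeff (Y x * ?R) 1 = - (\<Sum>i\<in>insert x A. tau i)"
      unfolding c1 x(1) R(1) R(3) using insert.hyps by (simp add: tau_def)
    have c0: "coeff (Y x * ?R) 0 = 1" using x(1) R(1) by (simp add: coeff_mult_0)
    have pe: "(\<Prod>i\<in>insert x A. Y i) = Y x * ?R" using insert.hyps by simp
    show ?case unfolding pe by (intro conjI allI impI c0 ev cc)
  qed (simp add: coeff_1)
  have P: "coeff (\<Prod>i=2..m. Y i) 0 = 1 \<and> (\<forall>j\<ge>1. even (coeff (\<Prod>i=2..m. Y i) j)) \<and>
      coeff (\<Prod>i=2..m. Y i) 1 = - (\<Sum>i=2..m. tau i)"
    by (rule *) auto
  show "coeff (\<Prod>i=2..m. Y i) 0 = 1" by (rule conjunct1[OF P])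
  show "coeff (\<Prod>i=2..m. Y i) 1 = - (\<Sum>i=2..m. tau i)" by (rule conjunct2[OF conjunct2[OF P]])
  show "even (coeff (\<Prod>i=2..m. Y i) j)" if "j \<ge> 1"
    using conjunct1[OF conjunct2[OF P]] that by blast
qed

lemma even_tau: "m \<ge> 2 \<Longrightarrow> even (tau m)"
  using Yeven[of m 1] by (simp add: tau_def)

lemma prod_y: "(\<Prod>i=2..m. y i) = pcompose (\<Prod>i=2..m. Y i) [:0, 2 ^ p:]"
  by (simp add: y_def pcompose_prod)

text \<open>The recursion one level lower shows that the traces of the levels below \<open>m\<close>
  already add up to \<open>tau m\<close>.\<close>

lemma tau_doubling:
  assumes "m \<ge> 3" "p + 2 \<le> 2 ^ (m - 1)"
  shows "tau (Suc m) = 2 * tau m"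
proof -
  obtain k where k: "m = Suc k" "k \<ge> 2" using assms(1) by (cases m) auto
  have e1: "coeff (Y (Suc m)) 1 = - (\<Sum>i=2..m. tau i)"
    unfolding prod_Y(3)[symmetric]
  proof (rule Yrec)
    have "(2 :: nat) ^ (m - 1) \<le> 2 ^ m" by (rule power_increasing) auto
    then show "p * 1 + 2 \<le> 2 ^ m" using assms(2) by linarith
  qed (use assms in simp)
  have e2: "coeff (Y (Suc k)) 1 = - (\<Sum>i=2..k. tau i)"
    unfolding prod_Y(3)[symmetric] using assms k by (intro Yrec) auto
  have "tau (Suc m) = (\<Sum>i=2..m. tau i)" unfolding tau_def[of "Suc m"] e1 by simp
  also have "\<dots> = (\<Sum>i=2..k. tau i) + tau m" using k by simp
  also have "(\<Sum>i=2..k. tau i) = tau m" unfolding k(1) tau_def[of "Suc k"] e2 by simp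
  finally show ?thesis by simp
qed

text \<open>The substitution of \<open>2 ^ p * X\<close> puts \<open>2 ^ (2 * p)\<close> into every
  coefficient from degree 2 on, and evenness of the coefficients of \<open>Y\<close> supplies one
  more factor 2.\<close>

lemma y_linear: "m \<ge> 2 \<Longrightarrow> [:2 ^ (2 * p + 1):] dvd y m - [:1, - (2 ^ p * tau m):]"
  unfolding const_poly_dvd_iff
proof
  fix j :: nat assume m: "m \<ge> 2"
  consider "j = 0" | "j = 1" | "j \<ge> 2" by linarith
  then show "2 ^ (2 * p + 1) dvd coeff (y m - [:1, - (2 ^ p * tau m):]) j"
  proof cases
    case 3
    then have "coeff [:1, - (2 ^ p * tau m):] j = 0" by (auto simp: coeff_pCons split: nat.splits)
    moreover have "(2 :: int) ^ (2 * p) dvd 2 ^ (p * j)" using 3 by (intro le_imp_power_dvd) simp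
    then have "(2 :: int) ^ (2 * p) * 2 dvd 2 ^ (p * j) * coeff (Y m) j"
      using Yeven[OF m, of j] 3 by (intro mult_dvd_mono) auto
    ultimately show ?thesis by (simp add: coeff_y mult.commute)
  qed (use m Y0 in \<open>simp_all add: coeff_y tau_def\<close>)
qed

text \<open>In degrees below \<open>J\<close> the recursion is exact; from \<open>J\<close> on both
  sides are divisible by \<open>2 ^ (p * J)\<close> times 2.\<close>

lemma y_rec_general:
  assumes "m \<ge> 2" and J: "\<And>j. j < J \<Longrightarrow> p * j + 2 \<le> 2 ^ m" and "J \<ge> 1" "B \<le> p * J + 1"
  shows "[:2 ^ B:] dvd y (Suc m) - (\<Prod>i=2..m. y i)"
  unfolding const_poly_dvd_iff
proof
  fix j
  have c: "coeff (y (Suc m) - (\<Prod>i=2..m. y i)) j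
      = 2 ^ (p * j) * (coeff (Y (Suc m)) j - coeff (\<Prod>i=2..m. Y i) j)"
    unfolding prod_y coeff_diff coeff_y coeff_pcompose_linear power_mult right_diff_distrib ..
  show "2 ^ B dvd coeff (y (Suc m) - (\<Prod>i=2..m. y i)) j"
  proof (cases "j < J")
    case True
    then show ?thesis unfolding c using Yrec[OF assms(1) J] by simp
  next
    case False
    then have "p * J \<le> p * j" by simp
    then have "(2 :: int) ^ (p * J) * 2 dvd 2 ^ (p * j) * (coeff (Y (Suc m)) j - coeff (\<Prod>i=2..m. Y i) j)"
      using Yeven[of "Suc m" j] prod_Y(2)[of j m] False assms
      by (intro mult_dvd_mono le_imp_power_dvd) auto
    moreover have "(2 :: int) ^ B dvd 2 ^ (p * J) * 2"
      using assms(4) le_imp_power_dvd[of B "p * J + 1" "2 :: int"] by (simp add: mult.commute)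
    ultimately show ?thesis unfolding c by (rule dvd_trans[rotated])
  qed
qed

lemma y_rec:
  assumes "m \<ge> 2"
  shows "[:2 ^ (2 ^ m):] dvd y (Suc m) - (\<Prod>i=2..m. y i)"
proof -
  \<comment> \<open>The first degree at which \<open>p * j + 2 \<le> 2 ^ m\<close> fails.\<close>
  define J :: nat where "J = (2 ^ m - 2) div p + 1"
  have p0: "p > 0" using p2 by simp
  have m4: "(4 :: nat) \<le> 2 ^ m" using assms power_increasing[of 2 m "2 :: nat"] by simp
  have J2: "p * j + 2 \<le> 2 ^ m" if "j < J" for j
  proof -
    have "j \<le> (2 ^ m - 2) div p" using that by (simp add: J_def)
    then have "j * p \<le> 2 ^ m - 2" using p0 by (simp add: less_eq_div_iff_mult_less_eq)
    then show ?thesis using m4 by (simp add: mult.commute)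
  qed
  have "2 ^ m - 2 < p * J"
    using p0 unfolding J_def by (metis Suc_eq_plus1 dividend_less_times_div mult_Suc_right add.commute)
  then have J1: "2 ^ m \<le> p * J + 1" using m4 by linarith
  show ?thesis
    by (rule y_rec_general[OF assms J2 _ J1]) (simp_all add: J_def)
qed

text \<open>In the product over the levels up to \<open>m\<close>, the part below \<open>m\<close>
  is itself congruent to \<open>y m\<close> by the recursion one level lower.\<close>

lemma y_square:
  assumes "m \<ge> 3" "B \<le> 2 ^ (m - 1)" "[:2 ^ B:] dvd y m - (\<Prod>i=2..m-1. y i)"
  shows "[:2 ^ B:] dvd y (Suc m) - y m * y m"
proof -
  obtain k where k: "m = Suc k" using assms(1) by (cases m) auto
  have A: "[:2 ^ B:] dvd y (Suc m) - (\<Prod>i=2..m. y i)"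
    by (rule const_dvd_trans_le[OF y_rec]) (use assms k in auto)
  have B: "(\<Prod>i=2..m. y i) = y m * (\<Prod>i=2..m-1. y i)"
    using k assms(1) by (simp add: mult.commute)
  have C: "[:2 ^ B:] dvd y m * (\<Prod>i=2..m-1. y i) - y m * y m"
    by (rule dvd_diff_mult_right) (use assms(3) in \<open>metis dvd_minus_iff minus_diff_eq\<close>)
  show ?thesis by (rule dvd_diff_trans[OF A[unfolded B] C])
qed

section \<open>Levels from which the recursion is a squaring\<close>

context
  fixes m1 :: nat
  assumes m1: "m1 \<ge> 3" "p + 2 \<le> 2 ^ (m1 - 1)"
begin

lemma tau_iterate: "tau (m1 + k) = 2 ^ k * tau m1"
proof (induction k)
  case (Suc k)
  have "(2 :: nat) ^ (m1 - 1) \<le> 2 ^ (m1 + k - 1)" by (intro power_increasing) auto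
  then have "p + 2 \<le> 2 ^ (m1 + k - 1)" using m1 by (metis le_trans)
  then have "tau (Suc (m1 + k)) = 2 * tau (m1 + k)" using m1(1) by (intro tau_doubling) simp_all
  then show ?case using Suc by simp
qed simp

lemma pow_large: "2 * p + 3 + k \<le> 2 ^ (m1 + k)"
proof (induction k)
  case 0
  have "(2 :: nat) ^ m1 = 2 * 2 ^ (m1 - 1)" using m1 by (cases m1) auto
  then show ?case using m1 by simp
qed simp

lemma y_step:
  assumes "[:2 ^ B:] dvd y (m1 + k) - [:1, - (2 ^ p * tau (m1 + k)):]"
    and "[:2 ^ Suc B:] dvd y (Suc (m1 + k)) - y (m1 + k) * y (m1 + k)" and "B \<le> 2 * p + 1 + k" "B \<ge> 1"
  shows "[:2 ^ Suc B:] dvd y (Suc (m1 + k)) - [:1, - (2 ^ p * tau (Suc (m1 + k))):]"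
proof -
  define s where "s = 2 ^ p * tau (m1 + k)"
  obtain t where t: "tau m1 = 2 * t" using even_tau[of m1] m1 by auto
  have "s = 2 ^ (p + k + 1) * t" unfolding s_def tau_iterate t by (simp add: power_add)
  then have "s * s = 2 ^ (p + k + 1 + (p + k + 1)) * (t * t)" by (simp add: power_add)
  moreover have "(2 :: int) ^ Suc B dvd 2 ^ (p + k + 1 + (p + k + 1))"
    using assms(3) by (intro le_imp_power_dvd) simp
  ultimately have "2 ^ Suc B dvd s * s" by (metis dvd_mult2)
  then have "[:2 ^ Suc B:] dvd y (m1 + k) * y (m1 + k) - [:1, - (2 * s):]"
    using assms(1,4) by (intro const_dvd_square) (simp_all add: s_def)
  have "tau (Suc (m1 + k)) = 2 ^ Suc k * tau m1" using tau_iterate[of "Suc k"] by (simp only: add_Suc_right)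
  then have "2 ^ p * tau (Suc (m1 + k)) = 2 * s"
    unfolding s_def tau_iterate[of k] by simp
  then show ?thesis
    using dvd_diff_trans[OF assms(2) \<open>[:2 ^ Suc B:] dvd y (m1 + k) * y (m1 + k) - [:1, - (2 * s):]\<close>] by (simp only:)
qed

lemma y_square_large:
  assumes "k \<ge> 1" "B \<le> 2 * p + 2 + k"
  shows "[:2 ^ B:] dvd y (Suc (m1 + k)) - y (m1 + k) * y (m1 + k)"
proof (rule y_square)
  obtain l where l: "k = Suc l" using assms(1) by (cases k) auto
  show B: "B \<le> 2 ^ (m1 + k - 1)" using pow_large[of l] assms l by simp
  have "[:2 ^ (2 ^ (m1 + l)):] dvd y (Suc (m1 + l)) - (\<Prod>i=2..m1+l. y i)"
    by (rule y_rec) (use m1 in simp)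
  from const_dvd_trans_le[OF this, of B] show "[:2 ^ B:] dvd y (m1 + k) - (\<Prod>i=2..m1 + k - 1. y i)"
    using B l by simp
qed (use m1 in simp)

text \<open>The induction starts at \<open>m1 + 1\<close>. A squaring step at \<open>m1\<close>
  would rest on the recursion one level below, which is guaranteed only modulo
  \<open>2 ^ (p + 2)\<close> there. The late start costs one digit.\<close>

lemma y_linear_weak: "[:2 ^ (2 * p + 1 + k):] dvd y (m1 + 1 + k) - [:1, - (2 ^ p * tau (m1 + 1 + k)):]"
proof (induction k)
  case 0
  show ?case using y_linear[of "m1 + 1"] m1 by simp
next
  case (Suc k)
  have "[:2 ^ Suc (2 * p + 1 + k):] dvd y (Suc (m1 + Suc k)) - [:1, - (2 ^ p * tau (Suc (m1 + Suc k))):]"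
  proof (rule y_step)
    show "[:2 ^ Suc (2 * p + 1 + k):] dvd y (Suc (m1 + Suc k)) - y (m1 + Suc k) * y (m1 + Suc k)"
      by (rule y_square_large) auto
  qed (use Suc in auto)
  then show ?case by simp
qed

text \<open>With \<open>2 * p + 2 \<le> 2 ^ (m1 - 1)\<close> the recursion leading to level
  \<open>m1\<close> is exact in degrees 0, 1 and 2, so the squaring is precise enough from
  \<open>m1\<close> itself.\<close>

lemma y_linear_strong:
  assumes "2 * p + 2 \<le> 2 ^ (m1 - 1)"
  shows "[:2 ^ (2 * p + 1 + k):] dvd y (m1 + k) - [:1, - (2 ^ p * tau (m1 + k)):]"
proof (induction k)
  case 0
  show ?case using y_linear[of m1] m1 by simp
next
  case (Suc k)
  have sq: "[:2 ^ Suc (2 * p + 1 + k):] dvd y (Suc (m1 + k)) - y (m1 + k) * y (m1 + k)"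
  proof (cases "k = 0")
    case True
    have "[:2 ^ Suc (2 * p + 1):] dvd y (Suc m1) - y m1 * y m1"
    proof (rule y_square)
      obtain l where l: "m1 = Suc l" "l \<ge> 2" using m1 by (cases m1) auto
      have lt: "p * j + 2 \<le> 2 ^ l" if "j < 3" for j
      proof -
        have "p * j \<le> p * 2" using that by simp
        moreover have "2 * p + 2 \<le> 2 ^ l" using assms l by simp
        ultimately show ?thesis by linarith
      qed
      show "[:2 ^ Suc (2 * p + 1):] dvd y m1 - (\<Prod>i=2..m1 - 1. y i)"
        using y_rec_general[OF l(2) lt, where J = 3 and B = "Suc (2 * p + 1)"] p2 l by simp
    qed (use m1 assms in auto)
    then show ?thesis using True by simp
  next
    case False
    then show ?thesis by (intro y_square_large) simp_all
  qed
  have "[:2 ^ Suc (2 * p + 1 + k):] dvd y (Suc (m1 + k)) - [:1, - (2 ^ p * tau (Suc (m1 + k))):]"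
    by (rule y_step[OF Suc.IH sq]) auto
  then show ?case by simp
qed

end

end

section \<open>Norms from cyclotomic fields\<close>

lemma algebraic_unitI: "algebraic_int x \<Longrightarrow> algebraic_int y \<Longrightarrow> x * y = 1 \<Longrightarrow> algebraic_unit x"
  unfolding algebraic_unit_def by blast

lemma algebraic_unit_int: "algebraic_unit x \<Longrightarrow> algebraic_int x"
  by (simp add: algebraic_unit_def)

lemma algebraic_unit_nonzero: "algebraic_unit x \<Longrightarrow> x \<noteq> 0"
  by (auto simp: algebraic_unit_def)

lemma algebraic_unit_mult: "algebraic_unit x \<Longrightarrow> algebraic_unit y \<Longrightarrow> algebraic_unit (x * y)"
  unfolding algebraic_unit_def
proof (elim conjE exE)
  fix v w assume "algebraic_int x" "algebraic_int y" "algebraic_int v" "x * v = 1" "algebraic_int w" "y * w = 1"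
  moreover have "(x * y) * (v * w) = (x * v) * (y * w)" by (simp only: mult_ac)
  ultimately show "algebraic_int (x * y) \<and> (\<exists>v. algebraic_int v \<and> x * y * v = 1)"
    by (intro conjI exI[of _ "v * w"] algebraic_int_mult) simp_all
qed

lemma algebraic_unit_1 [simp]: "algebraic_unit 1"
  by (rule algebraic_unitI[of 1 1]) auto

lemma algebraic_unit_prod: "(\<And>i. i \<in> A \<Longrightarrow> algebraic_unit (f i)) \<Longrightarrow> algebraic_unit (\<Prod>i\<in>A. f i)"
  by (induction A rule: infinite_finite_induct) (auto intro: algebraic_unit_mult)

lemma algebraic_unit_prod_mset: "(\<And>i. i \<in># M \<Longrightarrow> algebraic_unit (f i)) \<Longrightarrow> algebraic_unit (\<Prod>i\<in>#M. f i)"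
  by (induction M) (auto intro: algebraic_unit_mult)

lemma algebraic_unit_inverse: "algebraic_unit x \<Longrightarrow> algebraic_unit (inverse x)"
  unfolding algebraic_unit_def by (metis inverse_unique mult.commute)

lemma algebraic_unit_power: "algebraic_unit x \<Longrightarrow> algebraic_unit (x ^ n)"
  by (induction n) (auto intro: algebraic_unit_mult)

lemma algebraic_unit_powi: "algebraic_unit x \<Longrightarrow> algebraic_unit (x powi n)"
  by (auto simp: power_int_def intro: algebraic_unit_power algebraic_unit_inverse)

lemma algebraic_unit_rational:
  assumes "algebraic_unit x" "x \<in> \<rat>" shows "norm x = 1"
proof -
  have "x \<in> \<int>" using assms by (intro rational_algebraic_int_is_int) (auto simp: algebraic_unit_def)
  moreover have "inverse x \<in> \<int>"
    using algebraic_unit_inverse[OF assms(1)] assms(2)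
    by (intro rational_algebraic_int_is_int) (auto simp: algebraic_unit_def)
  ultimately obtain a b where ab: "x = of_int a" "inverse x = of_int b" by (auto elim!: Ints_cases)
  have "of_int (a * b) = (1 :: complex)"
    using ab algebraic_unit_nonzero[OF assms(1)] by (metis of_int_mult right_inverse)
  then have "a * b = 1" by (metis of_int_eq_1_iff)
  then have "\<bar>a\<bar> = 1" using zmult_eq_1_iff[of a b] by auto
  then show ?thesis by (simp add: ab norm_of_int)
qed

section \<open>Primitive roots of unity and rationality of norms\<close>

definition prim_roots :: "nat \<Rightarrow> complex set" where
  "prim_roots k = {z. z ^ k = 1 \<and> (\<forall>d. 0 < d \<and> d < k \<longrightarrow> z ^ d \<noteq> 1)}"

lemma finite_roots_unity: "k > 0 \<Longrightarrow> finite {z :: complex. z ^ k = 1}"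
  using bij_betw_roots_unity[of k] by (metis bij_betw_finite finite_lessThan)

lemma finite_prim_roots [simp]: "k > 0 \<Longrightarrow> finite (prim_roots k)"
  by (rule finite_subset[OF _ finite_roots_unity[of k]]) (auto simp: prim_roots_def)

lemma generator_roots_unity:
  assumes "k > 0"
  obtains w :: complex where "w \<in> prim_roots k" "\<And>z :: complex. z ^ k = 1 \<Longrightarrow> \<exists>j<k. z = w ^ j"
proof -
  define w where "w = cis (2 * pi / real k)"
  have pw: "w ^ j = cis (2 * pi * real j / real k)" for j
    by (simp add: w_def DeMoivre mult.commute)
  have bij: "bij_betw (\<lambda>j. w ^ j) {..<k} {z. z ^ k = 1}"
    using bij_betw_roots_unity[OF assms] by (simp add: pw)
  have "w ^ d \<noteq> 1" if "0 < d" "d < k" for d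
  proof
    assume "w ^ d = 1"
    then have "w ^ d = w ^ 0" by simp
    moreover have "inj_on (\<lambda>j. w ^ j) {..<k}" using bij by (simp add: bij_betw_def)
    ultimately have "d = 0" using that(2) assms by (auto dest: inj_onD[where x = d and y = 0])
    then show False using that by simp
  qed
  moreover have "w ^ k = 1" using assms by (simp add: pw)
  ultimately have "w \<in> prim_roots k" by (simp add: prim_roots_def)
  moreover have "\<exists>j<k. z = w ^ j" if "z ^ k = 1" for z
  proof -
    have "z \<in> (\<lambda>j. w ^ j) ` {..<k}" using bij that by (simp add: bij_betw_def)
    then show ?thesis by auto
  qed
  ultimately show ?thesis by (rule that)
qed

lemma root_unity_order:
  fixes z :: complex
  assumes "k > 0" "z ^ k = 1"
  shows "\<exists>d. d dvd k \<and> z \<in> prim_roots d"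
proof -
  define d where "d = (LEAST d. d > 0 \<and> z ^ d = 1)"
  have d: "d > 0 \<and> z ^ d = 1"
    unfolding d_def by (rule LeastI[of "\<lambda>d. d > 0 \<and> z ^ d = 1" k]) (use assms in simp)
  have min: "z ^ e \<noteq> 1" if "0 < e" "e < d" for e
    using not_less_Least[of e "\<lambda>d. d > 0 \<and> z ^ d = 1"] that unfolding d_def by auto
  have "z ^ k = z ^ (d * (k div d)) * z ^ (k mod d)" by (metis mult_div_mod_eq power_add)
  then have "z ^ (k mod d) = 1" using d assms(2) by (simp add: power_mult)
  moreover have "k mod d < d" using d by simp
  ultimately have "k mod d = 0" using min[of "k mod d"] by (cases "k mod d = 0") auto
  then have "d dvd k" by (simp add: mod_0_imp_dvd)
  moreover have "z \<in> prim_roots d" using d min by (simp add: prim_roots_def)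
  ultimately show ?thesis by blast
qed

lemma roots_unity_decomp:
  assumes "k > 0"
  shows "{z :: complex. z ^ k = 1} = (\<Union>d\<in>{d. d dvd k}. prim_roots d)"
    and "d dvd k \<Longrightarrow> e dvd k \<Longrightarrow> d \<noteq> e \<Longrightarrow> prim_roots d \<inter> prim_roots e = {}"
proof -
  have "z ^ k = 1" if "d dvd k" "z ^ d = 1" for z :: complex and d
    using that by (auto elim!: dvdE simp: power_mult)
  then have "z ^ k = 1" if "d dvd k" "z \<in> prim_roots d" for z d
    using that unfolding prim_roots_def by blast
  then show "{z :: complex. z ^ k = 1} = (\<Union>d\<in>{d. d dvd k}. prim_roots d)"
    using root_unity_order[OF assms] by blast
  assume de: "d dvd k" "e dvd k" "d \<noteq> e"
  then have pos: "d > 0" "e > 0" using assms by (auto intro: dvd_pos_nat)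
  show "prim_roots d \<inter> prim_roots e = {}"
  proof (rule ccontr)
    assume "prim_roots d \<inter> prim_roots e \<noteq> {}"
    then obtain z where "z \<in> prim_roots d" "z \<in> prim_roots e" by blast
    then show False using de(3) pos unfolding prim_roots_def by (cases d e rule: linorder_cases) auto
  qed
qed

text \<open>Multiplication by a generator permutes the roots of unity, so the sum is 0 unless all
  the \<open>z ^ i\<close> are 1.\<close>

lemma sum_roots_unity_rat:
  assumes "k > 0" shows "(\<Sum>z | z ^ k = (1 :: complex). z ^ i) \<in> \<rat>"
proof -
  obtain w where w: "w \<in> prim_roots k" "\<And>z :: complex. z ^ k = 1 \<Longrightarrow> \<exists>j<k. z = w ^ j"
    by (rule generator_roots_unity[OF assms]) blast
  have wk: "w ^ k = 1" using w by (simp add: prim_roots_def)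
  then have w0: "w \<noteq> 0" using assms by (auto simp: power_0_left)
  let ?S = "\<Sum>z | z ^ k = (1 :: complex). z ^ i"
  have "bij_betw (\<lambda>z. w * z) {z. z ^ k = 1} {z. z ^ k = 1}"
    by (rule bij_betwI[where g = "\<lambda>z. z / w"]) (auto simp: power_mult_distrib power_divide wk w0)
  then have "?S = (\<Sum>z | z ^ k = (1 :: complex). (w * z) ^ i)"
    by (rule sum.reindex_bij_betw[symmetric])
  also have "\<dots> = w ^ i * ?S" by (simp add: power_mult_distrib sum_distrib_left)
  finally have "?S * (1 - w ^ i) = 0" by (simp add: algebra_simps)
  then consider "?S = 0" | "w ^ i = 1" by auto
  then show ?thesis
  proof cases
    case 2
    have "z ^ i = 1" if "z ^ k = 1" for z :: complex
    proof -
      have "\<exists>j<k. z = w ^ j" by (rule w(2)) (rule that)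
      then obtain j where "z = w ^ j" by blast
      then show ?thesis using 2 by (metis power_mult mult.commute power_one)
    qed
    then have "?S = (\<Sum>z | z ^ k = (1 :: complex). 1)" by (intro sum.cong) auto
    then show ?thesis by simp
  qed simp
qed

lemma sum_prim_roots_rat: "k > 0 \<Longrightarrow> (\<Sum>z\<in>prim_roots k. z ^ i) \<in> \<rat>"
proof (induction k rule: less_induct)
  case (less k)
  let ?D = "{d. d dvd k}"
  have fin: "finite ?D" using less.prems by simp
  have "(\<Sum>z | z ^ k = (1 :: complex). z ^ i) = (\<Sum>d\<in>?D. \<Sum>z\<in>prim_roots d. z ^ i)"
    unfolding roots_unity_decomp(1)[OF less.prems]
  proof (intro sum.UNION_disjoint ballI impI)
    show "finite (prim_roots d)" if "d \<in> ?D" for d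
      using that less.prems by (auto intro: dvd_pos_nat)
    show "prim_roots d \<inter> prim_roots e = {}" if "d \<in> ?D" "e \<in> ?D" "d \<noteq> e" for d e
      using roots_unity_decomp(2)[OF less.prems] that by blast
  qed (rule fin)
  also have "\<dots> = (\<Sum>z\<in>prim_roots k. z ^ i) + (\<Sum>d\<in>?D - {k}. \<Sum>z\<in>prim_roots d. z ^ i)"
    using fin by (intro sum.remove) auto
  finally have "(\<Sum>z\<in>prim_roots k. z ^ i) = (\<Sum>z | z ^ k = (1 :: complex). z ^ i)
      - (\<Sum>d\<in>?D - {k}. \<Sum>z\<in>prim_roots d. z ^ i)" by simp
  also have "\<dots> \<in> \<rat>"
  proof -
    have a: "(\<Sum>z | z ^ k = (1 :: complex). z ^ i) \<in> \<rat>"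
      by (rule sum_roots_unity_rat[OF less.prems])
    have b: "(\<Sum>d\<in>?D - {k}. \<Sum>z\<in>prim_roots d. z ^ i) \<in> \<rat>"
    proof (rule Rats_sum)
      fix d assume "d \<in> ?D - {k}"
      then have "d dvd k" "d \<noteq> k" by auto
      then have "d < k" "d > 0"
        using less.prems dvd_imp_le[of d k] dvd_pos_nat[of k d] by linarith+
      then show "(\<Sum>z\<in>prim_roots d. z ^ i) \<in> \<rat>" by (rule less.IH)
    qed
    show ?thesis by (rule Rats_diff[OF a b])
  qed
  finally show ?case .
qed

text \<open>Power sums of the values are rational, and Newton's identities pass from these to the
  product. The multiset \<open>N\<close> consists of values of \<open>1 - q\<close> because
  \<open>eps N\<close> at 1 is the product of the \<open>1 - z\<close>.\<close>

lemma prod_prim_roots_rat: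
  assumes "k > 0" "\<And>i. coeff q i \<in> \<rat>"
  shows "(\<Prod>z\<in>prim_roots k. poly q z) \<in> \<rat>"
proof -
  have sp: "(\<Sum>z\<in>prim_roots k. poly g z) \<in> \<rat>" if "\<And>i. coeff g i \<in> \<rat>" for g
  proof -
    have "(\<Sum>z\<in>prim_roots k. poly g z) = (\<Sum>i\<le>degree g. coeff g i * (\<Sum>z\<in>prim_roots k. z ^ i))"
      unfolding poly_altdef sum_distrib_left by (rule sum.swap)
    also have "\<dots> \<in> \<rat>" using that by (intro Rats_sum Rats_mult[OF _ sum_prim_roots_rat[OF assms(1)]])
    finally show ?thesis .
  qed
  define N where "N = image_mset (poly (1 - q)) (mset_set (prim_roots k))"
  have rc: "coeff ((1 - q) ^ j) i \<in> \<rat>" for i j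
  proof (induction j arbitrary: i)
    case (Suc j)
    have "coeff (1 - q) l \<in> \<rat>" for l using assms(2) by (simp add: coeff_1)
    then show ?case using Suc by (auto simp: coeff_mult intro!: Rats_sum Rats_mult)
  qed (auto simp: coeff_1)
  have "psum N j \<in> \<rat>" for j
  proof -
    have "psum N j = (\<Sum>z\<in>prim_roots k. poly ((1 - q) ^ j) z)"
      by (simp add: psum_def N_def image_mset.compositionality o_def sum_unfold_sum_mset)
    then show ?thesis using sp[OF rc] by simp
  qed
  then have "coeff (eps N) j \<in> \<rat>" for j by (intro eps_coeff_rat)
  then have "poly (eps N) 1 \<in> \<rat>" unfolding poly_altdef by (intro Rats_sum Rats_mult) auto
  moreover have "poly (eps N) 1 = (\<Prod>z\<in>prim_roots k. poly q z)"
    by (simp add: poly_eps N_def image_mset.compositionality o_def prod_unfold_prod_mset)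
  ultimately show ?thesis by simp
qed

lemma prim_roots_cnj: assumes "z \<in> prim_roots k" "k > 0" shows "cnj z = z ^ (k - 1)" "cnj z = inverse z"
proof -
  have zk: "z ^ k = 1" using assms by (simp add: prim_roots_def)
  then have "norm z ^ k = 1 ^ k" by (metis norm_one norm_power power_one)
  then have n: "norm z = 1" using assms(2) by (intro power_eq_imp_eq_base[of "norm z" k 1]) auto
  then have c: "z * cnj z = 1" by (simp add: complex_norm_square[symmetric])
  have "z * z ^ (k - 1) = 1" using zk assms(2) by (metis power_eq_if less_not_refl2)
  then show "cnj z = z ^ (k - 1)" using c by (metis mult.left_commute mult_1_right)
  show "cnj z = inverse z" using c by (metis inverse_unique)
qed

lemma algebraic_unit_prim_root: "z \<in> prim_roots k \<Longrightarrow> k > 0 \<Longrightarrow> algebraic_unit z"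
proof -
  assume z: "z \<in> prim_roots k" and k: "k > 0"
  have zk: "z ^ k = 1" using z by (simp add: prim_roots_def)
  have "algebraic_int z"
    by (rule algebraic_int_root[of 1 "monom 1 k"]) (use zk k in \<open>auto simp: poly_monom degree_monom_eq\<close>)
  moreover have "z * z ^ (k - 1) = 1" using zk k by (metis power_eq_if less_not_refl2)
  ultimately show ?thesis by (intro algebraic_unitI[of z "z ^ (k - 1)"]) auto
qed

lemma poly_diff_factor:
  assumes "algebraic_int x" "algebraic_int y"
  shows "\<exists>w. algebraic_int w \<and> poly (of_int_poly V) x - poly (of_int_poly V) y = (x - y) * (w :: complex)"
proof (induction V)
  case (pCons a V)
  then obtain w where w: "algebraic_int w" "poly (of_int_poly V) x - poly (of_int_poly V) y = (x - y) * w"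
    by (elim exE conjE)
  have "poly (of_int_poly (pCons a V)) x - poly (of_int_poly (pCons a V)) y
      = x * (poly (of_int_poly V) x - poly (of_int_poly V) y) + (x - y) * poly (of_int_poly V) y"
    using pCons by (simp add: of_int_hom.map_poly_pCons_hom algebra_simps)
  also have "\<dots> = (x - y) * (x * w + poly (of_int_poly V) y)" unfolding w(2) by (simp add: algebra_simps)
  finally show ?case
    by (intro exI[of _ "x * w + poly (of_int_poly V) y"] conjI algebraic_int_add algebraic_int_mult
        algebraic_int_poly_of_int assms w(1))
qed (rule exI[of _ 0], simp)

text \<open>A unit congruent to 1 modulo 4 in a cyclotomic field is real, by comparing the norm of
  its imaginary part with 1; the linear term of \<open>y\<close> prevents this.\<close>

theorem cyclotomic_norm_not_unit:
  fixes y :: "int poly"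
  assumes k: "k \<ge> 2" and y: "[:2 ^ Suc b:] dvd y - [:1, - (2 ^ b * u):]" and b: "b \<ge> 2" and u: "odd u"
    and norm: "norm (\<Prod>z\<in>prim_roots k. poly (of_int_poly y) z) = 1"
  shows False
proof -
  have k0: "k > 0" using k by simp
  obtain V where V: "y - [:1, - (2 ^ b * u):] = [:2 ^ Suc b:] * V" using y by (elim dvdE)
  define f where "f = (\<lambda>z :: complex. poly (of_int_poly y) z)"
  define v where "v = (\<lambda>z :: complex. poly (of_int_poly V) z)"
  obtain b' where b': "b = Suc (Suc b')" using b by (metis add_2_eq_Suc le_Suc_ex)
  have yV: "y = [:1, - (2 ^ b * u):] + [:2 ^ Suc b:] * V" using V by (simp add: algebra_simps)
  then have fz: "f z = 1 - 2 ^ b * of_int u * z + 2 ^ Suc b * v z" for z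
    by (simp add: f_def v_def hom_distribs of_int_hom.map_poly_pCons_hom algebra_simps)
  have cnjf: "cnj (f z) = f (cnj z)" for z
    unfolding f_def by (induction y) (auto simp: of_int_hom.map_poly_pCons_hom)
  show False
  proof (cases "k = 2")
    case True
    have "prim_roots 2 = {-1 :: complex}"
    proof -
      have "z \<in> prim_roots 2 \<longleftrightarrow> z = -1" for z :: complex
      proof
        assume "z \<in> prim_roots 2"
        then have "z ^ 2 = 1" "z ^ 1 \<noteq> 1" unfolding prim_roots_def by (blast, auto)
        then show "z = -1" by (simp add: power2_eq_1_iff)
      qed (auto simp: prim_roots_def less_2_cases_iff)
      then show ?thesis by blast
    qed
    then have "norm (f (-1)) = 1" using norm True by (simp add: f_def)
    moreover have "f (-1) = of_int (poly y (-1))" unfolding f_def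
      by (metis of_int_1 of_int_minus of_int_hom.poly_map_poly)
    ultimately have "\<bar>poly y (-1)\<bar> = 1" by (metis norm_of_int of_int_abs of_int_eq_1_iff)
    moreover have "poly y (-1) = 1 + 2 ^ b * (u + 2 * poly V (-1))"
      unfolding yV poly_add poly_mult by (simp add: algebra_simps)
    ultimately have "\<bar>1 + 2 ^ b * (u + 2 * poly V (-1))\<bar> = 1" by simp
    \<comment> \<open>Both alternatives are impossible: the second factor is odd, hence nonzero, and
      \<open>b \<ge> 2\<close> makes the left-hand side divisible by 4.\<close>
    then have "2 ^ b * (u + 2 * poly V (-1)) = 0 \<or> 2 ^ b * (u + 2 * poly V (-1)) = - 2" by linarith
    moreover have "u + 2 * poly V (-1) \<noteq> 0" using u by presburger
    moreover have "(2 :: int) ^ b * (u + 2 * poly V (-1)) = 4 * (2 ^ b' * (u + 2 * poly V (-1)))"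
      by (simp add: b')
    ultimately have "4 * (2 ^ b' * (u + 2 * poly V (-1))) = - 2" by simp
    then show False by presburger
  next
    case False
    define D where "D = (\<lambda>z. (f z - f (cnj z)) / 4)"
    have alg: "algebraic_int z" if "z \<in> prim_roots k" for z
      using algebraic_unit_prim_root[OF that k0] by (rule algebraic_unit_int)
    have Dalg: "algebraic_int (D z)" if z: "z \<in> prim_roots k" for z
    proof -
      have "D z = of_int (2 ^ b') * (of_int (- u) * (z - cnj z) + 2 * (v z - v (cnj z)))"
        by (simp add: D_def fz b' field_simps)
      then show ?thesis using alg[OF z] unfolding v_def
        by (simp only:) (intro algebraic_int_mult algebraic_int_add algebraic_int_diff algebraic_int_of_int
            algebraic_int_numeral algebraic_int_poly_of_int algebraic_int_cnj)
    qed
    \<comment> \<open>On primitive roots \<open>cnj z = z ^ (k - 1)\<close>, which makes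
      \<open>D\<close> a rational polynomial in \<open>z\<close> and its norm rational.\<close>
    define Q :: "complex poly" where "Q = Polynomial.smult (1 / 4) (of_int_poly y - pcompose (of_int_poly y) (monom 1 (k - 1)))"
    have DQ: "D z = poly Q z" if "z \<in> prim_roots k" for z
      using prim_roots_cnj(1)[OF that k0] by (simp add: D_def Q_def f_def poly_pcompose poly_monom)
    have Qrat: "coeff Q i \<in> \<rat>" for i
    proof -
      have "pcompose (of_int_poly y :: complex poly) (monom 1 (k - 1)) = of_int_poly (pcompose y (monom 1 (k - 1)))"
        by (simp add: of_int_hom.map_poly_pcompose of_int_hom.map_poly_hom_monom)
      then show ?thesis by (simp add: Q_def)
    qed
    have "(\<Prod>z\<in>prim_roots k. D z) \<in> \<int>"
    proof (rule rational_algebraic_int_is_int)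
      show "algebraic_int (\<Prod>z\<in>prim_roots k. D z)" using Dalg by (rule algebraic_int_prod)
      have "(\<Prod>z\<in>prim_roots k. D z) = (\<Prod>z\<in>prim_roots k. poly Q z)" using DQ by (intro prod.cong) auto
      then show "(\<Prod>z\<in>prim_roots k. D z) \<in> \<rat>" using prod_prim_roots_rat[OF k0 Qrat] by simp
    qed
    then obtain n where n: "(\<Prod>z\<in>prim_roots k. D z) = of_int n" by (auto elim: Ints_cases)
    have "norm (\<Prod>z\<in>prim_roots k. D z) = (\<Prod>z\<in>prim_roots k. norm (D z))" by (simp add: prod_norm)
    \<comment> \<open>Conjugate arguments give values of equal norm, so \<open>norm (D z)\<close> is
      at most half of \<open>norm (f z)\<close>, and the norms of the \<open>f z\<close> multiply to
      1.\<close>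
    also have "\<dots> \<le> (\<Prod>z\<in>prim_roots k. norm (f z) * (1 / 2))"
    proof (intro prod_mono conjI)
      fix z
      have "norm (f z - f (cnj z)) \<le> norm (f z) + norm (f (cnj z))" by (rule norm_triangle_ineq4)
      moreover have "norm (f (cnj z)) = norm (f z)" by (metis cnjf complex_mod_cnj)
      ultimately show "norm (D z) \<le> norm (f z) * (1 / 2)" by (simp add: D_def norm_divide)
    qed simp
    also have "\<dots> = (1 / 2) ^ card (prim_roots k)"
      unfolding prod.distrib using norm by (simp add: f_def prod_norm)
    also have "\<dots> < 1"
    proof -
      obtain w :: complex where "w \<in> prim_roots k" using generator_roots_unity[OF k0] by blast
      then have "card (prim_roots k) > 0" using k0 card_gt_0_iff by fastforce
      then show ?thesis by (simp add: power_less_one_iff)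
    qed
    finally have "norm (of_int n :: complex) < 1" unfolding n .
    then have "n = 0" by (simp add: norm_of_int)
    then obtain z where z: "z \<in> prim_roots k" "D z = 0" using n k0 by (auto simp: prod_zero_iff)
    have zc: "z \<noteq> cnj z"
    proof
      assume "z = cnj z"
      then have "z = inverse z" using prim_roots_cnj(2)[OF z(1) k0] by simp
      moreover have "z * inverse z = 1"
        using algebraic_unit_nonzero[OF algebraic_unit_prim_root[OF z(1) k0]] by simp
      ultimately have "z ^ 2 = 1" unfolding power2_eq_square by metis
      then show False using z(1) k False by (auto simp: prim_roots_def)
    qed
    have "algebraic_int (cnj z)" using alg[OF z(1)] by simp
    from poly_diff_factor[OF alg[OF z(1)] this, of V]
    obtain w where w: "algebraic_int w" "v z - v (cnj z) = (z - cnj z) * w"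
      unfolding v_def by (elim exE conjE)
    \<comment> \<open>Both the linear term and the remainder \<open>V\<close> are divisible by
      \<open>z - cnj z\<close>; after cancelling it, \<open>2 * w = u\<close> is left, although
      \<open>u\<close> is odd.\<close>
    have "0 = 2 ^ b * ((z - cnj z) * (2 * w - of_int u))"
    proof -
      have "0 = f z - f (cnj z)" using z(2) by (simp add: D_def)
      also have "\<dots> = 2 ^ b * (- of_int u * (z - cnj z) + 2 * (v z - v (cnj z)))"
        by (simp add: fz algebra_simps)
      finally show ?thesis unfolding w(2) by (simp add: algebra_simps)
    qed
    then have e: "2 * w = of_int u" using zc by simp
    then have "of_int u / of_int 2 = w" by (simp add: e[symmetric])
    then have "algebraic_int (of_int u / of_int 2 :: complex)" using w by simp
    then have "2 dvd u" by (rule of_int_dvd_algebraic) simp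
    then show False using u by simp
  qed
qed

section \<open>Moebius products of polynomials\<close>

lemma moebius_prime_mult:
  assumes "prime q" "\<not> q dvd d" "d > 0"
  shows "moebius (q * d) = - moebius d"
proof -
  have cop: "coprime q d" using assms by (simp add: prime_imp_coprime)
  have "squarefree (q * d) \<longleftrightarrow> squarefree d"
    using squarefree_mult_coprime[OF cop squarefree_prime[OF assms(1)]] squarefree_multD(2) by blast
  moreover have "prime_factors (q * d) = insert q (prime_factors d)"
    using assms by (simp add: prime_factors_product prime_prime_factors)
  moreover have "q \<notin> prime_factors d" using assms by (simp add: in_prime_factors_iff)
  ultimately show ?thesis by (simp add: moebius_def)
qed

lemma moebius_1 [simp]: "moebius (Suc 0) = 1"
  by (simp add: moebius_def)

text \<open>For a prime \<open>q\<close> dividing \<open>n\<close>, the squarefree divisors form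
  pairs \<open>d\<close>, \<open>q * d\<close> of opposite sign.\<close>

lemma sum_moebius:
  assumes "n > 0"
  shows "(\<Sum>d | d dvd n. moebius d) = (if n = 1 then 1 else 0)"
proof (cases "n = 1")
  case False
  obtain q where q: "prime q" "q dvd n" using prime_factor_nat[OF False] by blast
  let ?A = "{d. d dvd n \<and> squarefree d \<and> \<not> q dvd d}"
  have fin: "finite {d. d dvd n}" using assms by simp
  have pos: "d > 0" if "d dvd n" for d using that assms by (auto intro: Nat.gr0I)
  have split: "{d. d dvd n \<and> squarefree d} = ?A \<union> (\<lambda>d. q * d) ` ?A"
  proof (intro equalityI subsetI)
    fix d assume d: "d \<in> {d. d dvd n \<and> squarefree d}"
    show "d \<in> ?A \<union> (\<lambda>d. q * d) ` ?A"
    proof (cases "q dvd d")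
      case True
      then obtain e where e: "d = q * e" by (elim dvdE)
      have "\<not> q dvd e"
      proof
        assume "q dvd e"
        then have "q ^ 2 dvd d" by (auto simp: e power2_eq_square elim!: dvdE)
        then have "is_unit q" using d by (auto simp: squarefree_def)
        then show False using q(1) by simp
      qed
      moreover have "squarefree e" using d e squarefree_multD(2) by blast
      moreover have "e dvd n" using d e dvd_mult_right by blast
      ultimately show ?thesis using e by blast
    qed (use d in blast)
  next
    fix d assume "d \<in> ?A \<union> (\<lambda>d. q * d) ` ?A"
    then consider "d \<in> ?A" | e where "e \<in> ?A" "d = q * e" by blast
    then show "d \<in> {d. d dvd n \<and> squarefree d}"
    proof cases
      case 2
      then have "coprime q e" using q(1) by (simp add: prime_imp_coprime)
      then show ?thesis using 2 q squarefree_prime[OF q(1)]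
        by (simp add: divides_mult squarefree_mult_coprime)
    qed simp
  qed
  have "(\<Sum>d | d dvd n. moebius d) = (\<Sum>d | d dvd n \<and> squarefree d. moebius d)"
    using fin by (intro sum.mono_neutral_right) (auto simp: moebius_def)
  also have "\<dots> = sum moebius ?A + sum moebius ((\<lambda>d. q * d) ` ?A)"
    unfolding split using fin by (intro sum.union_disjoint) auto
  also have "sum moebius ((\<lambda>d. q * d) ` ?A) = (\<Sum>d\<in>?A. moebius (q * d))"
    using q(1) by (subst sum.reindex) (auto simp: inj_on_def prime_gt_0_nat)
  also have "\<dots> = (\<Sum>d\<in>?A. - moebius d)"
    using q(1) pos by (intro sum.cong) (auto simp: moebius_prime_mult)
  finally show ?thesis using False by (simp add: sum_negf)
qed simp

lemma sum_moebius_multiples: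
  assumes "n > 0" "e > 0"
  shows "(\<Sum>d | d dvd n \<and> e dvd d. moebius (n div d)) = (if e = n then 1 else 0)"
proof (cases "e dvd n")
  case True
  then obtain k where k: "n = e * k" by (elim dvdE)
  have k0: "k > 0" using assms k by simp
  have "(\<Sum>d | d dvd n \<and> e dvd d. moebius (n div d)) = (\<Sum>d | d dvd k. moebius d)"
  proof (rule sum.reindex_bij_witness[where i = "\<lambda>d. e * (k div d)" and j = "\<lambda>d. n div d"])
    fix d assume "d \<in> {d. d dvd n \<and> e dvd d}"
    then obtain i where i: "d = e * i" "i dvd k" using assms(2) by (auto simp: k)
    then obtain l where l: "k = i * l" by (elim dvdE)
    then show "e * (k div (n div d)) = d" "n div d \<in> {d. d dvd k}"
      using i k k0 assms by auto
  next
    fix d assume "d \<in> {d. d dvd k}"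
    then obtain l where l: "k = d * l" by auto
    then show "n div (e * (k div d)) = d" "e * (k div d) \<in> {d. d dvd n \<and> e dvd d}"
      using k k0 assms by auto
  qed simp
  then show ?thesis using sum_moebius[OF k0] k assms by auto
next
  case False
  then have e: "{d. d dvd n \<and> e dvd d} = {}" using dvd_trans by blast
  show ?thesis unfolding e using False by auto
qed

section \<open>Products with integer exponents that are polynomials\<close>

lemma power_int_nat: "(x :: 'a :: field) \<noteq> 0 \<Longrightarrow> x powi a = x ^ nat a / x ^ nat (- a)"
  by (cases "a \<ge> 0") (auto simp: power_int_def field_simps)

lemma to_fract_power: "to_fract (x ^ n) = to_fract x ^ n"
  by (induction n) simp_all

lemma to_fract_prod: "to_fract (\<Prod>d\<in>D. X d) = (\<Prod>d\<in>D. to_fract (X d))"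
  by (induction D rule: infinite_finite_induct) simp_all

lemma fract_prod_iff:
  assumes "finite D" "\<And>d. d \<in> D \<Longrightarrow> X d \<noteq> 0"
  shows "to_fract g = (\<Prod>d\<in>D. to_fract (X d) powi mu d)
    \<longleftrightarrow> g * (\<Prod>d\<in>D. X d ^ nat (- mu d)) = (\<Prod>d\<in>D. X d ^ nat (mu d))"
proof -
  have "(\<Prod>d\<in>D. to_fract (X d) powi mu d)
      = (\<Prod>d\<in>D. to_fract (X d ^ nat (mu d)) / to_fract (X d ^ nat (- mu d)))"
    using assms by (intro prod.cong) (auto simp: to_fract_power power_int_nat)
  also have "\<dots> = to_fract (\<Prod>d\<in>D. X d ^ nat (mu d)) / to_fract (\<Prod>d\<in>D. X d ^ nat (- mu d))"
    by (simp only: prod_dividef to_fract_prod)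
  finally have e: "(\<Prod>d\<in>D. to_fract (X d) powi mu d)
      = to_fract (\<Prod>d\<in>D. X d ^ nat (mu d)) / to_fract (\<Prod>d\<in>D. X d ^ nat (- mu d))" .
  have "to_fract (\<Prod>d\<in>D. X d ^ nat (- mu d)) \<noteq> 0"
    unfolding to_fract_eq_0_iff using assms by (auto simp: prod_zero_iff)
  then have "to_fract g = (\<Prod>d\<in>D. to_fract (X d) powi mu d) \<longleftrightarrow>
      to_fract (g * (\<Prod>d\<in>D. X d ^ nat (- mu d))) = to_fract (\<Prod>d\<in>D. X d ^ nat (mu d))"
    unfolding e to_fract_mult by (simp add: nonzero_eq_divide_eq)
  then show ?thesis unfolding to_fract_eq_iff .
qed

lemma prod_powi_sum:
  "(x :: 'a :: field) \<noteq> 0 \<Longrightarrow> (\<Prod>d\<in>D. x powi mu d) = x powi (\<Sum>d\<in>D. mu d)"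
  by (induction D rule: infinite_finite_induct) (auto simp: power_int_add)

lemma monic_division:
  assumes "monic (Q :: 'a :: {comm_ring_1,semiring_1_no_zero_divisors} poly)"
  obtains K R where "P = Q * K + R" "R = 0 \<or> degree R < degree Q"
proof -
  have Q0: "Q \<noteq> 0" using assms by auto
  obtain K R where KR: "pseudo_divmod P Q = (K, R)" by force
  show ?thesis using pseudo_divmod[OF Q0 KR] assms that by simp
qed

lemma dvd_of_order_le:
  assumes "P \<noteq> 0" "Q \<noteq> 0" "\<And>c. order c Q \<le> order c P"
  shows "Q dvd (P :: complex poly)"
proof -
  have "proots Q \<subseteq># proots P" using assms by (intro mset_subset_eqI) simp
  then have "(\<Prod>x\<in>#proots Q. [:-x, 1:]) dvd (\<Prod>x\<in>#proots P. [:-x, 1:])"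
    by (intro prod_mset_subset_imp_dvd image_mset_subseteq_mono)
  then have "Polynomial.smult (lead_coeff Q) (\<Prod>x\<in>#proots Q. [:-x, 1:])
      dvd Polynomial.smult (lead_coeff P) (\<Prod>x\<in>#proots P. [:-x, 1:])"
    using assms by (simp add: smult_dvd_iff dvd_smult)
  then show ?thesis by (simp only: complex_poly_decompose_multiset)
qed

definition ord :: "complex \<Rightarrow> int poly \<Rightarrow> nat" where
  "ord c P = order c (of_int_poly P)"

lemma ord_mult: "P \<noteq> 0 \<Longrightarrow> Q \<noteq> 0 \<Longrightarrow> ord c (P * Q) = ord c P + ord c Q"
  by (simp add: ord_def of_int_poly_hom.hom_mult order_mult)

lemma ord_1 [simp]: "ord c 1 = 0"
  by (simp add: ord_def order_0I)

lemma ord_power: "P \<noteq> 0 \<Longrightarrow> ord c (P ^ k) = k * ord c P"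
  by (induction k) (auto simp: ord_mult)

lemma ord_prod: "(\<And>i. i \<in> A \<Longrightarrow> P i \<noteq> 0) \<Longrightarrow> ord c (\<Prod>i\<in>A. P i) = (\<Sum>i\<in>A. ord c (P i))"
  by (induction A rule: infinite_finite_induct) (auto simp: ord_mult prod_zero_iff)

lemma ord_eq_0: "poly (of_int_poly P) c \<noteq> 0 \<Longrightarrow> ord c P = 0"
  by (simp add: ord_def order_0I)

lemma ord_pos: "P \<noteq> 0 \<Longrightarrow> poly (of_int_poly P) c = 0 \<longleftrightarrow> ord c P > 0"
  using order_root[of "of_int_poly P" c] by (simp add: ord_def)

text \<open>Orders of vanishing decide divisibility over the complex numbers, and division by a
  monic polynomial keeps the quotient in Z[X].\<close>

lemma monic_quotient:
  assumes "monic P" "monic Q" "\<And>c. ord c Q \<le> ord c P"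
  obtains K :: "int poly" where "P = K * Q" "monic K"
proof -
  obtain K R where KR: "P = Q * K + R" "R = 0 \<or> degree R < degree Q"
    by (rule monic_division[OF assms(2)])
  have nz: "P \<noteq> 0" "Q \<noteq> 0" using assms by auto
  then have "of_int_poly Q dvd (of_int_poly P :: complex poly)"
    using assms(3) by (intro dvd_of_order_le) (auto simp: ord_def)
  then have "of_int_poly Q dvd (of_int_poly Q * of_int_poly K + of_int_poly R :: complex poly)"
    by (simp add: KR(1) of_int_poly_hom.hom_mult of_int_poly_hom.hom_add)
  then have "of_int_poly Q dvd (of_int_poly R :: complex poly)" by (simp add: dvd_add_right_iff)
  then have "R = 0" using dvd_imp_degree_le[of "of_int_poly Q" "of_int_poly R :: complex poly"] KR(2)
    by (cases "R = 0") auto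
  then have PK: "P = K * Q" using KR by simp
  have "monic K" using assms(1,2) lead_coeff_mult[of K Q] unfolding PK by simp
  then show ?thesis using PK that by blast
qed

lemma monic_power_int: "monic (P :: int poly) \<Longrightarrow> monic (P ^ k)"
  by (simp add: lead_coeff_power)

lemma monic_prod_int: "(\<And>i. i \<in> A \<Longrightarrow> monic (P i)) \<Longrightarrow> monic (\<Prod>i\<in>A. P i :: int poly)"
  by (simp add: lead_coeff_prod)

lemma fract_prod_is_poly:
  fixes X :: "'i \<Rightarrow> int poly"
  assumes "finite D" "\<And>d. d \<in> D \<Longrightarrow> monic (X d)" "\<And>c. 0 \<le> (\<Sum>d\<in>D. mu d * int (ord c (X d)))"
  obtains G where "monic G" "to_fract G = (\<Prod>d\<in>D. to_fract (X d) powi mu d)"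
    "\<And>c. int (ord c G) = (\<Sum>d\<in>D. mu d * int (ord c (X d)))"
proof -
  have X0: "X d \<noteq> 0" if "d \<in> D" for d using assms(2)[OF that] by auto
  define P Q where "P = (\<Prod>d\<in>D. X d ^ nat (mu d))" and "Q = (\<Prod>d\<in>D. X d ^ nat (- mu d))"
  have mon: "monic P" "monic Q" unfolding P_def Q_def
    using assms(2) by (auto intro!: monic_prod_int monic_power_int)
  have "int (ord c P) - int (ord c Q) = (\<Sum>d\<in>D. mu d * int (ord c (X d)))" for c
  proof -
    have "int (ord c P) - int (ord c Q)
        = (\<Sum>d\<in>D. int (nat (mu d)) * int (ord c (X d)) - int (nat (- mu d)) * int (ord c (X d)))"
      using X0 by (simp add: P_def Q_def ord_prod ord_power sum_subtractf)
    also have "\<dots> = (\<Sum>d\<in>D. mu d * int (ord c (X d)))"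
      by (intro sum.cong refl) (simp add: left_diff_distrib[symmetric])
    finally show ?thesis .
  qed
  note o = this
  then have "ord c Q \<le> ord c P" for c using assms(3)[of c] o[of c] by linarith
  then obtain G where G: "P = G * Q" "monic G" by (rule monic_quotient[OF mon])
  have "G \<noteq> 0" "Q \<noteq> 0" using G mon by auto
  then have "int (ord c G) = (\<Sum>d\<in>D. mu d * int (ord c (X d)))" for c
    using o[of c] by (simp add: G(1) ord_mult)
  moreover have "to_fract G = (\<Prod>d\<in>D. to_fract (X d) powi mu d)"
    using G(1) fract_prod_iff[OF assms(1) X0, where g = G and mu = mu] by (simp add: P_def Q_def)
  ultimately show ?thesis using that G(2) by blast
qed

section \<open>Misiurewicz polynomials\<close>

lemma mis_W_Suc: "mis_W (Suc t) n = crit_iter (t + n) + crit_iter t"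
  by (simp add: mis_W_def)

lemma mis_W_1: "mis_W (Suc 0) n = crit_iter n"
  by (simp add: mis_W_Suc)

lemma crit_iter_diff:
  "crit_iter (s + e) - crit_iter (t + e)
    = (crit_iter s - crit_iter t) * (\<Prod>i<e. crit_iter (s + i) + crit_iter (t + i))"
proof (induction e)
  case (Suc e)
  have "crit_iter (s + Suc e) - crit_iter (t + Suc e)
      = (crit_iter (s + e) - crit_iter (t + e)) * (crit_iter (s + e) + crit_iter (t + e))"
    by (simp add: crit_iter_Suc power2_eq_square algebra_simps)
  then show ?case unfolding Suc by (simp add: mult.assoc)
qed simp

text \<open>For \<open>e, j \<ge> 1\<close> this is the quotient of
  \<open>mis_W (Suc t) (e * j)\<close> by \<open>mis_W (Suc t) e\<close>. An explicit recursion in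
  Z[X] allows evaluation at the zeros of the divisor.\<close>

primrec mis_Q :: "nat \<Rightarrow> nat \<Rightarrow> nat \<Rightarrow> int poly" where
  "mis_Q t e 0 = 0"
| "mis_Q t e (Suc j) = 1 + mis_Q t e j * ((crit_iter (t + e * j) - crit_iter t) *
    (\<Prod>i=1..<e. crit_iter (t + e * j + i) + crit_iter (t + i)))"

lemma mis_W_multiple_Suc:
  assumes "e \<ge> 1"
  shows "mis_W (Suc t) (e * Suc j) = mis_W (Suc t) e * mis_Q t e (Suc j)"
proof (induction j)
  case (Suc j)
  define s where "s = t + e * Suc j"
  have split: "(\<Prod>i<e. crit_iter (s + i) + crit_iter (t + i))
      = (crit_iter s + crit_iter t) * (\<Prod>i=1..<e. crit_iter (s + i) + crit_iter (t + i))"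
    using assms unfolding lessThan_atLeast0 by (subst prod.atLeast_Suc_lessThan) auto
  have W: "crit_iter s + crit_iter t = mis_W (Suc t) e * mis_Q t e (Suc j)"
    using Suc by (simp add: mis_W_Suc s_def)
  have "mis_W (Suc t) (e * Suc (Suc j)) = (crit_iter (s + e) - crit_iter (t + e)) + mis_W (Suc t) e"
    by (simp add: mis_W_Suc s_def algebra_simps)
  also have "\<dots> = (crit_iter s - crit_iter t) * ((mis_W (Suc t) e * mis_Q t e (Suc j)) *
      (\<Prod>i=1..<e. crit_iter (s + i) + crit_iter (t + i))) + mis_W (Suc t) e"
    unfolding crit_iter_diff split W ..
  also have "\<dots> = mis_W (Suc t) e * (1 + mis_Q t e (Suc j) * ((crit_iter s - crit_iter t) *
      (\<Prod>i=1..<e. crit_iter (s + i) + crit_iter (t + i))))"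
    by (simp only: ring_distribs mult_ac mult_1_right add_ac)
  also have "\<dots> = mis_W (Suc t) e * mis_Q t e (Suc (Suc j))"
    unfolding s_def mis_Q.simps(2)[of t e "Suc j"] ..
  finally show ?case .
qed simp

lemma mis_W_multiple:
  "e \<ge> 1 \<Longrightarrow> j \<ge> 1 \<Longrightarrow> mis_W (Suc t) (e * j) = mis_W (Suc t) e * mis_Q t e j"
  using mis_W_multiple_Suc[of e t "j - 1"] by simp

lemma poly_mis_W: "poly (of_int_poly (mis_W (Suc t) d)) c = poly (cit (t + d)) c + poly (cit t) c"
  by (simp add: mis_W_Suc cit_def hom_distribs)

lemma poly_cit_Suc: "poly (cit (Suc i)) c = (poly (cit i) c)\<^sup>2 + c"
  by (simp add: cit_Suc)

lemma poly_cit_periodic: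
  assumes "poly (of_int_poly (mis_W (Suc t) e)) c = 0" "i \<ge> 1"
  shows "poly (cit (t + i + e * j)) c = poly (cit (t + i)) c"
proof -
  have step: "poly (cit (t + i + e)) c = poly (cit (t + i)) c" if "i \<ge> 1" for i
    using that
  proof (induction i rule: nat_induct_at_least)
    case base
    have "poly (cit (t + e)) c = - poly (cit t) c"
      using assms(1) by (simp add: poly_mis_W eq_neg_iff_add_eq_0)
    then show ?case by (simp add: poly_cit_Suc)
  next
    case (Suc i)
    then show ?case by (simp add: poly_cit_Suc)
  qed
  show ?thesis
  proof (induction j)
    case (Suc j)
    have "poly (cit (t + (i + e * j) + e)) c = poly (cit (t + (i + e * j))) c"
      using assms(2) by (intro step) simp
    then show ?case using Suc by (simp add: add_ac)
  qed simp
qed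

text \<open>The multiplier of the cycle is the ratio of the geometric sum.\<close>

lemma poly_mis_Q:
  assumes "e \<ge> 1" "poly (of_int_poly (mis_W (Suc t) e)) c = 0"
  shows "poly (of_int_poly (mis_Q t e j)) c = (\<Sum>i<j. (2 ^ e * poly (cyc e (Suc t)) c) ^ i)"
proof (induction j)
  case (Suc j)
  define A where "A i = poly (cit i) c" for i
  define l where "l = 2 ^ e * poly (cyc e (Suc t)) c"
  have per: "A (t + i + e * j) = A (t + i)" if "i \<ge> 1" for i j
    using poly_cit_periodic[OF assms(2) that] by (simp add: A_def)
  have neg: "A (t + e) = - A t"
    using assms(2) by (simp add: poly_mis_W A_def eq_neg_iff_add_eq_0)
  have e: "poly (of_int_poly (mis_Q t e (Suc j))) c = 1 + poly (of_int_poly (mis_Q t e j)) c *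
      ((A (t + e * j) - A t) * (\<Prod>i=1..<e. A (t + e * j + i) + A (t + i)))"
    by (simp add: A_def cit_def hom_distribs poly_prod)
  have geo: "(\<Sum>i<Suc j. l ^ i) = 1 + (\<Sum>i<j. l ^ i) * l"
    unfolding sum.lessThan_Suc_shift by (simp add: sum_distrib_left mult.commute)
  show ?case
  proof (cases "j = 0")
    case False
    then obtain j' where j': "j = Suc j'" by (cases j) auto
    \<comment> \<open>\<open>A t\<close> itself need not lie on the cycle, only
      \<open>- A t = A (t + e)\<close> does. The minus sign turns this difference into the same
      shape as the other factors.\<close>
    have a: "A (t + e * j) - A t = 2 * A (t + e)"
      using per[of e j'] assms(1) neg by (simp add: j' add_ac)
    have "(\<Prod>i=1..<e. A (t + e * j + i) + A (t + i)) = (\<Prod>i=1..<e. 2 * A (t + i))"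
      using per[of _ j] by (intro prod.cong) (auto simp: add_ac)
    also have "\<dots> = 2 ^ (e - 1) * (\<Prod>i=1..<e. A (t + i))" by (simp add: prod.distrib)
    finally have "(A (t + e * j) - A t) * (\<Prod>i=1..<e. A (t + e * j + i) + A (t + i))
        = (2 * 2 ^ (e - 1)) * ((\<Prod>i=1..<e. A (t + i)) * A (t + e))" unfolding a by (simp add: mult_ac)
    also have "2 * 2 ^ (e - 1) = (2 :: complex) ^ e" using assms(1) by (cases e) auto
    also have "(\<Prod>i=1..<e. A (t + i)) * A (t + e) = (\<Prod>i=1..<Suc e. A (t + i))"
      using assms(1) by (subst prod.atLeastLessThan_Suc) auto
    also have "\<dots> = (\<Prod>i<e. A (Suc t + i))"
      unfolding lessThan_atLeast0 One_nat_def prod.shift_bounds_Suc_ivl by simp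
    also have "2 ^ e * \<dots> = l" by (simp add: l_def cyc_def poly_prod A_def)
    finally show ?thesis unfolding e Suc l_def[symmetric] geo by simp
  qed simp
qed simp

text \<open>Otherwise 2 would be a unit and 1/2 an algebraic integer. The powers of 2 in the
  multiplier thus keep it away from roots of unity.\<close>

lemma twice_not_root_unity:
  assumes "algebraic_int w" "j \<ge> 1" shows "(2 * w) ^ j \<noteq> (1 :: complex)"
proof
  assume "(2 * w) ^ j = 1"
  moreover obtain i where "j = Suc i" using assms(2) by (cases j) auto
  ultimately have "2 * (w * (2 * w) ^ i) = 1" by (simp add: mult_ac)
  then have e: "1 / 2 = w * (2 * w) ^ i" by (simp add: field_simps)
  have "algebraic_int (w * (2 * w) ^ i)"
    using assms(1) by (intro algebraic_int_mult algebraic_int_power algebraic_int_numeral)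
  then show False using algebraic_int_not_half unfolding e by blast
qed

lemma geometric_nonzero:
  assumes "algebraic_int w" "j \<ge> 1" "e \<ge> 1"
  shows "(\<Sum>i<j. (2 ^ e * w) ^ i) \<noteq> (0 :: complex)" "(2 ^ e * w) ^ j \<noteq> 1"
proof -
  obtain e' where e': "e = Suc e'" using assms(3) by (cases e) auto
  have "(2 * (2 ^ e' * w)) ^ j \<noteq> 1"
    using assms(1,2) by (intro twice_not_root_unity algebraic_int_mult algebraic_int_power algebraic_int_numeral)
  then show "(2 ^ e * w) ^ j \<noteq> 1" by (simp add: e' mult.assoc)
  then show "(\<Sum>i<j. (2 ^ e * w) ^ i) \<noteq> 0"
    using power_diff_1_eq[of "2 ^ e * w" j] by auto
qed

lemma algebraic_int_root_mis_W:
  "d \<ge> 1 \<Longrightarrow> poly (of_int_poly (mis_W (Suc t) d)) c = 0 \<Longrightarrow> algebraic_int (c :: complex)"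
  by (rule algebraic_int_monic_root[of "mis_W (Suc t) d"]) (auto intro: monic_mis_W)

lemma algebraic_int_cyc: "algebraic_int c \<Longrightarrow> algebraic_int (poly (cyc e m) c)"
  unfolding cyc_int by (rule algebraic_int_poly_of_int)

lemma mis_W_nonzero: "d \<ge> 1 \<Longrightarrow> mis_W (Suc t) d \<noteq> 0"
  using monic_mis_W[of d "Suc t"] by auto

lemma mis_Q_nonzero_at:
  fixes c :: complex
  assumes "e \<ge> 1" "poly (of_int_poly (mis_W (Suc t) e)) c = 0" "j \<ge> 1"
  shows "poly (of_int_poly (mis_Q t e j)) c \<noteq> 0"
  unfolding poly_mis_Q[OF assms(1,2)]
  by (intro geometric_nonzero algebraic_int_cyc algebraic_int_root_mis_W[of e t c] assms)

text \<open>At such a parameter the quotient is a geometric sum in the multiplier, and this is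
  nonzero.\<close>

lemma ord_mis_W_multiple:
  assumes "e \<ge> 1" "poly (of_int_poly (mis_W (Suc t) e)) c = 0" "j \<ge> 1"
  shows "ord c (mis_W (Suc t) (e * j)) = ord c (mis_W (Suc t) e)"
proof -
  have "mis_Q t e j \<noteq> 0" using mis_Q_nonzero_at[OF assms] by auto
  then show ?thesis
    using assms mis_W_nonzero ord_eq_0[OF mis_Q_nonzero_at[OF assms]]
    by (simp add: mis_W_multiple ord_mult)
qed

section \<open>Exact periods and Moebius inversion of the orders\<close>

lemma poly_cit_orbit:
  "d \<ge> 1 \<Longrightarrow> poly (cit (t + d)) c = (quad_map c ^^ d) (- poly (cit t) c)"
  by (induction d rule: nat_induct_at_least) (auto simp: poly_cit_Suc quad_map_def)

lemma mis_W_root_iff: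
  "d \<ge> 1 \<Longrightarrow> poly (of_int_poly (mis_W (Suc t) d)) c = 0
    \<longleftrightarrow> (quad_map c ^^ d) (- poly (cit t) c) = - poly (cit t) c"
  by (simp add: poly_mis_W poly_cit_orbit eq_neg_iff_add_eq_0)

text \<open>The period is measured at \<open>- a t\<close>: this point has the same image as
  \<open>a t\<close>, and it is on the cycle exactly when some \<open>a (t + d)\<close> with
  \<open>d \<ge> 1\<close> equals \<open>- a t\<close>.\<close>

definition exact_period :: "complex \<Rightarrow> nat \<Rightarrow> nat \<Rightarrow> bool" where
  "exact_period c t e \<longleftrightarrow>
    (\<forall>d. (quad_map c ^^ d) (- poly (cit t) c) = - poly (cit t) c \<longleftrightarrow> e dvd d)"

lemma periodic_point_period:
  assumes "d > 0" "(f ^^ d) z = z"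
  shows "\<exists>e>0. \<forall>d. (f ^^ d) z = z \<longleftrightarrow> e dvd d"
proof -
  define e where "e = (LEAST d. d > 0 \<and> (f ^^ d) z = z)"
  have e: "e > 0 \<and> (f ^^ e) z = z"
    unfolding e_def by (rule LeastI[of "\<lambda>d. d > 0 \<and> (f ^^ d) z = z" d]) (use assms in simp)
  have min: "(f ^^ i) z \<noteq> z" if "0 < i" "i < e" for i
    using not_less_Least[of i "\<lambda>d. d > 0 \<and> (f ^^ d) z = z"] that unfolding e_def by auto
  have "(f ^^ d) z = z \<longleftrightarrow> e dvd d" for d
  proof -
    have "(f ^^ d) z = (f ^^ (d mod e)) z" using funpow_mod_eq[of e f z d] e by simp
    moreover have "d mod e < e" using e by simp
    ultimately show ?thesis using min[of "d mod e"] by (cases "d mod e = 0") (auto simp: dvd_eq_mod_eq_0)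
  qed
  then show ?thesis using e by blast
qed

lemma exact_period_root_iff:
  "exact_period c t e \<Longrightarrow> d \<ge> 1 \<Longrightarrow> poly (of_int_poly (mis_W (Suc t) d)) c = 0 \<longleftrightarrow> e dvd d"
  by (simp add: mis_W_root_iff exact_period_def)

text \<open>If \<open>- a t\<close> has period \<open>e\<close>, the order of
  \<open>mis_W (Suc t) d\<close> at \<open>c\<close> is one and the same number for all multiples
  \<open>d\<close> of \<open>e\<close> and 0 for all other \<open>d\<close>. The Moebius sum over
  the multiples of \<open>e\<close> detects \<open>e = n\<close>.\<close>

lemma ord_moebius_sum:
  assumes n: "n \<ge> 1"
  shows "(\<Sum>d | d dvd n. moebius (n div d) * int (ord c (mis_W (Suc t) d)))
    = (if exact_period c t n then int (ord c (mis_W (Suc t) n)) else 0)"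
proof -
  have pos: "d \<ge> 1" if "d dvd n" for d using that n by (cases d) auto
  have fin: "finite {d. d dvd n}" using n by simp
  show ?thesis
  proof (cases "\<exists>d>0. (quad_map c ^^ d) (- poly (cit t) c) = - poly (cit t) c")
    case True
    then obtain e where e0: "e > 0" and e: "exact_period c t e"
      using periodic_point_period unfolding exact_period_def by metis
    have We: "poly (of_int_poly (mis_W (Suc t) e)) c = 0"
      using exact_period_root_iff[OF e, of e] e0 by simp
    have od: "ord c (mis_W (Suc t) d) = (if e dvd d then ord c (mis_W (Suc t) e) else 0)"
      if "d dvd n" for d
    proof (cases "e dvd d")
      case True
      then obtain j where j: "d = e * j" by (elim dvdE)
      then have "j \<ge> 1" using pos[OF that] by (cases j) auto
      then show ?thesis using ord_mis_W_multiple[OF _ We, of j] e0 by (simp add: j)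
    next
      case False
      then show ?thesis using exact_period_root_iff[OF e pos[OF that]] by (simp add: ord_eq_0)
    qed
    have "(\<Sum>d | d dvd n. moebius (n div d) * int (ord c (mis_W (Suc t) d)))
        = (\<Sum>d | d dvd n \<and> e dvd d. moebius (n div d) * int (ord c (mis_W (Suc t) e)))"
      using fin by (intro sum.mono_neutral_cong_right) (auto simp: od)
    also have "\<dots> = (if e = n then 1 else 0) * int (ord c (mis_W (Suc t) e))"
      using sum_moebius_multiples[of n e] n e0 by (simp add: sum_distrib_right[symmetric])
    also have en: "e = n \<longleftrightarrow> exact_period c t n"
    proof
      assume "exact_period c t n"
      then have nd: "n dvd d \<longleftrightarrow> e dvd d" for d using e unfolding exact_period_def by blast
      have "e dvd n" using nd[of n] by (rule iffD1) (rule dvd_refl)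
      moreover have "n dvd e" using nd[of e] by (rule iffD2) (rule dvd_refl)
      ultimately show "e = n" by (rule dvd_antisym)
    qed (use e in blast)
    also have "(if exact_period c t n then 1 else 0) * int (ord c (mis_W (Suc t) e))
        = (if exact_period c t n then int (ord c (mis_W (Suc t) n)) else 0)"
      using en by (cases "e = n") auto
    finally show ?thesis .
  next
    case False
    have "\<not> exact_period c t n"
    proof
      assume "exact_period c t n"
      then have "(quad_map c ^^ n) (- poly (cit t) c) = - poly (cit t) c"
        unfolding exact_period_def by simp
      moreover have "n > 0" using n by simp
      ultimately show False using False by blast
    qed
    moreover have "ord c (mis_W (Suc t) d) = 0" if "d dvd n" for d
    proof (rule ord_eq_0)
      have "d > 0" using pos[OF that] by simp
      then show "poly (of_int_poly (mis_W (Suc t) d)) c \<noteq> 0"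
        unfolding mis_W_root_iff[OF pos[OF that]] using False by blast
    qed
    ultimately show ?thesis by simp
  qed
qed

text \<open>The first product of the Misiurewicz polynomial of index \<open>Suc t\<close>. For
  \<open>t = 0\<close> it is the polynomial of the parameters for which 0 has exact period
  \<open>n\<close>, that is, the inverse of the second product.\<close>

definition prim_part :: "nat \<Rightarrow> nat \<Rightarrow> int poly" where
  "prim_part t n = (THE g. to_fract g = (\<Prod>d | d dvd n. to_fract (mis_W (Suc t) d) powi moebius (n div d)))"

lemma prim_part:
  assumes n: "n \<ge> 1"
  shows "monic (prim_part t n)"
    and "to_fract (prim_part t n) = (\<Prod>d | d dvd n. to_fract (mis_W (Suc t) d) powi moebius (n div d))"
    and "int (ord c (prim_part t n)) = (if exact_period c t n then int (ord c (mis_W (Suc t) n)) else 0)"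
proof -
  have fin: "finite {d. d dvd n}" using n by simp
  have mon: "monic (mis_W (Suc t) d)" if "d \<in> {d. d dvd n}" for d
    using that n by (intro monic_mis_W) (cases d, auto)
  have nonneg: "0 \<le> (\<Sum>d | d dvd n. moebius (n div d) * int (ord c (mis_W (Suc t) d)))" for c
    unfolding ord_moebius_sum[OF n] by simp
  obtain G where G: "monic G"
    "to_fract G = (\<Prod>d | d dvd n. to_fract (mis_W (Suc t) d) powi moebius (n div d))"
    "\<And>c. int (ord c G) = (\<Sum>d | d dvd n. moebius (n div d) * int (ord c (mis_W (Suc t) d)))"
    by (rule fract_prod_is_poly[OF fin _ nonneg], erule mon) (rule that; assumption)
  have "prim_part t n = G"
    unfolding prim_part_def G(2)[symmetric] to_fract_eq_iff by (rule the_equality) auto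
  then show "monic (prim_part t n)"
    "to_fract (prim_part t n) = (\<Prod>d | d dvd n. to_fract (mis_W (Suc t) d) powi moebius (n div d))"
    "int (ord c (prim_part t n)) = (if exact_period c t n then int (ord c (mis_W (Suc t) n)) else 0)"
    using G ord_moebius_sum[OF n] by auto
qed

lemma crit_iter_dvd: "e \<ge> 1 \<Longrightarrow> e dvd i \<Longrightarrow> crit_iter e dvd crit_iter i"
proof (elim dvdE)
  fix j assume "e \<ge> 1" "i = e * j"
  then show ?thesis
    using mis_W_multiple[of e j 0] by (cases "j = 0") (auto simp: mis_W_1)
qed

text \<open>If 0 has exact period \<open>n\<close> and \<open>n dvd t\<close>, then
  \<open>a t = 0\<close>, so \<open>- a t\<close> has the same period. The multiplicities compare
  because \<open>crit_iter n\<close> divides both summands of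
  \<open>mis_W (Suc t) n\<close>.\<close>

lemma ord_prim_part_le:
  assumes "n \<ge> 1" "n dvd t"
  shows "ord c (prim_part 0 n) \<le> ord c (prim_part t n)"
proof (cases "exact_period c 0 n")
  case True
  have "poly (cit n) c = 0"
    using exact_period_root_iff[OF True assms(1)] poly_mis_W[of 0 n c] by simp
  moreover have d: "crit_iter n dvd crit_iter t" "crit_iter n dvd crit_iter (t + n)"
    using assms by (auto intro!: crit_iter_dvd)
  ultimately have "poly (cit t) c = 0"
    unfolding cit_def by (auto elim!: dvdE simp: hom_distribs)
  then have "exact_period c t n" using True unfolding exact_period_def by simp
  moreover have "crit_iter n dvd mis_W (Suc t) n" unfolding mis_W_Suc using d by simp
  then have "ord c (crit_iter n) \<le> ord c (mis_W (Suc t) n)"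
    unfolding ord_def using assms(1) mis_W_nonzero[of n t]
    by (intro dvd_imp_order_le of_int_poly_hom.hom_dvd) auto
  ultimately have "int (ord c (prim_part 0 n)) \<le> int (ord c (prim_part t n))"
    unfolding prim_part(3)[OF assms(1)] using True by (simp add: mis_W_1)
  then show ?thesis by simp
next
  case False
  then have "int (ord c (prim_part 0 n)) = 0" unfolding prim_part(3)[OF assms(1)] by simp
  then show ?thesis by simp
qed

text \<open>This also establishes that the definite description behind
  \<open>misiurewicz_poly\<close> denotes an element of Z[c].\<close>

lemma misiurewicz_poly:
  assumes n: "n \<ge> 1"
  shows "misiurewicz_poly (Suc t) n * (if n dvd t then prim_part 0 n else 1) = prim_part t n"
    and "monic (misiurewicz_poly (Suc t) n)"
proof -
  define E where "E = (if n dvd t then prim_part 0 n else 1)"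
  have E: "monic E" using prim_part(1)[OF n] by (simp add: E_def)
  have "ord c E \<le> ord c (prim_part t n)" for c
    using ord_prim_part_le[OF n] by (simp add: E_def)
  then obtain K where K: "prim_part t n = K * E" "monic K"
    by (rule monic_quotient[OF prim_part(1)[OF n] E])
  have E0: "to_fract E \<noteq> 0" using E by auto
  have "misiurewicz_fract (Suc t) n = to_fract (prim_part t n) * inverse (to_fract E)"
  proof -
    have "(\<Prod>k | k dvd n. to_fract (crit_iter k) powi (- moebius (n div k)))
        = inverse (to_fract (prim_part 0 n))"
      unfolding prim_part(2)[OF n] mis_W_1 by (simp add: power_int_minus prod_inversef[symmetric] o_def)
    moreover have "(\<Prod>k | k dvd n. to_fract (crit_iter (Suc t + k - 1) + crit_iter (Suc t - 1)) powi moebius (n div k))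
        = to_fract (prim_part t n)"
      unfolding prim_part(2)[OF n] mis_W_Suc by simp
    ultimately show ?thesis unfolding misiurewicz_fract_def E_def by simp
  qed
  also have "\<dots> = to_fract K" using E0 by (simp add: K(1))
  finally have "misiurewicz_poly (Suc t) n = K"
    unfolding misiurewicz_poly_def by (simp add: the_equality)
  then show "misiurewicz_poly (Suc t) n * (if n dvd t then prim_part 0 n else 1) = prim_part t n"
    "monic (misiurewicz_poly (Suc t) n)"
    using K by (simp_all add: E_def)
qed

lemma misiurewicz_root_exact_period:
  assumes "n \<ge> 1" "poly (of_int_poly (misiurewicz_poly (Suc t) n)) c = 0"
  shows "exact_period c t n"
proof (rule ccontr)
  assume "\<not> exact_period c t n"
  then have "int (ord c (prim_part t n)) = 0" unfolding prim_part(3)[OF assms(1)] by simp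
  moreover have "poly (of_int_poly (prim_part t n)) c = 0"
    using assms(2) by (subst misiurewicz_poly(1)[OF assms(1), symmetric])
      (simp only: of_int_poly_hom.hom_mult poly_mult mult_zero_left)
  moreover have "prim_part t n \<noteq> 0" using prim_part(1)[OF assms(1), of t] by auto
  ultimately show False using ord_pos by auto
qed

lemma prim_part_prime:
  assumes "prime p"
  shows "prim_part t p * mis_W (Suc t) 1 = mis_W (Suc t) p"
proof -
  have p: "p \<ge> 1" "p \<noteq> 1" using prime_gt_1_nat[OF assms] by auto
  have D: "{d. d dvd p} = {1, p}" using assms p by (auto simp: prime_nat_iff)
  have mp: "moebius p = - 1" using moebius_prime_mult[OF assms, of 1] assms p by simp
  have nz: "mis_W (Suc t) 1 \<noteq> 0" by (rule mis_W_nonzero) simp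
  have "to_fract (prim_part t p) = to_fract (mis_W (Suc t) 1) powi moebius p * to_fract (mis_W (Suc t) p) powi 1"
    unfolding prim_part(2)[OF p(1)] D using p by simp
  then have "to_fract (prim_part t p * mis_W (Suc t) 1) = to_fract (mis_W (Suc t) p)"
    using nz by (simp add: mp power_int_minus)
  then show ?thesis unfolding to_fract_eq_iff .
qed

section \<open>Values at the roots of the period p polynomial\<close>

definition alg_dvd :: "complex \<Rightarrow> complex \<Rightarrow> bool" where
  "alg_dvd x y \<longleftrightarrow> (\<exists>w. algebraic_int w \<and> y = x * w)"

lemma alg_dvdI: "algebraic_int w \<Longrightarrow> y = x * w \<Longrightarrow> alg_dvd x y"
  by (auto simp: alg_dvd_def)

lemma alg_dvd_0: "alg_dvd x 0"
  by (rule alg_dvdI[of 0]) auto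

lemma alg_dvd_add:
  assumes "alg_dvd x y" "alg_dvd x z" shows "alg_dvd x (y + z)"
proof -
  obtain v w where "algebraic_int v" "y = x * v" "algebraic_int w" "z = x * w"
    using assms unfolding alg_dvd_def by (elim exE conjE)
  then show ?thesis by (intro alg_dvdI[of "v + w"] algebraic_int_add) (simp_all add: ring_distribs)
qed

lemma alg_dvd_trans:
  assumes "alg_dvd x y" "alg_dvd y z" shows "alg_dvd x z"
proof -
  obtain v w where "algebraic_int v" "y = x * v" "algebraic_int w" "z = y * w"
    using assms unfolding alg_dvd_def by (elim exE conjE)
  then show ?thesis by (intro alg_dvdI[of "v * w"] algebraic_int_mult) (simp_all add: mult.assoc)
qed

lemma alg_dvd_minus:
  assumes "alg_dvd x y" shows "alg_dvd x (- y)"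
proof -
  obtain v where "algebraic_int v" "y = x * v" using assms unfolding alg_dvd_def by (elim exE conjE)
  then show ?thesis by (intro alg_dvdI[of "- v"]) simp_all
qed

lemma alg_dvd_associated:
  assumes "alg_dvd x y" "alg_dvd y x" "x \<noteq> 0"
  shows "\<exists>u. algebraic_unit u \<and> y = x * u"
proof -
  obtain v w where vw: "algebraic_int v" "y = x * v" "algebraic_int w" "x = y * w"
    using assms(1,2) unfolding alg_dvd_def by (elim exE conjE)
  have "x * (v * w) = x * 1" using vw(2,4) by (simp add: mult.assoc[symmetric])
  then have "v * w = 1" using assms(3) by (simp only: mult_cancel_left simp_thms)
  then have "algebraic_unit v" using vw by (intro algebraic_unitI[of v w])
  then show ?thesis using vw(2) by blast
qed

lemma algebraic_int_quad_map_iterate: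
  "algebraic_int (c :: complex) \<Longrightarrow> algebraic_int x \<Longrightarrow> algebraic_int ((quad_map c ^^ i) x)"
  by (induction i) (auto simp: quad_map_def intro!: algebraic_int_add algebraic_int_power)

lemma alg_dvd_quad_map_iterate:
  assumes "algebraic_int c" "algebraic_int x" "algebraic_int y"
  shows "alg_dvd (x - y) ((quad_map c ^^ i) x - (quad_map c ^^ i) y)"
proof (induction i)
  case 0
  show ?case by (rule alg_dvdI[of 1]) auto
next
  case (Suc i)
  let ?a = "(quad_map c ^^ i) x" and ?b = "(quad_map c ^^ i) y"
  have "alg_dvd (?a - ?b) ((quad_map c ^^ Suc i) x - (quad_map c ^^ Suc i) y)"
    using assms by (intro alg_dvdI[of "?a + ?b"] algebraic_int_add algebraic_int_quad_map_iterate)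
      (simp_all add: quad_map_def power2_eq_square algebra_simps)
  then show ?case by (rule alg_dvd_trans[OF Suc])
qed

lemma alg_dvd_iterate_multiple:
  assumes "algebraic_int c" "algebraic_int z"
  shows "alg_dvd ((quad_map c ^^ d) z - z) ((quad_map c ^^ (d * u)) z - z)"
proof (induction u)
  case (Suc u)
  have "(quad_map c ^^ (d * Suc u)) z - z
      = ((quad_map c ^^ (d * u)) ((quad_map c ^^ d) z) - (quad_map c ^^ (d * u)) z)
        + ((quad_map c ^^ (d * u)) z - z)"
    unfolding mult_Suc_right add.commute[of d] funpow_add by simp
  then show ?case using Suc assms
    by (simp only:) (intro alg_dvd_add alg_dvd_quad_map_iterate algebraic_int_quad_map_iterate)
qed (simp add: alg_dvd_0)

lemma algebraic_int_cit: "algebraic_int c \<Longrightarrow> algebraic_int (poly (cit i) c)"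
  unfolding cit_def by (rule algebraic_int_poly_of_int)

lemma poly_mis_W_displacement:
  assumes "d \<ge> 1"
  shows "poly (of_int_poly (mis_W (Suc t) d)) c = (quad_map c ^^ d) (- poly (cit t) c) - (- poly (cit t) c)"
  by (simp add: poly_mis_W poly_cit_orbit[OF assms])

text \<open>Write \<open>f\<close> for the map and \<open>z\<close> for the periodic point. The
  displacement of \<open>z\<close> under the \<open>d\<close>-th iterate divides the one under the
  \<open>(d * u)\<close>-th. Since \<open>d\<close> is invertible modulo the period
  \<open>p\<close>, some \<open>u\<close> turns the latter into \<open>f z - z\<close>; the reverse
  divisibility is the case of one step.\<close>

lemma mis_W_associated:
  assumes p: "prime p" and per: "exact_period c t p" and c: "algebraic_int c" and d: "d \<ge> 1" "\<not> p dvd d"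
  shows "\<exists>u. algebraic_unit u \<and>
    poly (of_int_poly (mis_W (Suc t) d)) c = poly (of_int_poly (mis_W (Suc t) 1)) c * u"
proof -
  define z where "z = - poly (cit t) c"
  have z: "algebraic_int z" unfolding z_def using c by (simp add: algebraic_int_cit)
  have pz: "(quad_map c ^^ p) z = z" using per by (simp add: exact_period_def z_def)
  have "coprime p d" using p d(2) by (rule prime_imp_coprime)
  then have "coprime d p" by (simp only: coprime_commute)
  moreover obtain u y where "d * u = p * y + gcd d p" using bezout_nat[of d p] d(1) by auto
  ultimately have "d * u = 1 + p * y" by simp
  then have "d * u mod p = 1 mod p" by (simp only: mod_mult_self2)
  then have "(quad_map c ^^ (d * u)) z = (quad_map c ^^ 1) z"
    using funpow_mod_eq[OF pz, of "d * u"] funpow_mod_eq[OF pz, of 1] by (simp only:)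
  then have "alg_dvd ((quad_map c ^^ d) z - z) ((quad_map c ^^ 1) z - z)"
    using alg_dvd_iterate_multiple[OF c z, of d u] by (simp only:)
  moreover have "alg_dvd ((quad_map c ^^ 1) z - z) ((quad_map c ^^ d) z - z)"
    using alg_dvd_iterate_multiple[OF c z, of 1 d] by (simp only: mult_1)
  moreover have "(quad_map c ^^ 1) z - z \<noteq> 0"
  proof
    assume "(quad_map c ^^ 1) z - z = 0"
    then have "(quad_map c ^^ 1) z = z" by simp
    then have "p dvd 1" using per unfolding exact_period_def z_def[symmetric] by blast
    then show False using p by simp
  qed
  ultimately have "\<exists>u. algebraic_unit u \<and> (quad_map c ^^ d) z - z = ((quad_map c ^^ 1) z - z) * u"
    by (intro alg_dvd_associated)
  then show ?thesis unfolding poly_mis_W_displacement[OF d(1)] poly_mis_W_displacement[OF order_refl] z_def .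
qed

lemma poly_cit_iterate: "poly (cit i) c = (quad_map c ^^ i) 0"
  by (induction i) (simp_all add: poly_cit_Suc quad_map_def)

text \<open>\<open>a d\<close> divides \<open>a (t + d)\<close> because \<open>d dvd t\<close>. By
  periodicity this equals \<open>a (t + d + p * x)\<close>, and a Bezout coefficient
  \<open>x\<close> makes the index congruent to \<open>gcd p d\<close> modulo \<open>d\<close>, so
  that \<open>a d\<close> divides \<open>a (gcd p d)\<close>.\<close>

lemma cit_associated:
  assumes c: "algebraic_int c" and W: "poly (of_int_poly (mis_W (Suc t) p)) c = 0" and p: "p \<ge> 1"
    and d: "d \<ge> 1" "d dvd t" and nz: "poly (cit (gcd p d)) c \<noteq> 0"
  shows "\<exists>u. algebraic_unit u \<and> poly (cit d) c = poly (cit (gcd p d)) c * u"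
proof -
  define A where "A i = poly (cit i) c" for i
  let ?g = "gcd p d"
  have mult: "alg_dvd (A a) (A (a * u))" for a u
    using alg_dvd_iterate_multiple[OF c, of 0 a u] by (simp add: A_def poly_cit_iterate)
  obtain x y where xy: "p * x = d * y + ?g" using bezout_nat[of p d] p by auto
  obtain s where s: "t = d * s" using d(2) by (elim dvdE)
  define w where "w = s + 1 + y"
  have "A (t + d + p * x) = A (t + d)"
    using poly_cit_periodic[OF W d(1)] by (simp add: A_def)
  moreover have "t + d + p * x = ?g + d * w" unfolding xy s w_def by (simp add: algebra_simps)
  ultimately have "A (?g + d * w) = A (d * (s + 1))" by (simp add: s add.commute)
  then have "A ?g = A (d * (s + 1)) + - (A (?g + d * w) - A ?g)" by simp
  moreover have "alg_dvd (A d) (A (?g + d * w) - A ?g)"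
  proof -
    have "A (?g + d * w) - A ?g = (quad_map c ^^ ?g) (A (d * w)) - (quad_map c ^^ ?g) 0"
      by (simp add: A_def poly_cit_iterate funpow_add)
    moreover have "alg_dvd (A (d * w) - 0) \<dots>"
      using c by (intro alg_dvd_quad_map_iterate) (simp_all add: A_def algebraic_int_cit)
    ultimately show ?thesis using alg_dvd_trans[OF mult[of d w]] by simp
  qed
  ultimately have "alg_dvd (A d) (A ?g)"
    using alg_dvd_add[OF mult[of d "s + 1"] alg_dvd_minus] by metis
  moreover have "alg_dvd (A ?g) (A d)"
  proof -
    obtain b where "d = ?g * b" using gcd_dvd2[of p d] by (elim dvdE)
    then show ?thesis using mult[of ?g b] by metis
  qed
  ultimately show ?thesis using nz unfolding A_def by (intro alg_dvd_associated)
qed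

text \<open>The common factor \<open>x\<close> occurs with total exponent 0.\<close>

lemma algebraic_unit_prod_powi:
  assumes "x \<noteq> 0" "\<And>d. d \<in> D \<Longrightarrow> \<exists>u. algebraic_unit u \<and> y d = x * u" "(\<Sum>d\<in>D. mu d) = 0"
  shows "algebraic_unit (\<Prod>d\<in>D. y d powi mu d)"
proof -
  have "\<forall>d\<in>D. \<exists>u. algebraic_unit u \<and> y d = x * u" using assms(2) by blast
  then obtain u where "\<forall>d\<in>D. algebraic_unit (u d) \<and> y d = x * u d" by (rule bchoice[THEN exE])
  then have u: "algebraic_unit (u d)" "y d = x * u d" if "d \<in> D" for d using that by auto
  have "(\<Prod>d\<in>D. y d powi mu d) = (\<Prod>d\<in>D. x powi mu d * u d powi mu d)"
    using u(2) by (intro prod.cong) (auto simp: power_int_mult_distrib)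
  also have "\<dots> = (\<Prod>d\<in>D. u d powi mu d)"
    using assms(3) by (simp add: prod.distrib prod_powi_sum[OF assms(1)])
  also have "algebraic_unit \<dots>" using u(1) by (intro algebraic_unit_prod algebraic_unit_powi)
  finally show ?thesis .
qed

lemma fract_prod_eval:
  assumes "finite D" "\<And>d. d \<in> D \<Longrightarrow> poly (of_int_poly (X d)) c \<noteq> (0 :: complex)"
    and "to_fract G = (\<Prod>d\<in>D. to_fract (X d) powi mu d)"
  shows "poly (of_int_poly G) c = (\<Prod>d\<in>D. poly (of_int_poly (X d)) c powi mu d)"
proof -
  define x where "x d = poly (of_int_poly (X d)) c" for d
  have x0: "x d \<noteq> 0" if "d \<in> D" for d using assms(2)[OF that] by (simp add: x_def)
  have "X d \<noteq> 0" if "d \<in> D" for d using assms(2)[OF that] by auto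
  then have "G * (\<Prod>d\<in>D. X d ^ nat (- mu d)) = (\<Prod>d\<in>D. X d ^ nat (mu d))"
    using fract_prod_iff[OF assms(1), where X = X and g = G and mu = mu] assms(3) by blast
  then have "poly (of_int_poly (G * (\<Prod>d\<in>D. X d ^ nat (- mu d)))) c
      = poly (of_int_poly (\<Prod>d\<in>D. X d ^ nat (mu d))) c" by (simp only:)
  then have "poly (of_int_poly G) c * (\<Prod>d\<in>D. x d ^ nat (- mu d)) = (\<Prod>d\<in>D. x d ^ nat (mu d))"
    by (simp add: of_int_poly_hom.hom_mult of_int_poly_prod of_int_poly_hom.hom_power poly_prod x_def)
  moreover have "(\<Prod>d\<in>D. x d ^ nat (- mu d)) \<noteq> 0" using x0 assms(1) by (simp add: prod_zero_iff)
  ultimately have "poly (of_int_poly G) c = (\<Prod>d\<in>D. x d ^ nat (mu d)) / (\<Prod>d\<in>D. x d ^ nat (- mu d))"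
    by (simp add: nonzero_eq_divide_eq)
  also have "\<dots> = (\<Prod>d\<in>D. x d powi mu d)"
    unfolding prod_dividef[symmetric] using x0 by (intro prod.cong) (simp_all add: power_int_nat)
  finally show ?thesis by (simp add: x_def)
qed

lemma prod_split_multiples:
  "finite D \<Longrightarrow> (\<Prod>d\<in>D. f d) = (\<Prod>d\<in>{d\<in>D. p dvd d}. f d) * (\<Prod>d\<in>{d\<in>D. \<not> p dvd d}. f d)"
  by (subst prod.union_disjoint[symmetric]) (auto intro!: prod.cong)

lemma sum_moebius_parts:
  assumes "p \<ge> 2" "k \<ge> 2"
  shows "(\<Sum>d\<in>{d\<in>{d. d dvd p * k}. p dvd d}. moebius (p * k div d)) = 0"
    and "(\<Sum>d\<in>{d\<in>{d. d dvd p * k}. \<not> p dvd d}. moebius (p * k div d)) = 0"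
proof -
  let ?D = "{d. d dvd p * k}"
  have fin: "finite ?D" using assms by simp
  have "(\<Sum>d | d dvd p * k \<and> p dvd d. moebius (p * k div d)) = (if p = p * k then 1 else 0)"
    using assms by (intro sum_moebius_multiples) auto
  then show m: "(\<Sum>d\<in>{d\<in>?D. p dvd d}. moebius (p * k div d)) = 0" using assms by simp
  have "(\<Sum>d | d dvd p * k \<and> 1 dvd d. moebius (p * k div d)) = (if 1 = p * k then 1 else 0)"
    using assms by (intro sum_moebius_multiples) auto
  then have "(\<Sum>d\<in>?D. moebius (p * k div d)) = 0" using assms by simp
  moreover have "(\<Sum>d\<in>?D. moebius (p * k div d)) = (\<Sum>d\<in>{d\<in>?D. p dvd d}. moebius (p * k div d))
      + (\<Sum>d\<in>{d\<in>?D. \<not> p dvd d}. moebius (p * k div d))"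
    using fin by (subst sum.union_disjoint[symmetric]) (auto intro!: sum.cong)
  ultimately show "(\<Sum>d\<in>{d\<in>?D. \<not> p dvd d}. moebius (p * k div d)) = 0" using m by simp
qed

text \<open>The factors with \<open>p dvd d\<close> all vanish at \<open>c\<close>. They share the
  factor \<open>mis_W (Suc t) p\<close>, whose total exponent is 0 since \<open>k \<ge> 2\<close>;
  once it is cancelled in the fraction field, the quotients \<open>mis_Q\<close> can be
  evaluated.\<close>

lemma prim_part_eval:
  assumes p: "p \<ge> 2" and k: "k \<ge> 2" and per: "exact_period c t p"
  shows "poly (of_int_poly (prim_part t (p * k))) c
    = (\<Prod>j | j dvd k. (\<Sum>i<j. (2 ^ p * poly (cyc p (Suc t)) c) ^ i) powi moebius (k div j))
      * (\<Prod>d\<in>{d\<in>{d. d dvd p * k}. \<not> p dvd d}. poly (of_int_poly (mis_W (Suc t) d)) c powi moebius (p * k div d))"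
proof -
  define n where "n = p * k"
  define D where "D = {d. d dvd n}"
  define V where "V d = (if p dvd d then mis_Q t p (d div p) else mis_W (Suc t) d)" for d
  have n: "n \<ge> 1" using p k by (simp add: n_def)
  have fin: "finite D" using n by (simp add: D_def)
  have pos: "d \<ge> 1" if "d \<in> D" for d using that n by (cases d) (auto simp: D_def)
  have Wp: "poly (of_int_poly (mis_W (Suc t) p)) c = 0" using exact_period_root_iff[OF per, of p] p by simp
  have W: "mis_W (Suc t) d = (if p dvd d then mis_W (Suc t) p else 1) * V d" if d: "d \<in> D" for d
  proof (cases "p dvd d")
    case True
    then obtain j where j: "d = p * j" by (elim dvdE)
    then have "j \<ge> 1" using pos[OF d] by (cases j) auto
    then show ?thesis using mis_W_multiple[of p j t] p by (simp add: V_def j)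
  qed (simp add: V_def)
  have V0: "poly (of_int_poly (V d)) c \<noteq> 0" if d: "d \<in> D" for d
  proof (cases "p dvd d")
    case True
    then obtain j where j: "d = p * j" by (elim dvdE)
    then have "j \<ge> 1" using pos[OF d] by (cases j) auto
    then show ?thesis using mis_Q_nonzero_at[OF _ Wp] p by (simp add: V_def j)
  next
    case False
    then show ?thesis using exact_period_root_iff[OF per pos[OF d]] by (simp add: V_def)
  qed
  have "to_fract (prim_part t n) = (\<Prod>d\<in>D. to_fract (mis_W (Suc t) d) powi moebius (n div d))"
    unfolding D_def by (rule prim_part(2)[OF n])
  also have "\<dots> = (\<Prod>d\<in>D. to_fract (if p dvd d then mis_W (Suc t) p else 1) powi moebius (n div d)
      * to_fract (V d) powi moebius (n div d))"
    using W by (intro prod.cong) (simp_all add: power_int_mult_distrib)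
  also have "\<dots> = (\<Prod>d\<in>D. to_fract (if p dvd d then mis_W (Suc t) p else 1) powi moebius (n div d))
      * (\<Prod>d\<in>D. to_fract (V d) powi moebius (n div d))" by (rule prod.distrib)
  also have "(\<Prod>d\<in>D. to_fract (if p dvd d then mis_W (Suc t) p else 1) powi moebius (n div d))
      = (\<Prod>d\<in>{d\<in>D. p dvd d}. to_fract (mis_W (Suc t) p) powi moebius (n div d))"
    using fin by (intro prod.mono_neutral_cong_right) auto
  also have "\<dots> = 1"
    using mis_W_nonzero[of p t] p sum_moebius_parts(1)[OF p k] by (subst prod_powi_sum) (simp_all add: D_def n_def)
  finally have "to_fract (prim_part t n) = (\<Prod>d\<in>D. to_fract (V d) powi moebius (n div d))" by simp
  from fract_prod_eval[OF fin V0 this]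
  have "poly (of_int_poly (prim_part t n)) c = (\<Prod>d\<in>D. poly (of_int_poly (V d)) c powi moebius (n div d))" .
  also have "\<dots> = (\<Prod>d\<in>{d\<in>D. p dvd d}. poly (of_int_poly (V d)) c powi moebius (n div d))
      * (\<Prod>d\<in>{d\<in>D. \<not> p dvd d}. poly (of_int_poly (V d)) c powi moebius (n div d))"
    by (rule prod_split_multiples[OF fin])
  also have "(\<Prod>d\<in>{d\<in>D. \<not> p dvd d}. poly (of_int_poly (V d)) c powi moebius (n div d))
      = (\<Prod>d\<in>{d\<in>D. \<not> p dvd d}. poly (of_int_poly (mis_W (Suc t) d)) c powi moebius (n div d))"
    by (intro prod.cong) (auto simp: V_def)
  also have "(\<Prod>d\<in>{d\<in>D. p dvd d}. poly (of_int_poly (V d)) c powi moebius (n div d))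
      = (\<Prod>j | j dvd k. (\<Sum>i<j. (2 ^ p * poly (cyc p (Suc t)) c) ^ i) powi moebius (k div j))"
    by (rule prod.reindex_bij_witness[where i = "\<lambda>j. p * j" and j = "\<lambda>d. d div p"])
      (use p Wp in \<open>auto simp: D_def n_def V_def poly_mis_Q\<close>)
  finally show ?thesis unfolding n_def D_def .
qed

lemma power_minus_1_factor:
  assumes "j \<ge> 1"
  shows "x ^ j - 1 = (\<Prod>z | z ^ j = 1. x - (z :: complex))"
proof -
  define P :: "complex poly" where "P = monom 1 j - 1"
  have roots: "poly P z = 0 \<longleftrightarrow> z ^ j = 1" for z by (simp add: P_def poly_monom)
  have "coeff P j = 1" using assms by (simp add: P_def)
  moreover have "degree P = j"
  proof (rule antisym)
    show "degree P \<le> j" unfolding P_def by (intro degree_diff_le) (simp_all add: degree_monom_le)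
    show "j \<le> degree P" using \<open>coeff P j = 1\<close> by (intro le_degree) simp
  qed
  ultimately have lc: "lead_coeff P = 1" by simp
  have "poly (pderiv P) z \<noteq> 0" if "z ^ j = 1" for z
  proof -
    have "z \<noteq> 0" using that assms by (auto simp: power_0_left)
    then show ?thesis using assms by (simp add: P_def pderiv_diff pderiv_monom poly_monom)
  qed
  then have "rsquarefree P" unfolding rsquarefree_roots roots by blast
  then have "P = (\<Prod>z | z ^ j = 1. [:- z, 1:])"
    using complex_poly_decompose_rsquarefree[of P] lc unfolding roots by simp
  then have "poly P x = poly (\<Prod>z | z ^ j = 1. [:- z, 1:]) x" by (simp only:)
  then show ?thesis by (simp add: poly_prod P_def poly_monom)
qed

lemma prod_powi: "(\<Prod>i\<in>A. f i) powi (a :: int) = (\<Prod>i\<in>A. f i powi a :: complex)"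
  by (induction A rule: infinite_finite_induct) (simp_all add: power_int_mult_distrib)

text \<open>Moebius inversion of \<open>x ^ j - 1 = (\<Prod>d dvd j. \<Phi>\<^sub>d x)\<close>.\<close>

lemma cyclotomic_moebius:
  assumes k: "k \<ge> 2" and x: "\<And>j. j \<ge> 1 \<Longrightarrow> x ^ j \<noteq> 1"
  shows "(\<Prod>j | j dvd k. (\<Sum>i<j. x ^ i) powi moebius (k div j)) = (\<Prod>z\<in>prim_roots k. x - z)"
proof -
  define phi where "phi d = (\<Prod>z\<in>prim_roots d. x - z)" for d
  let ?D = "{j. j dvd k}"
  have fin: "finite ?D" using k by simp
  have pos: "j \<ge> 1" if "j dvd k" for j using that k by (cases j) auto
  have x1: "x - 1 \<noteq> 0" using x[of 1] by simp
  have fac: "x ^ j - 1 = (\<Prod>d | d dvd j. phi d)" if j: "j \<ge> 1" for j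
  proof -
    have fj: "finite {d. d dvd j}" using j by simp
    have jp: "0 < j" using j by simp
    have "x ^ j - 1 = (\<Prod>z\<in>(\<Union>d\<in>{d. d dvd j}. prim_roots d). x - z)"
      unfolding power_minus_1_factor[OF j] roots_unity_decomp(1)[OF jp] ..
    also have "\<dots> = (\<Prod>d | d dvd j. phi d)" unfolding phi_def
    proof (rule prod.UNION_disjoint[OF fj])
      show "\<forall>i\<in>{d. d dvd j}. finite (prim_roots i)"
      proof
        fix i assume "i \<in> {d. d dvd j}"
        then have "i > 0" using jp by (auto intro: Nat.gr0I)
        then show "finite (prim_roots i)" by simp
      qed
      show "\<forall>i\<in>{d. d dvd j}. \<forall>l\<in>{d. d dvd j}. i \<noteq> l \<longrightarrow> prim_roots i \<inter> prim_roots l = {}"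
        using roots_unity_decomp(2)[OF jp] by simp
    qed
    finally show ?thesis .
  qed
  have phi0: "phi d \<noteq> 0" if "d dvd k" for d
  proof -
    have "x ^ d - 1 \<noteq> 0" using x[OF pos[OF that]] by simp
    moreover have "finite {e. e dvd d}" using pos[OF that] by simp
    ultimately show ?thesis unfolding fac[OF pos[OF that]] by (simp add: prod_zero_iff)
  qed
  have tot: "(\<Sum>j\<in>?D. moebius (k div j)) = 0"
    using sum_moebius_multiples[of k 1] k by simp
  have "(\<Prod>j\<in>?D. (\<Sum>i<j. x ^ i) powi moebius (k div j))
      = (\<Prod>j\<in>?D. (x ^ j - 1) powi moebius (k div j) / (x - 1) powi moebius (k div j))"
  proof (intro prod.cong refl)
    fix j
    have "(\<Sum>i<j. x ^ i) = (x ^ j - 1) / (x - 1)"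
      using x1 power_diff_1_eq[of x j] by (simp add: field_simps)
    then show "(\<Sum>i<j. x ^ i) powi moebius (k div j)
        = (x ^ j - 1) powi moebius (k div j) / (x - 1) powi moebius (k div j)"
      by (simp add: power_int_divide_distrib)
  qed
  also have "\<dots> = (\<Prod>j\<in>?D. (x ^ j - 1) powi moebius (k div j))"
    unfolding prod_dividef prod_powi_sum[OF x1] tot by simp
  also have "\<dots> = (\<Prod>j\<in>?D. \<Prod>d\<in>?D. if d dvd j then phi d powi moebius (k div j) else 1)"
  proof (intro prod.cong refl)
    fix j assume j: "j \<in> ?D"
    have "(x ^ j - 1) powi moebius (k div j) = (\<Prod>d | d dvd j. phi d powi moebius (k div j))"
      using j pos by (simp add: fac prod_powi)
    also have "\<dots> = (\<Prod>d\<in>?D. if d dvd j then phi d powi moebius (k div j) else 1)"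
      using fin j by (intro prod.mono_neutral_cong_left) (auto intro: dvd_trans)
    finally show "(x ^ j - 1) powi moebius (k div j)
        = (\<Prod>d\<in>?D. if d dvd j then phi d powi moebius (k div j) else 1)" .
  qed
  also have "\<dots> = (\<Prod>d\<in>?D. \<Prod>j\<in>?D. if d dvd j then phi d powi moebius (k div j) else 1)"
    by (rule prod.swap)
  also have "\<dots> = (\<Prod>d\<in>?D. if d = k then phi d else 1)"
  proof (intro prod.cong refl)
    fix d assume d: "d \<in> ?D"
    have "(\<Prod>j\<in>?D. if d dvd j then phi d powi moebius (k div j) else 1)
        = (\<Prod>j | j dvd k \<and> d dvd j. phi d powi moebius (k div j))"
      using fin by (intro prod.mono_neutral_cong_right) auto
    also have "\<dots> = phi d powi (if d = k then 1 else 0)"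
      using phi0 d pos[of d] k sum_moebius_multiples[of k d] by (subst prod_powi_sum) auto
    finally show "(\<Prod>j\<in>?D. if d dvd j then phi d powi moebius (k div j) else 1)
        = (if d = k then phi d else 1)" by simp
  qed
  also have "\<dots> = phi k" using fin by simp
  finally show ?thesis by (simp add: phi_def)
qed

text \<open>Each \<open>a d\<close> is associated to \<open>a p\<close> or to \<open>a 1\<close>,
  according to whether \<open>p\<close> divides \<open>d\<close>, and the exponents add up to 0
  within each of the two classes.\<close>

lemma crit_prim_part_unit:
  assumes p: "prime p" and k: "k \<ge> 2" and c: "algebraic_int c"
    and W: "poly (of_int_poly (mis_W (Suc t) p)) c = 0"
    and dvd: "p * k dvd t" and t: "poly (cit t) c \<noteq> 0"
  shows "algebraic_unit (poly (of_int_poly (prim_part 0 (p * k))) c)"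
proof -
  define D where "D = {d. d dvd p * k}"
  have p2: "p \<ge> 2" using p by (rule prime_ge_2_nat)
  have fin: "finite D" using p2 k by (simp add: D_def)
  have nz: "poly (cit d) c \<noteq> 0" if "d \<in> D" for d
  proof -
    have "d dvd t" using that dvd unfolding D_def by (auto intro: dvd_trans)
    moreover have "d \<ge> 1" using that p2 k by (cases d) (auto simp: D_def)
    ultimately have "crit_iter d dvd crit_iter t" by (intro crit_iter_dvd)
    then show ?thesis using t unfolding cit_def by (auto elim!: dvdE simp: hom_distribs)
  qed
  have assoc: "\<exists>u. algebraic_unit u \<and> poly (cit d) c = poly (cit (gcd p d)) c * u" if d: "d \<in> D" for d
  proof (rule cit_associated[OF c W])
    show "p \<ge> 1" using p2 by simp
    show "d \<ge> 1" using d p2 k by (cases d) (auto simp: D_def)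
    show "d dvd t" using d dvd unfolding D_def by (auto intro: dvd_trans)
    have "gcd p d \<in> D" using d unfolding D_def by (auto intro: dvd_trans)
    then show "poly (cit (gcd p d)) c \<noteq> 0" by (rule nz)
  qed
  have "poly (of_int_poly (prim_part 0 (p * k))) c
      = (\<Prod>d\<in>D. poly (of_int_poly (mis_W (Suc 0) d)) c powi moebius (p * k div d))"
  proof (rule fract_prod_eval[OF fin])
    show "poly (of_int_poly (mis_W (Suc 0) d)) c \<noteq> 0" if "d \<in> D" for d
      using nz[OF that] by (simp add: poly_mis_W)
    show "to_fract (prim_part 0 (p * k)) = (\<Prod>d\<in>D. to_fract (mis_W (Suc 0) d) powi moebius (p * k div d))"
      unfolding D_def using p2 k by (intro prim_part(2)) simp
  qed
  also have "\<dots> = (\<Prod>d\<in>D. poly (cit d) c powi moebius (p * k div d))"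
    by (simp add: poly_mis_W)
  also have "\<dots> = (\<Prod>d\<in>{d\<in>D. p dvd d}. poly (cit d) c powi moebius (p * k div d))
      * (\<Prod>d\<in>{d\<in>D. \<not> p dvd d}. poly (cit d) c powi moebius (p * k div d))"
    by (rule prod_split_multiples[OF fin])
  also have "algebraic_unit \<dots>"
  proof (rule algebraic_unit_mult)
    show "algebraic_unit (\<Prod>d\<in>{d\<in>D. p dvd d}. poly (cit d) c powi moebius (p * k div d))"
    proof (rule algebraic_unit_prod_powi[where x = "poly (cit p) c"])
      show "poly (cit p) c \<noteq> 0" by (rule nz) (simp add: D_def)
      show "\<exists>u. algebraic_unit u \<and> poly (cit d) c = poly (cit p) c * u" if "d \<in> {d\<in>D. p dvd d}" for d
      proof -
        have "gcd p d = p" "d \<in> D" using that by (simp_all add: gcd_nat.absorb1)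
        then show ?thesis using assoc[of d] by simp
      qed
    qed (use sum_moebius_parts(1)[OF p2 k] in \<open>simp add: D_def\<close>)
    show "algebraic_unit (\<Prod>d\<in>{d\<in>D. \<not> p dvd d}. poly (cit d) c powi moebius (p * k div d))"
    proof (rule algebraic_unit_prod_powi[where x = "poly (cit 1) c"])
      show "poly (cit 1) c \<noteq> 0" by (rule nz) (simp add: D_def)
      show "\<exists>u. algebraic_unit u \<and> poly (cit d) c = poly (cit 1) c * u" if d: "d \<in> {d\<in>D. \<not> p dvd d}" for d
      proof -
        have "coprime p d" using p d by (simp add: prime_imp_coprime)
        then have "gcd p d = 1" by (simp add: coprime_iff_gcd_eq_1)
        then show ?thesis using assoc[of d] d by simp
      qed
    qed (use sum_moebius_parts(2)[OF p2 k] in \<open>simp add: D_def\<close>)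
  qed
  finally show ?thesis .
qed

theorem misiurewicz_unit_multiplier:
  assumes p: "prime p" and k: "k \<ge> 2"
    and root: "poly (of_int_poly (misiurewicz_poly (Suc t) p)) c = 0"
    and unit: "algebraic_unit (poly (of_int_poly (misiurewicz_poly (Suc t) (p * k))) c)"
  shows "algebraic_unit (\<Prod>z\<in>prim_roots k. 2 ^ p * poly (cyc p (Suc t)) c - z)"
proof -
  have p2: "p \<ge> 2" using p by (rule prime_ge_2_nat)
  have k0: "k > 0" using k by simp
  have per: "exact_period c t p" using root p2 by (intro misiurewicz_root_exact_period) auto
  have W: "poly (of_int_poly (mis_W (Suc t) p)) c = 0" using exact_period_root_iff[OF per, of p] p2 by simp
  have c: "algebraic_int c" using W p2 by (intro algebraic_int_root_mis_W[of p t c]) auto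
  show ?thesis
  \<comment> \<open>If \<open>a t = 0\<close>, the cycle passes through 0 and the multiplier is 0,
    so every factor of the product is minus a root of unity. Otherwise
    \<open>crit_prim_part_unit\<close> controls the correcting factor.\<close>
  proof (cases "poly (cit t) c = 0")
    case True
    then have "poly (cit (t + p)) c = 0" using W by (simp add: poly_mis_W)
    moreover have "Suc t + (p - 1) = t + p" using p2 by simp
    ultimately have "poly (cyc p (Suc t)) c = 0" unfolding cyc_def poly_prod
      using p2 by (intro prod_zero[of _ _] bexI[of _ "p - 1"]) auto
    moreover have "algebraic_unit (- z)" if "z \<in> prim_roots k" for z
    proof -
      have "algebraic_unit (- 1)" by (rule algebraic_unitI[of _ "- 1"]) auto
      then have "algebraic_unit (- 1 * z)" by (rule algebraic_unit_mult) (rule algebraic_unit_prim_root[OF that k0])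
      then show ?thesis by simp
    qed
    ultimately show ?thesis by (auto intro: algebraic_unit_prod)
  next
    case False
    define l where "l = 2 ^ p * poly (cyc p (Suc t)) c"
    define U where "U = (\<Prod>d\<in>{d\<in>{d. d dvd p * k}. \<not> p dvd d}.
        poly (of_int_poly (mis_W (Suc t) d)) c powi moebius (p * k div d))"
    have l: "l ^ j \<noteq> 1" if "j \<ge> 1" for j
      unfolding l_def using c that p2 by (intro geometric_nonzero(2) algebraic_int_cyc) auto
    have U: "algebraic_unit U" unfolding U_def
    proof (rule algebraic_unit_prod_powi[where x = "poly (of_int_poly (mis_W (Suc t) 1)) c"])
      have "\<not> p dvd 1" using p2 by simp
      then show "poly (of_int_poly (mis_W (Suc t) 1)) c \<noteq> 0"
        using exact_period_root_iff[OF per, of 1] by simp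
      show "\<exists>u. algebraic_unit u \<and>
          poly (of_int_poly (mis_W (Suc t) d)) c = poly (of_int_poly (mis_W (Suc t) 1)) c * u"
        if "d \<in> {d\<in>{d. d dvd p * k}. \<not> p dvd d}" for d
        using that p2 k by (intro mis_W_associated[OF p per c]) (cases d, auto)
    qed (rule sum_moebius_parts(2)[OF p2 k])
    have cm: "(\<Prod>j | j dvd k. (\<Sum>i<j. l ^ i) powi moebius (k div j)) = (\<Prod>z\<in>prim_roots k. l - z)"
      by (rule cyclotomic_moebius[OF k]) (rule l)
    define E where "E = (if p * k dvd t then prim_part 0 (p * k) else 1)"
    have E: "algebraic_unit (poly (of_int_poly E) c)"
      using crit_prim_part_unit[OF p k c W _ False] by (simp add: E_def)
    have "poly (of_int_poly (prim_part t (p * k))) c = poly (of_int_poly (misiurewicz_poly (Suc t) (p * k))) c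
        * poly (of_int_poly E) c"
    proof -
      have "misiurewicz_poly (Suc t) (p * k) * E = prim_part t (p * k)"
        unfolding E_def using p2 k by (intro misiurewicz_poly(1)) simp
      then show ?thesis by (metis of_int_poly_hom.hom_mult poly_mult)
    qed
    moreover have "poly (of_int_poly (prim_part t (p * k))) c = (\<Prod>z\<in>prim_roots k. l - z) * U"
      unfolding prim_part_eval[OF p2 k per] U_def l_def[symmetric] cm ..
    ultimately have e: "(\<Prod>z\<in>prim_roots k. l - z) * U
        = poly (of_int_poly (misiurewicz_poly (Suc t) (p * k))) c * poly (of_int_poly E) c" by simp
    then have "(\<Prod>z\<in>prim_roots k. l - z)
        = poly (of_int_poly (misiurewicz_poly (Suc t) (p * k))) c * poly (of_int_poly E) c * inverse U"
      using algebraic_unit_nonzero[OF U] by (simp add: e[symmetric] mult.assoc)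
    also have "algebraic_unit \<dots>" by (intro algebraic_unit_mult algebraic_unit_inverse unit E U)
    finally show ?thesis unfolding l_def .
  qed
qed

section \<open>Exchanging the roles of the two irreducible polynomials\<close>

lemma algebraic_unit_reciprocal:
  assumes "algebraic_int v" "poly (of_int_poly F) c * v = (1 :: complex)"
  obtains H :: "int poly" where "poly (of_int_poly H) c = v"
proof -
  define u where "u = poly (of_int_poly F) c"
  have uv: "u * v = 1" using assms(2) by (simp add: u_def)
  obtain q :: "int poly" where q: "poly (of_int_poly q) v = 0" "monic q"
    using assms(1) unfolding algebraic_int_altdef_ipoly by blast
  have "degree q \<noteq> 0"
  proof
    assume "degree q = 0"
    then have "q = 1" using q(2) by (metis monic_degree_0)
    then show False using q(1) by simp
  qed
  then obtain d where d: "degree q = Suc d" by (cases "degree q") auto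
  \<comment> \<open>Multiplying the monic equation of \<open>v = 1 / u\<close> by
    \<open>u ^ d\<close> leaves \<open>v\<close> in the top term and powers of \<open>u\<close> in
    all others.\<close>
  have "0 = u ^ d * poly (of_int_poly q) v" by (simp add: q(1))
  also have "\<dots> = (\<Sum>i\<le>Suc d. of_int (coeff q i) * (u ^ d * v ^ i))"
    unfolding poly_altdef sum_distrib_left by (simp add: d mult_ac del: sum.atMost_Suc)
  also have "\<dots> = (\<Sum>i\<le>d. of_int (coeff q i) * (u ^ d * v ^ i)) + u ^ d * v ^ Suc d"
    using q(2) by (simp add: d)
  also have "u ^ d * v ^ Suc d = v * (u * v) ^ d" by (simp add: power_mult_distrib)
  also have "(\<Sum>i\<le>d. of_int (coeff q i) * (u ^ d * v ^ i)) = (\<Sum>i\<le>d. of_int (coeff q i) * u ^ (d - i))"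
  proof (intro sum.cong refl)
    fix i assume "i \<in> {..d}"
    then have "u ^ d * v ^ i = u ^ (d - i) * (u * v) ^ i"
      by (simp add: power_mult_distrib power_add[symmetric])
    then show "of_int (coeff q i) * (u ^ d * v ^ i) = of_int (coeff q i) * u ^ (d - i)" by (simp add: uv)
  qed
  finally have "v = - (\<Sum>i\<le>d. of_int (coeff q i) * u ^ (d - i))" by (simp add: uv eq_neg_iff_add_eq_0 add.commute)
  also have "\<dots> = poly (of_int_poly (- (\<Sum>i\<le>d. Polynomial.smult (coeff q i) (F ^ (d - i))))) c"
    by (simp add: u_def hom_distribs poly_sum)
  finally show ?thesis using that by metis
qed

text \<open>A nonzero rational polynomial \<open>P\<close> of least degree vanishing at
  \<open>c\<close> divides every other one. It divides the irreducible \<open>G\<close> and is not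
  constant, so \<open>G\<close> divides \<open>P\<close> and hence \<open>R\<close>, against the
  degrees.\<close>

lemma irreducible_root_degree:
  fixes G R :: "int poly" and c :: complex
  assumes G: "irreducible (of_int_poly G :: rat poly)" "poly (of_int_poly G) c = 0"
    and R: "poly (of_int_poly R) c = 0" "degree R < degree G"
  shows "R = 0"
proof (rule ccontr)
  assume "R \<noteq> 0"
  let ?G = "of_int_poly G :: rat poly" and ?R = "of_int_poly R :: rat poly"
  have ndvd: "\<not> ?G dvd ?R" using dvd_imp_degree_le[of ?G ?R] R(2) \<open>R \<noteq> 0\<close> by auto
  interpret h: map_poly_comm_ring_hom "of_rat :: rat \<Rightarrow> complex" ..
  define ev where "ev P = poly (map_poly of_rat P) c" for P :: "rat poly"
  have ev_int: "ev (of_int_poly P) = poly (of_int_poly P) c" for P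
    by (simp add: ev_def map_poly_map_poly o_def)
  have ev_add: "ev (A + B) = ev A + ev B" and ev_mult: "ev (A * B) = ev A * ev B" for A B
    unfolding ev_def by (simp_all add: h.hom_add h.hom_mult)
  have "?R \<noteq> 0 \<and> ev ?R = 0" using \<open>R \<noteq> 0\<close> R(1) by (simp add: ev_int)
  from ex_has_least_nat[of "\<lambda>P. P \<noteq> 0 \<and> ev P = 0", OF this, of degree]
  obtain P where P: "P \<noteq> 0" "ev P = 0" "\<And>Q. Q \<noteq> 0 \<and> ev Q = 0 \<Longrightarrow> degree P \<le> degree Q" by blast
  have min: "P dvd Q" if "ev Q = 0" for Q
  proof (rule ccontr)
    assume "\<not> P dvd Q"
    then have nz: "Q mod P \<noteq> 0" by (simp add: dvd_eq_mod_eq_0)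
    have "ev (Q div P * P + Q mod P) = 0" using that by simp
    then have "ev (Q mod P) = 0" unfolding ev_add ev_mult P(2) by simp
    then have "degree P \<le> degree (Q mod P)" using nz P(3) by blast
    then show False using degree_mod_less'[OF P(1) nz] by simp
  qed
  have "P dvd ?G" "P dvd ?R" using G(2) R(1) by (simp_all add: min ev_int)
  moreover have "\<not> is_unit P"
  proof
    assume "is_unit P"
    then obtain X where "1 = P * X" by (elim dvdE)
    then have "ev 1 = 0" using ev_mult[of P X] P(2) by simp
    then show False by (simp add: ev_def)
  qed
  ultimately have "?G dvd P" using irreducibleD'[OF G(1)] by blast
  then show False using \<open>P dvd ?R\<close> ndvd dvd_trans by blast
qed

theorem irreducible_unit_transfer:
  fixes F G :: "int poly"
  assumes G: "monic G" "irreducible (of_int_poly G :: rat poly)" "poly (of_int_poly G) c0 = 0"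
    and F: "monic F" "poly (of_int_poly F) c1 = 0"
    and unit: "algebraic_unit (poly (of_int_poly F) c0)"
  shows "algebraic_unit (poly (of_int_poly G) c1)"
proof -
  obtain v where v: "algebraic_int v" "poly (of_int_poly F) c0 * v = 1"
    using unit unfolding algebraic_unit_def by blast
  obtain H where H: "poly (of_int_poly H) c0 = v" by (rule algebraic_unit_reciprocal[OF v])
  \<comment> \<open>\<open>F * H - 1\<close> vanishes at \<open>c0\<close>. Division by the monic
    \<open>G\<close> stays in Z[X], which makes the cofactor \<open>K\<close> integral at
    \<open>c1\<close> as well.\<close>
  obtain K R where KR: "F * H - 1 = G * K + R" "R = 0 \<or> degree R < degree G"
    by (rule monic_division[OF G(1)])
  have ev: "poly (of_int_poly F) c * poly (of_int_poly H) c - 1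
      = poly (of_int_poly G) c * poly (of_int_poly K) c + poly (of_int_poly R) c" for c :: complex
    using arg_cong[OF KR(1), of "\<lambda>P. poly (of_int_poly P) c"] by (simp add: hom_distribs)
  have "poly (of_int_poly R) c0 = 0" using ev[of c0] by (simp add: H v(2) G(3))
  then have "R = 0" using KR(2) irreducible_root_degree[OF G(2,3)] by blast
  then have "poly (of_int_poly G) c1 * poly (of_int_poly K) c1 = - 1" using ev[of c1] F(2) by simp
  then have "poly (of_int_poly G) c1 * - poly (of_int_poly K) c1 = 1" by (simp only: mult_minus_right minus_minus)
  moreover have "algebraic_int c1" by (rule algebraic_int_monic_root[OF F])
  ultimately show ?thesis
    by (intro algebraic_unitI[of _ "- poly (of_int_poly K) c1"]) (auto intro: algebraic_int_poly_of_int)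
qed

lemma inverse_prim_roots: "bij_betw inverse (prim_roots k) (prim_roots k)"
  by (rule bij_betwI[where g = inverse]) (auto simp: prim_roots_def power_inverse)

lemma prod_prod_mset_swap: "(\<Prod>i\<in>A. \<Prod>z\<in>#M. f i z) = (\<Prod>z\<in>#M. \<Prod>i\<in>A. f i z :: complex)"
  by (induction M) (simp_all add: prod.distrib)

text \<open>Inversion permutes the primitive roots, and the factors \<open>- w\<close> that it costs
  are units. The new form is the one in which \<open>eps\<close> of the multipliers appears.\<close>

lemma unit_reciprocal_form:
  assumes k: "k > 0" and unit: "algebraic_unit (\<Prod>w\<in>prim_roots k. l - w)"
  shows "algebraic_unit (\<Prod>w\<in>prim_roots k. 1 - l * w)"
proof -
  have "(\<Prod>w\<in>prim_roots k. 1 - l * w) = (\<Prod>w\<in>prim_roots k. (- 1 * w) * (l - inverse w))"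
  proof (rule prod.cong)
    fix w assume "w \<in> prim_roots k"
    then have "w \<noteq> 0" using algebraic_unit_nonzero[OF algebraic_unit_prim_root] k by blast
    then show "1 - l * w = (- 1 * w) * (l - inverse w)" by (simp add: algebra_simps)
  qed simp
  also have "\<dots> = (\<Prod>w\<in>prim_roots k. - 1 * w) * (\<Prod>w\<in>prim_roots k. l - w)"
    unfolding prod.distrib using prod.reindex_bij_betw[OF inverse_prim_roots, of "\<lambda>w. l - w" k] by simp
  also have "algebraic_unit \<dots>"
  proof (rule algebraic_unit_mult[OF algebraic_unit_prod unit])
    have "algebraic_unit (- 1)" by (rule algebraic_unitI[of _ "- 1"]) auto
    then show "algebraic_unit (- 1 * w)" if "w \<in> prim_roots k" for w
      by (rule algebraic_unit_mult) (rule algebraic_unit_prim_root[OF that k])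
  qed
  finally show ?thesis .
qed

section \<open>Cycle products at the roots of the Misiurewicz polynomial\<close>

definition mis_vals :: "nat \<Rightarrow> nat \<Rightarrow> complex multiset" where
  "mis_vals p m = image_mset (poly (cyc p m)) (proots (of_int_poly (misiurewicz_poly m p)))"

lemma norm_eps_prim_roots:
  fixes Y :: "int poly"
  assumes k: "k > 0" and Y: "of_int_poly Y = eps M"
    and unit: "\<And>z. z \<in># M \<Longrightarrow> algebraic_unit (\<Prod>w\<in>prim_roots k. 2 ^ p * z - w)"
  shows "norm (\<Prod>w\<in>prim_roots k. poly (of_int_poly (pcompose Y [:0, 2 ^ p:])) w) = 1"
proof (rule algebraic_unit_rational)
  have e: "poly (of_int_poly (pcompose Y [:0, 2 ^ p:])) w = (\<Prod>z\<in>#M. 1 - (2 ^ p * z) * w)" for w :: complex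
  proof -
    have "poly (of_int_poly (pcompose Y [:0, 2 ^ p:])) w = poly (eps M) (2 ^ p * w)"
      by (simp add: of_int_hom.map_poly_pcompose of_int_hom.map_poly_pCons_hom poly_pcompose Y[symmetric] mult.commute)
    then show ?thesis by (simp add: poly_eps mult_ac)
  qed
  show "algebraic_unit (\<Prod>w\<in>prim_roots k. poly (of_int_poly (pcompose Y [:0, 2 ^ p:])) w)"
    unfolding e prod_prod_mset_swap
    by (rule algebraic_unit_prod_mset) (rule unit_reciprocal_form[OF k unit])
  show "(\<Prod>w\<in>prim_roots k. poly (of_int_poly (pcompose Y [:0, 2 ^ p:])) w) \<in> \<rat>"
    by (rule prod_prim_roots_rat[OF k]) simp
qed

lemma mis_vals_root:
  assumes "z \<in># mis_vals p m"
  obtains r where "poly (of_int_poly (misiurewicz_poly m p)) r = 0" "z = poly (cyc p m) r"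
proof -
  have "\<exists>r. r \<in># proots (of_int_poly (misiurewicz_poly m p)) \<and> z = poly (cyc p m) r"
    using assms unfolding mis_vals_def by auto
  then obtain r where r: "r \<in># proots (of_int_poly (misiurewicz_poly m p))" "z = poly (cyc p m) r" by blast
  then have "of_int_poly (misiurewicz_poly m p) \<noteq> (0 :: complex poly)" by auto
  then have "poly (of_int_poly (misiurewicz_poly m p)) r = 0" using r(1) by simp
  then show ?thesis using r(2) by (rule that)
qed

text \<open>Modulo 2 squaring is additive, so the \<open>k\<close>-th iterate of the map at
  \<open>x\<close> is congruent to \<open>x ^ (2 ^ k)\<close> plus its value at 0.\<close>

lemma crit_iter_shift: "\<exists>S. crit_iter (k + e) = crit_iter e ^ 2 ^ k + crit_iter k + (S + S)"
proof (induction k)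
  case (Suc k)
  then obtain S where S: "crit_iter (k + e) = crit_iter e ^ 2 ^ k + crit_iter k + (S + S)" by blast
  have sq: "(x + b + (s + s))\<^sup>2 + y = x\<^sup>2 + (b\<^sup>2 + y)
      + ((x * b + (s * x + s * x) + (s * b + s * b) + (s * s + s * s))
        + (x * b + (s * x + s * x) + (s * b + s * b) + (s * s + s * s)))" for x b s y :: "int poly"
    unfolding power2_eq_square by (simp add: algebra_simps)
  have "crit_iter e ^ 2 ^ Suc k = (crit_iter e ^ 2 ^ k)\<^sup>2"
    by (simp add: power_mult[symmetric] mult.commute)
  then show ?case unfolding add_Suc crit_iter_Suc S sq by (intro exI) (simp only:)
qed (auto intro: exI[of _ 0])

lemma eps_sum: "eps (\<Sum>i\<in>A. M i) = (\<Prod>i\<in>A. eps (M i))"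
  by (induction A rule: infinite_finite_induct) (simp_all add: eps_union)

lemma psum_sum: "psum (\<Sum>i\<in>A. M i) q = (\<Sum>i\<in>A. psum (M i) q)"
  by (induction A rule: infinite_finite_induct) simp_all

context
  fixes p :: nat
  assumes prime: "prime p"
begin

lemma p_ge_2: "p \<ge> 2" using prime by (rule prime_ge_2_nat)

lemma multiple_index: "\<exists>i<p. p dvd m + i"
proof (intro exI conjI)
  show "(p - m mod p) mod p < p" using p_ge_2 by simp
  have "(m + (p - m mod p) mod p) mod p = (m mod p + (p - m mod p)) mod p" by (rule mod_add_cong) simp_all
  also have "m mod p + (p - m mod p) = p" using p_ge_2 by (simp add: less_imp_le)
  finally show "p dvd m + (p - m mod p) mod p" unfolding dvd_eq_mod_eq_0 mod_self .
qed

text \<open>Among \<open>p\<close> consecutive indices one is a multiple of \<open>p\<close>, and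
  \<open>crit_iter p\<close> divides the iterate of that index.\<close>

lemma poly_cyc_factor:
  assumes "m \<ge> 1" "algebraic_int c"
  shows "\<exists>w. algebraic_int w \<and> poly (cyc p m) c = poly (cit p) c * w"
proof -
  obtain i where i: "i < p" "p dvd m + i" using multiple_index by blast
  then have "crit_iter p dvd crit_iter (m + i)" using p_ge_2 by (intro crit_iter_dvd) auto
  then obtain B where B: "crit_iter (m + i) = crit_iter p * B" by (elim dvdE)
  let ?w = "poly (of_int_poly B) c * (\<Prod>j\<in>{..<p} - {i}. poly (cit (m + j)) c)"
  have "poly (cyc p m) c = poly (cit (m + i)) c * (\<Prod>j\<in>{..<p} - {i}. poly (cit (m + j)) c)"
    unfolding cyc_def poly_prod using i by (intro prod.remove) auto
  also have "poly (cit (m + i)) c = poly (cit p) c * poly (of_int_poly B) c"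
    unfolding cit_def B by (simp add: hom_distribs)
  finally have "poly (cyc p m) c = poly (cit p) c * ?w" by (simp only: mult.assoc)
  moreover have "algebraic_int ?w"
    by (rule algebraic_int_mult[OF algebraic_int_poly_of_int[OF assms(2)] algebraic_int_prod])
      (rule algebraic_int_cit[OF assms(2)])
  ultimately show ?thesis by blast
qed

text \<open>\<open>E\<close> is the correcting factor in the case \<open>p dvd t\<close>. Its roots
  satisfy \<open>a p = 0\<close>, so they drop out of the sums of cycle products.\<close>

lemma mis_W_factor:
  "\<exists>E. monic E \<and> misiurewicz_poly (Suc t) p * E * mis_W (Suc t) 1 = mis_W (Suc t) p \<and>
    (\<forall>r :: complex. poly (of_int_poly E) r = 0 \<longrightarrow> poly (cit p) r = 0)"
proof -
  define E where "E = (if p dvd t then prim_part 0 p else 1)"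
  have p1: "p \<ge> 1" using p_ge_2 by simp
  have "misiurewicz_poly (Suc t) p * E = prim_part t p" unfolding E_def by (rule misiurewicz_poly(1)[OF p1])
  then have "misiurewicz_poly (Suc t) p * E * mis_W (Suc t) 1 = mis_W (Suc t) p"
    using prim_part_prime[OF prime] by simp
  moreover have "monic E" using prim_part(1)[OF p1, of 0] by (simp add: E_def)
  moreover have "poly (cit p) r = 0" if "poly (of_int_poly E) r = 0" for r :: complex
  proof -
    have "poly (of_int_poly (prim_part 0 p)) r = 0" using that by (auto simp: E_def split: if_splits)
    moreover have "prim_part 0 p * crit_iter 1 = crit_iter p" using prim_part_prime[OF prime, of 0] by (simp only: mis_W_1)
    ultimately show ?thesis unfolding cit_def
      by (metis mult_zero_left of_int_poly_hom.hom_mult poly_mult)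
  qed
  ultimately show ?thesis by (intro exI[of _ E] conjI allI impI)
qed

text \<open>Among the roots of \<open>mis_W (Suc t) p\<close>, those of \<open>E\<close> contribute
  0. At those of \<open>mis_W (Suc t) 1\<close> the cycle is a fixed point run through
  \<open>p\<close> times, so its product is a \<open>p\<close>-th power.\<close>

lemma psum_mis_vals:
  assumes q: "q \<ge> 1"
  shows "psum (mis_vals p (Suc t)) q = cyc_sum p (Suc t) q - cyc_sum 1 (Suc t) (p * q)"
proof -
  let ?c = "of_int_poly :: int poly \<Rightarrow> complex poly" and ?F = "misiurewicz_poly (Suc t) p"
  let ?g = "cyc p (Suc t) ^ q"
  have p1: "p \<ge> 1" using p_ge_2 by simp
  obtain E where E: "monic E" "?F * E * mis_W (Suc t) 1 = mis_W (Suc t) p"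
    "\<And>r :: complex. poly (?c E) r = 0 \<Longrightarrow> poly (cit p) r = 0" using mis_W_factor[of t] by (elim exE conjE) blast
  have F: "monic ?F" by (rule misiurewicz_poly(2)[OF p1])
  have nz: "?c ?F \<noteq> 0" "?c E \<noteq> 0" "critF 1 (Suc t) \<noteq> 0"
    using F E(1) monic_critF(1)[of 1 "Suc t"] by auto
  have "critF p (Suc t) = ?c ?F * ?c E * critF 1 (Suc t)"
    unfolding critF_mis_W E(2)[symmetric] by (simp add: hom_distribs)
  then have "cyc_sum p (Suc t) q = root_sum (?c ?F) ?g + root_sum (?c E) ?g + root_sum (critF 1 (Suc t)) ?g"
    using nz by (simp add: cyc_sum_def root_sum_mult)
  moreover have "root_sum (?c ?F) ?g = psum (mis_vals p (Suc t)) q"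
    unfolding mis_vals_def by (rule root_sum_power)
  moreover have "root_sum (?c E) ?g = 0"
  proof (rule root_sum_eq_0[OF _ nz(2)])
    fix r assume r: "poly (?c E) r = 0"
    have "algebraic_int r" by (rule algebraic_int_monic_root[OF E(1) r])
    then have "poly (cyc p (Suc t)) r = 0" using poly_cyc_factor[of "Suc t" r] E(3)[OF r] by auto
    then show "poly ?g r = 0" using q by (simp add: poly_power)
  qed
  moreover have "root_sum (critF 1 (Suc t)) ?g = cyc_sum 1 (Suc t) (p * q)"
    unfolding cyc_sum_def
  proof (rule root_sum_cong)
    fix r assume "poly (critF 1 (Suc t)) r = 0"
    then have W: "poly (of_int_poly (mis_W (Suc t) 1)) r = 0" unfolding critF_mis_W .
    have "poly (cit (Suc t + i)) r = poly (cit (Suc t)) r" for i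
      using poly_cit_periodic[OF W, of 1 i] by simp
    then show "poly ?g r = poly (cyc 1 (Suc t) ^ (p * q)) r"
      by (simp add: cyc_def poly_prod power_mult)
  qed (rule nz)
  ultimately show ?thesis by simp
qed

text \<open>\<open>a (t + p) = - a t\<close>, while \<open>a (t + p)\<close> is congruent to
  \<open>a p ^ (2 ^ t) + a t\<close> modulo 2. Hence 2 divides a power of \<open>a p\<close>, and
  \<open>a p\<close> divides the cycle product.\<close>

lemma rad2_mis_vals:
  assumes "z \<in># mis_vals p (Suc t)"
  shows "rad2 z"
proof -
  obtain r where r: "poly (of_int_poly (misiurewicz_poly (Suc t) p)) r = 0" "z = poly (cyc p (Suc t)) r"
    by (rule mis_vals_root[OF assms])
  have p1: "p \<ge> 1" using p_ge_2 by simp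
  obtain E where E: "misiurewicz_poly (Suc t) p * E * mis_W (Suc t) 1 = mis_W (Suc t) p"
    using mis_W_factor[of t] by (elim exE conjE)
  have W: "poly (of_int_poly (mis_W (Suc t) p)) r = 0" unfolding E[symmetric] using r(1) by (simp add: hom_distribs)
  have alg: "algebraic_int r" by (rule algebraic_int_root_mis_W[OF p1 W])
  define A where "A i = poly (cit i) r" for i
  obtain S where "crit_iter (t + p) = crit_iter p ^ 2 ^ t + crit_iter t + (S + S)" using crit_iter_shift by blast
  then have "A (t + p) = A p ^ 2 ^ t + A t + 2 * poly (of_int_poly S) r"
    by (simp add: A_def cit_def hom_distribs)
  then have "A p ^ 2 ^ t = A (t + p) - A t - 2 * poly (of_int_poly S) r" by simp
  moreover have "A (t + p) = - A t" using W by (simp add: poly_mis_W A_def eq_neg_iff_add_eq_0)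
  ultimately have "A p ^ 2 ^ t = - A t - A t - 2 * poly (of_int_poly S) r" by (simp only:)
  then have "A p ^ 2 ^ t / 2 = - A t - poly (of_int_poly S) r" by (simp add: field_simps)
  moreover have "algebraic_int (- A t - poly (of_int_poly S) r)"
    unfolding A_def using alg by (intro algebraic_int_diff algebraic_int_minus algebraic_int_cit algebraic_int_poly_of_int)
  ultimately have Ap: "rad2 (A p)" unfolding rad2_def using algebraic_int_cit[OF alg, of p] by (metis A_def)
  obtain w where "algebraic_int w" "z = A p * w"
    using poly_cyc_factor[of "Suc t" r] alg unfolding r(2) A_def by auto
  then show ?thesis using rad2_mult[OF Ap] by simp
qed

text \<open>The doubling rule applies to period \<open>p\<close> with exponent \<open>q\<close> and
  to period 1 with exponent \<open>p * q\<close> under the same condition; level 1 contributes 0 to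
  both.\<close>

lemma psum_mis_vals_rec:
  assumes m: "m \<ge> 2" and q: "q \<ge> 1" and le: "p * q + 2 \<le> 2 ^ m"
  shows "psum (mis_vals p (Suc m)) q = (\<Sum>i=2..m. psum (mis_vals p i) q)"
proof -
  have pq: "p * q \<ge> 1" "p \<ge> 1" using p_ge_2 q by simp_all
  have split: "(\<Sum>i=1..m. f i) = f 1 + (\<Sum>i=2..m. f i)" for f :: "nat \<Rightarrow> complex"
    using m by (subst sum.atLeast_Suc_atMost) (simp_all add: numeral_2_eq_2)
  have "psum (mis_vals p (Suc m)) q = (\<Sum>i=1..m. cyc_sum p i q) - (\<Sum>i=1..m. cyc_sum 1 i (p * q))"
    using cyc_sum_doubling[of p m q] cyc_sum_doubling[of 1 m "p * q"] m q le pq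
    by (simp only: psum_mis_vals[OF q])
  also have "\<dots> = (\<Sum>i=2..m. cyc_sum p i q - cyc_sum 1 i (p * q))"
    unfolding split sum_subtractf using cyc_sum_1[of p q] cyc_sum_1[of 1 "p * q"] pq q by simp
  also have "\<dots> = (\<Sum>i=2..m. psum (mis_vals p i) q)"
  proof (intro sum.cong refl)
    fix i assume "i \<in> {2..m}"
    then show "cyc_sum p i q - cyc_sum 1 i (p * q) = psum (mis_vals p i) q"
      using psum_mis_vals[OF q, of "i - 1"] by simp
  qed
  finally show ?thesis .
qed

lemma two_adic_mis_vals:
  obtains Y :: "nat \<Rightarrow> int poly" where "two_adic p Y" "\<And>m. m \<ge> 1 \<Longrightarrow> of_int_poly (Y m) = eps (mis_vals p m)"
proof -
  have p1: "p \<ge> 1" using p_ge_2 by simp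
  have ex: "\<exists>Y :: int poly. m \<ge> 1 \<longrightarrow> of_int_poly Y = eps (mis_vals p m)" for m
  proof (cases m)
    case (Suc t)
    have "algebraic_int z" if "z \<in># mis_vals p (Suc t)" for z
      using rad2_mis_vals[OF that] by (simp add: rad2_def)
    moreover have "psum (mis_vals p (Suc t)) q \<in> \<rat>" if "q \<ge> 1" for q
    proof -
      have "cyc_sum p (Suc t) q - cyc_sum 1 (Suc t) (p * q) \<in> \<int>"
        using p1 by (intro Ints_diff cyc_sum_int) auto
      then show ?thesis unfolding psum_mis_vals[OF that] by (rule subsetD[OF Ints_subset_Rats])
    qed
    ultimately obtain Y :: "int poly" where "of_int_poly Y = eps (mis_vals p (Suc t))"
      using eps_int_poly[of "mis_vals p (Suc t)"] by blast
    then show ?thesis using Suc by blast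
  qed simp
  have "\<exists>Y :: nat \<Rightarrow> int poly. \<forall>m. m \<ge> 1 \<longrightarrow> of_int_poly (Y m) = eps (mis_vals p m)"
    using ex by (intro choice) blast
  then obtain Y :: "nat \<Rightarrow> int poly" where Y: "\<And>m. m \<ge> 1 \<Longrightarrow> of_int_poly (Y m) = eps (mis_vals p m)" by blast
  have cY: "of_int (coeff (Y m) j) = coeff (eps (mis_vals p m)) j" if "m \<ge> 1" for m j
    unfolding Y[OF that, symmetric] by simp
  have "two_adic p Y"
  proof
    show "p \<ge> 2" by (rule p_ge_2)
    fix m :: nat assume m: "m \<ge> 2"
    have "of_int (coeff (Y m) 0) = (1 :: complex)" using cY[of m 0] m by simp
    then show "coeff (Y m) 0 = 1" by (simp only: of_int_eq_1_iff)
    show "even (coeff (Y m) j)" if "j \<ge> 1" for j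
    proof -
      have "rad2 (coeff (eps (mis_vals p m)) j)"
        using rad2_mis_vals[of _ "m - 1"] m that by (intro eps_coeff_rad2) simp_all
      then show ?thesis using cY[of m j] m rad2_of_int_iff[of "coeff (Y m) j"] by simp
    qed
    show "coeff (Y (Suc m)) j = coeff (\<Prod>i=2..m. Y i) j" if le: "p * j + 2 \<le> 2 ^ m" for j
    proof -
      have "of_int_poly (\<Prod>i=2..m. Y i) = eps (\<Sum>i=2..m. mis_vals p i)"
        unfolding of_int_poly_prod eps_sum using Y by (intro prod.cong) auto
      then have "of_int (coeff (\<Prod>i=2..m. Y i) j) = coeff (eps (\<Sum>i=2..m. mis_vals p i)) j"
        by (metis of_int_hom.coeff_map_poly_hom)
      also have "\<dots> = coeff (eps (mis_vals p (Suc m))) j"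
      proof (rule eps_coeff_cong[OF _ order_refl])
        fix q assume q: "1 \<le> q" "q \<le> j"
        then have "p * q \<le> p * j" by simp
        then have "p * q + 2 \<le> 2 ^ m" using le by linarith
        then show "psum (\<Sum>i=2..m. mis_vals p i) q = psum (mis_vals p (Suc m)) q"
          unfolding psum_sum using psum_mis_vals_rec[OF m q(1)] by simp
      qed
      also have "\<dots> = of_int (coeff (Y (Suc m)) j)" using cY[of "Suc m" j] by simp
      finally show ?thesis by (simp only: of_int_eq_iff)
    qed
  qed
  then show ?thesis using Y by (rule that)
qed

end

section \<open>The trace of the cycle products\<close>

lemma cyc_sum_fixed_2:
  assumes "p \<ge> 1" shows "cyc_sum 1 2 p = 2 ^ p"
proof -
  have F: "critF 1 2 = [:- 0, 1:] * [:- (- 2), 1:]"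
    using cit_small(1,2) by (simp add: critF_def)
  have lin: "root_sum [:- a, 1:] g = poly g a" for a g
  proof -
    have "proots [:- a, 1:] = {#a#}" by (rule multiset_eqI) (auto simp: order_linear)
    then show ?thesis by (simp add: root_sum_def)
  qed
  have "cyc 1 2 = cit 2" by (simp add: cyc_def)
  then have c: "poly (cyc 1 2 ^ p) 0 = 0" "poly (cyc 1 2 ^ p) (- 2) = 2 ^ p"
    using assms by (simp_all add: cit_small)
  show ?thesis unfolding cyc_sum_def F
    by (subst root_sum_mult) (simp_all only: lin c, simp_all)
qed

text \<open>\<open>b\<close> is the exact exponent of 2 in \<open>s\<close>. It must stay below the
  precision \<open>B\<close>, which is what the bounds on the trace have to secure.\<close>

lemma two_power_linear_form:
  fixes y :: "int poly"
  assumes "[:2 ^ B:] dvd y - [:1, - s:]" "4 dvd s" "\<not> 2 ^ B dvd s"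
  shows "\<exists>b u. b \<ge> 2 \<and> odd u \<and> [:2 ^ Suc b:] dvd y - [:1, - (2 ^ b * u):]"
proof -
  have s0: "s \<noteq> 0" using assms(3) by auto
  define b where "b = multiplicity 2 s"
  have le: "2 ^ i dvd s \<longleftrightarrow> i \<le> b" for i
    unfolding b_def using s0 by (intro power_dvd_iff_le_multiplicity) auto
  obtain u where u: "s = 2 ^ b * u" using le[of b] by (auto elim: dvdE)
  have "odd u"
  proof
    assume "even u"
    then have "2 ^ Suc b dvd s" unfolding u by (auto elim!: evenE)
    then have "Suc b \<le> b" by (simp only: le)
    then show False by simp
  qed
  moreover have "b \<ge> 2" using le[of 2] assms(2) by simp
  moreover have "[:2 ^ Suc b:] dvd y - [:1, - (2 ^ b * u):]"
  proof -
    have "\<not> B \<le> b" using assms(3) unfolding le .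
    then have "Suc b \<le> B" by simp
    then show ?thesis using const_dvd_trans_le[OF assms(1)] unfolding u by blast
  qed
  ultimately show ?thesis by (intro exI conjI)
qed

text \<open>\<open>p\<close> divides the trace while \<open>0 < T - s < 2 T\<close>, so a large power of 2 dividing it would
  make it too big; \<open>p \<le> 5\<close> falls outside the range of the bound on \<open>s\<close>.\<close>

lemma trace_not_dvd:
  assumes p: "prime p" and m: "m \<ge> 3" and le: "2 ^ (m - 2) \<le> p + 1" and s: "cyc_sum 1 m p = of_int s"
  defines "tau \<equiv> 2 ^ (m - 2) * (2 ^ p - 1) - s"
  shows "\<not> 2 ^ (p + 1) dvd tau" and "2 ^ (m - 2) \<le> p \<Longrightarrow> p + 2 \<le> 2 ^ (m - 1) \<Longrightarrow> \<not> 2 ^ p dvd tau"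
proof -
  have p2: "p \<ge> 2" using p by (rule prime_ge_2_nat)
  have m1: "(2 :: nat) ^ (m - 1) = 2 * 2 ^ (m - 2)" using m by (simp add: power_Suc[symmetric] Suc_diff_le numeral_2_eq_2 del: power_Suc)
  have "\<not> 2 ^ (p + 1) dvd tau \<and> (2 ^ (m - 2) \<le> p \<longrightarrow> p + 2 \<le> 2 ^ (m - 1) \<longrightarrow> \<not> 2 ^ p dvd tau)"
  proof (cases "p \<noteq> 2 \<and> 9 * 2 ^ (m - 2) < 2 ^ p + (3 :: int)")
    case True
    define T :: int where "T = 2 ^ (m - 2) * (2 ^ p - 1)"
    have "odd p" using prime_odd_nat[OF p] True p2 by simp
    then have cop: "coprime (int p) (2 ^ i)" for i by simp
    have "int p dvd (s - 2 ^ (m - 2))" by (rule cyc_sum_fixed_cong[OF p m s])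
    moreover have "int p dvd 2 ^ p - 2" using prime_power_cong[OF p, of 2] by simp
    moreover have "tau = 2 ^ (m - 2) * (2 ^ p - 2) - (s - 2 ^ (m - 2))"
      unfolding tau_def by (simp add: algebra_simps)
    ultimately have pd: "int p dvd tau" by simp
    have "norm (of_int s :: complex) < 2 ^ (m - 2) * (2 ^ p - 1)"
      using cyc_sum_fixed_bound[OF m p2] True s by simp
    then have "real_of_int \<bar>s\<bar> < real_of_int T" unfolding T_def by (simp add: norm_of_int)
    then have sT: "\<bar>s\<bar> < T" by simp
    then have pos: "0 < tau" "tau < 2 * T" unfolding tau_def T_def[symmetric] by linarith+
    \<comment> \<open>Divisibility by the odd prime \<open>p\<close> strengthens the lower bound for
      \<open>tau\<close> by a factor \<open>p\<close> over the bare power of 2.\<close>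
    have big: "int p * 2 ^ i \<le> tau" if "2 ^ i dvd tau" for i
      using divides_mult[OF pd that cop] pos by (intro zdvd_imp_le)
    have q1: "(2 :: int) ^ p \<ge> 1" by simp
    have leT: "T < int c * 2 ^ p" if "2 ^ (m - 2) \<le> c" "c \<ge> 1" for c :: nat
    proof -
      have "(2 :: int) ^ (m - 2) \<le> int c" using of_nat_mono[OF that(1), where 'a = int] by simp
      then have "T \<le> int c * (2 ^ p - 1)" unfolding T_def by (intro mult_right_mono) simp_all
      then show ?thesis using that(2) by (simp add: algebra_simps)
    qed
    have lt1: "int (p + 1) * 2 ^ p \<le> int p * 2 ^ (p + 1)" using p2 by (simp add: algebra_simps)
    show ?thesis
    \<comment> \<open>In the first case positivity of \<open>s\<close> gives
      \<open>tau \<le> T\<close>. In the second only \<open>tau < 2 * T\<close> is at hand, but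
      there \<open>2 * 2 ^ (m - 2) \<le> p + 1\<close> makes \<open>T\<close> smaller.\<close>
    proof (cases "p + 2 \<le> 2 ^ (m - 1)")
      case True
      have "nonneg_real (cyc_sum 1 (Suc (m - 1)) p)"
        using m p2 True by (intro cyc_sum_fixed_nonneg) auto
      then have "s \<ge> 0" using m s by (simp add: nonneg_real_def)
      then have "tau \<le> T" by (simp add: tau_def T_def)
      have "\<not> 2 ^ (p + 1) dvd tau"
      proof
        assume "2 ^ (p + 1) dvd tau"
        then have "int p * 2 ^ (p + 1) \<le> tau" by (rule big)
        moreover have "T < int (p + 1) * 2 ^ p" using le by (intro leT) simp_all
        ultimately show False using lt1 \<open>tau \<le> T\<close> by linarith
      qed
      moreover have "\<not> 2 ^ p dvd tau" if "2 ^ (m - 2) \<le> p"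
      proof
        assume "2 ^ p dvd tau"
        then have "int p * 2 ^ p \<le> tau" by (rule big)
        moreover have "T < int p * 2 ^ p" using that p2 by (intro leT) simp_all
        ultimately show False using \<open>tau \<le> T\<close> by linarith
      qed
      ultimately show ?thesis by blast
    next
      case False
      have "2 * T < int (p + 1) * 2 ^ p"
      proof -
        have "2 * (2 :: nat) ^ (m - 2) \<le> p + 1" using False m1 by simp
        from of_nat_mono[OF this, where 'a = int]
        have "2 * (2 :: int) ^ (m - 2) \<le> int (p + 1)" by simp
        then have "(2 * 2 ^ (m - 2)) * (2 ^ p - 1) \<le> int (p + 1) * (2 ^ p - 1)" by (intro mult_right_mono) simp_all
        then show ?thesis unfolding T_def by (simp add: algebra_simps)
      qed
      have "\<not> 2 ^ (p + 1) dvd tau"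
      proof
        assume "2 ^ (p + 1) dvd tau"
        then have "int p * 2 ^ (p + 1) \<le> tau" by (rule big)
        then show False using lt1 pos(2) \<open>2 * T < int (p + 1) * 2 ^ p\<close> by linarith
      qed
      then show ?thesis using False by blast
    qed
  next
    case False
    have "p \<le> 5"
    proof (rule ccontr)
      assume "\<not> p \<le> 5"
      then have "p \<ge> 6" by simp
      then have "9 * (int p + 1) < 2 ^ p + 3"
      proof (induction p rule: nat_induct_at_least)
        case (Suc p)
        then show ?case by simp
      qed simp
      moreover have "(2 :: int) ^ (m - 2) \<le> int p + 1" using of_nat_mono[OF le, where 'a = int] by simp
      then have "9 * (2 :: int) ^ (m - 2) \<le> 9 * (int p + 1)" by (rule mult_left_mono) simp
      ultimately have "9 * 2 ^ (m - 2) < 2 ^ p + (3 :: int)" by (rule le_less_trans[rotated])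
      then show False using False \<open>p \<ge> 6\<close> by simp
    qed
    then have "p \<in> {2, 3, 4, 5}" using p2 by auto
    moreover have "\<not> prime (4 :: nat)" by (simp add: prime_nat_iff) (rule exI[of _ 2], simp)
    ultimately have p235: "p = 2 \<or> p = 3 \<or> p = 5" using p by auto
    have "m - 2 < 3"
    proof (rule ccontr)
      assume "\<not> m - 2 < 3"
      then have "(2 :: nat) ^ 3 \<le> 2 ^ (m - 2)" by (intro power_increasing) auto
      then show False using le \<open>p \<le> 5\<close> by simp
    qed
    then have m34: "m = 3 \<or> m = 4" using m by auto
    consider "p = 2" "m = 3" | "p = 3" "m = 3" | "p = 3" "m = 4" | "p = 5" "m = 4"
      using p235 m34 le False by auto
    then show ?thesis
    proof cases
      case 1
      then have "s = 4" using s cyc_sum_fixed_small(1) by simp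
      then show ?thesis using 1 by (simp add: tau_def)
    next
      case 2
      then have "s = 2" using s cyc_sum_fixed_small(2) by simp
      then show ?thesis using 2 by (simp add: tau_def)
    next
      case 3
      then have "s = 10" using s cyc_sum_fixed_small(3) by simp
      then show ?thesis using 3 by (simp add: tau_def)
    next
      case 4
      then have "s = 24" using s cyc_sum_fixed_small(4) by simp
      then show ?thesis using 4 by (simp add: tau_def)
    qed
  qed
  then show "\<not> 2 ^ (p + 1) dvd tau" "2 ^ (m - 2) \<le> p \<Longrightarrow> p + 2 \<le> 2 ^ (m - 1) \<Longrightarrow> \<not> 2 ^ p dvd tau"
    by blast+
qed

context two_adic
begin

text \<open>Up to the level \<open>M\<close> the linear form modulo \<open>2 ^ (2 * p + 1)\<close>
  suffices. Beyond it, the exponent of 2 in the trace and the precision both grow by one per level,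
  so the comparison can be made at \<open>M\<close>.\<close>

lemma y_linear_odd:
  assumes p: "prime p" and Y: "\<And>m. m \<ge> 1 \<Longrightarrow> of_int_poly (Y m) = eps (mis_vals p m)" and m: "m \<ge> 2"
  shows "\<exists>b u. b \<ge> 2 \<and> odd u \<and> [:2 ^ Suc b:] dvd y m - [:1, - (2 ^ b * u):]"
proof -
  have p1: "p \<ge> 1" using p2 by simp
  have tau: "of_int (tau m) = cyc_sum p m 1 - cyc_sum 1 m p" if m1: "m \<ge> 1" for m
  proof -
    obtain t where t: "m = Suc t" using m1 by (cases m) auto
    have "of_int (coeff (Y m) 1) = coeff (eps (mis_vals p m)) 1" unfolding Y[OF m1, symmetric] by simp
    then show ?thesis unfolding t
      using eps_coeff_1[of "mis_vals p (Suc t)"] psum_mis_vals[OF p, of 1 t] by (simp add: tau_def)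
  qed
  have small: "\<not> 2 ^ (p + 1) dvd tau m \<and> (2 ^ (m - 2) \<le> p \<longrightarrow> p + 2 \<le> 2 ^ (m - 1) \<longrightarrow> \<not> 2 ^ p dvd tau m)"
    if m: "m \<ge> 3" "2 ^ (m - 2) \<le> p + 1" for m
  proof -
    obtain s where s: "cyc_sum 1 m p = of_int s" using cyc_sum_int[of 1 m p] m(1) by (auto elim: Ints_cases)
    have "of_int (tau m) = (of_int (2 ^ (m - 2) * (2 ^ p - 1) - s) :: complex)"
      using tau[of m] m(1) unfolding cyc_sum_value(2)[OF p1 m(1)] s by simp
    then have "tau m = 2 ^ (m - 2) * (2 ^ p - 1) - s" by (simp only: of_int_eq_iff)
    then show ?thesis using trace_not_dvd[OF p m s] by simp
  qed
  have four: "4 dvd 2 ^ p * tau m" for m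
  proof -
    have "(2 :: int) ^ 2 dvd 2 ^ p" using p2 by (rule le_imp_power_dvd)
    then show ?thesis by simp
  qed
  have shift: "2 ^ (a + p + k) dvd 2 ^ p * (2 ^ k * x) \<longleftrightarrow> 2 ^ a dvd x" for a k and x :: int
  proof -
    have "(2 :: int) ^ (a + p + k) = (2 ^ p * 2 ^ k) * 2 ^ a" by (simp add: power_add mult_ac)
    then show ?thesis by (simp only: mult.assoc[symmetric] dvd_mult_cancel_left) simp
  qed
  have base: ?thesis if "\<not> 2 ^ (p + 1) dvd tau m"
  proof (rule two_power_linear_form[OF y_linear[OF m] four])
    have "2 * p + 1 = (p + 1) + p + 0" by simp
    then show "\<not> 2 ^ (2 * p + 1) dvd 2 ^ p * tau m"
      using that shift[of "p + 1" 0 "tau m"] by (simp only: power_0 mult_1 simp_thms)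
  qed
  \<comment> \<open>The first level at which the doubling of traces is guaranteed. Minimality gives
    \<open>2 ^ (M - 2) \<le> p + 1\<close>, which is the range of
    \<open>trace_not_dvd\<close>.\<close>
  define M where "M = (LEAST M. p + 2 \<le> 2 ^ (M - 1))"
  have "p + 2 \<le> 2 ^ (p + 3 - 1)" using less_exp[of "p + 2"] by (simp add: less_imp_le)
  then have M: "p + 2 \<le> 2 ^ (M - 1)" unfolding M_def by (rule LeastI)
  have M3: "M \<ge> 3"
  proof (rule ccontr)
    assume "\<not> M \<ge> 3"
    then have "(2 :: nat) ^ (M - 1) \<le> 2 ^ 1" by (intro power_increasing) auto
    then show False using M p2 by simp
  qed
  have "\<not> p + 2 \<le> 2 ^ (M - 1 - 1)"
    using M3 unfolding M_def by (intro not_less_Least) simp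
  then have Mle: "2 ^ (M - 2) \<le> p + 1" by (simp add: numeral_2_eq_2)
  show ?thesis
  proof (cases "m = 2")
    case True
    have "of_int (tau 2) = (of_int (2 ^ p - 2) :: complex)"
      using tau[of 2] cyc_sum_value(1)[OF p1] cyc_sum_fixed_2[OF p1] by simp
    then have t2: "tau 2 = 2 ^ p - 2" by (simp only: of_int_eq_iff)
    have "(2 :: int) ^ 2 \<le> 2 ^ p" using p2 by (intro power_increasing) auto
    then have "\<not> 2 ^ (p + 1) dvd tau 2" unfolding t2 by (intro zdvd_not_zless) auto
    then show ?thesis using base True by simp
  next
    case False
    then have m3: "m \<ge> 3" using m by simp
    show ?thesis
    proof (cases "m \<le> M")
      case True
      then have "(2 :: nat) ^ (m - 2) \<le> 2 ^ (M - 2)" by (intro power_increasing) auto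
      then have "(2 :: nat) ^ (m - 2) \<le> p + 1" using Mle by (rule le_trans)
      from conjunct1[OF small[OF m3 this]] show ?thesis by (rule base)
    next
      case False
      define k where "k = m - M"
      have mk: "m = M + k" "k \<ge> 1" using False by (simp_all add: k_def)
      have tm: "tau m = 2 ^ k * tau M" unfolding mk(1) by (rule tau_iterate[OF M3 M])
      show ?thesis
      proof (cases "2 * p + 2 \<le> 2 ^ (M - 1)")
        case True
        show ?thesis
        proof (rule two_power_linear_form[OF _ four])
          show "[:2 ^ (2 * p + 1 + k):] dvd y m - [:1, - (2 ^ p * tau m):]"
            unfolding mk(1) by (rule y_linear_strong[OF M3 M True])
          have "2 * p + 1 + k = (p + 1) + p + k" by simp
          then show "\<not> 2 ^ (2 * p + 1 + k) dvd 2 ^ p * tau m"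
            using conjunct1[OF small[OF M3 Mle]] shift[of "p + 1" k "tau M"] unfolding tm by (simp only: simp_thms)
        qed
      next
        case False
        \<comment> \<open>Only the weak linear form is available here, with one digit less. The
          failed inequality gives \<open>2 ^ (M - 2) \<le> p\<close>, and then the sharper statement
          that \<open>2 ^ p\<close> does not divide \<open>tau M\<close> makes up for it.\<close>
        have "(2 :: nat) ^ (M - 1) = 2 * 2 ^ (M - 2)"
          using M3 by (simp add: power_Suc[symmetric] Suc_diff_le numeral_2_eq_2 del: power_Suc)
        then have lep: "2 ^ (M - 2) \<le> p" using False by simp
        obtain k' where k': "k = Suc k'" using mk(2) by (cases k) auto
        show ?thesis
        proof (rule two_power_linear_form[OF _ four])
          show "[:2 ^ (2 * p + 1 + k'):] dvd y m - [:1, - (2 ^ p * tau m):]"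
            using y_linear_weak[OF M3 M, of k'] by (simp add: mk(1) k')
          have "2 * p + 1 + k' = p + p + k" by (simp add: k')
          moreover have "\<not> 2 ^ p dvd tau M" using small[OF M3 Mle] lep M by blast
          ultimately show "\<not> 2 ^ (2 * p + 1 + k') dvd 2 ^ p * tau m"
            using shift[of p k "tau M"] unfolding tm by (simp only: simp_thms)
        qed
      qed
    qed
  qed
qed

end

theorem theorem1p3:
  fixes m n p :: nat and c0 :: complex
  assumes "m \<ge> 2"
    and "prime p" and "p \<le> 1024"
    and "n > 0" and "n \<noteq> p" and "p dvd n"
    and "poly (map_poly of_int (misiurewicz_poly m n)) c0 = 0"
    and "irreducible (map_poly of_int (misiurewicz_poly m p) :: rat poly)"
    and "irreducible (map_poly of_int (misiurewicz_poly m n) :: rat poly)"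
  shows "\<not> algebraic_unit (poly (map_poly of_int (misiurewicz_poly m p)) c0)"
proof
  assume unit: "algebraic_unit (poly (map_poly of_int (misiurewicz_poly m p)) c0)"
  obtain t where t: "m = Suc t" using assms(1) by (cases m) auto
  obtain k where n: "n = p * k" using assms(6) by (elim dvdE)
  have p2: "p \<ge> 2" using assms(2) by (rule prime_ge_2_nat)
  have "k \<noteq> 0" "k \<noteq> 1" using assms(4,5) n by auto
  then have k: "k \<ge> 2" "k > 0" by auto
  obtain Y where Y: "two_adic p Y" "\<And>m. m \<ge> 1 \<Longrightarrow> of_int_poly (Y m) = eps (mis_vals p m)"
    by (rule two_adic_mis_vals[OF assms(2)]) (rule that; assumption)
  interpret two_adic p Y by (rule Y(1))
  obtain b u where b: "b \<ge> 2" "odd u" "[:2 ^ Suc b:] dvd y m - [:1, - (2 ^ b * u):]"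
    using y_linear_odd[OF assms(2) Y(2) assms(1)] by blast
  have unit_at: "algebraic_unit (\<Prod>w\<in>prim_roots k. 2 ^ p * z - w)" if z: "z \<in># mis_vals p m" for z
  proof -
    obtain c1 where c1: "poly (of_int_poly (misiurewicz_poly m p)) c1 = 0" "z = poly (cyc p m) c1"
      by (rule mis_vals_root[OF z])
    have mon: "monic (misiurewicz_poly m n)" "monic (misiurewicz_poly m p)"
      unfolding t using assms(4) p2 by (auto intro!: misiurewicz_poly(2))
    have "algebraic_unit (poly (of_int_poly (misiurewicz_poly m n)) c1)"
      by (rule irreducible_unit_transfer[OF mon(1) assms(9,7) mon(2) c1(1) unit])
    then show ?thesis using misiurewicz_unit_multiplier[OF assms(2) k(1), of t c1] c1 unfolding t n by simp
  qed
  have "norm (\<Prod>w\<in>prim_roots k. poly (of_int_poly (y m)) w) = 1"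
    unfolding y_def using assms(1) by (intro norm_eps_prim_roots[OF k(2) Y(2) unit_at]) auto
  then show False by (rule cyclotomic_norm_not_unit[OF k(1) b(3,1,2)])
qed

end
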